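(* Let $(\Omega,\mathcal{F},\mu,T)$ be a dynamical system with canonical decomposition $\mu=\mu_B+\mu_m+\mu_{wm}+\mu_{ne}$. Then: (i) if $\mu_{ne}\ne0$, the Poisson suspension $(M_\Omega,\mathcal{M}_{\mathcal{F}},\mathcal{P}_{\mu_{ne}},T^\star)$ is not ergodic; (ii) $(M_\Omega,\mathcal{M}_{\mathcal{F}},\mathcal{P}_{\mu_{wm}},T^\star)$ is weakly mixing and, if $\mu_{wm}\neq0$, not mixing; (iii) $(M_\Omega,\mathcal{M}_{\mathcal{F}},\mathcal{P}_{\mu_m},T^\star)$ is mixing of all orders; (iv) $(M_\Omega,\mathcal{M}_{\mathcal{F}},\mathcal{P}_{\mu_B},T^\star)$ is Bernoulli.
   Context: **Dynamical systems.** A dynamical system $(\Omega,\mathcal{F},\mu,T)$ is a $\sigma$-finite Lebesgue space (i.e. $\mu$ is equivalent to a probability measure $\nu$ making $(\Omega,\mathcal{F},\nu)$ a Lebesgue space) with a bijective bimeasurable $\mu$-preserving map $T$; $\mu$ may be infinite. **Canonical decomposition.** A set $A$ is wandering if the sets $T^{-n}A$, $n\in\mathbb{Z}$, are disjoint; $\mathfrak{D}$ is the measurable union of all wandering sets and $\mathfrak{C}=\Omega\setminus\mathfrak{D}$. There is a unique partition (mod $\mu$) $\{\mathfrak{P},\mathcal{N}\}$ of $\Omega$ into $T$-invariant sets such that there is a $T$-invariant probability measure equivalent to $\mu_{|\mathfrak{P}}$ (or $\mu(\mathfrak{P})=0$) and no $T$-invariant probability measure absolutely continuous with respect to $\mu_{|\mathcal{N}}$.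 There is a partition $\{\mathcal{N}_0,\mathcal{N}_+\}$ of $\Omega$ into $T$-invariant sets such that $\mu(A\cap T^{-k}A)\to0$ as $k\to\infty$ for all $A\subset\mathcal{N}_0$ with $0<\mu(A)<\infty$, and $\limsup_{k\to\infty}\mu(A\cap T^{-k}A)>0$ for all $A\subset\mathcal{N}_+$ with $\mu(A)>0$. One has $\mathfrak{D}\subset\mathcal{N}_0$, $\mathfrak{P}\subset\mathcal{N}_+\subset\mathfrak{C}$. The canonical decomposition is $\mu=\mu_B+\mu_m+\mu_{wm}+\mu_{ne}$ with $\mu_B=\mu_{|\mathfrak{D}}$, $\mu_m=\mu_{|\mathcal{N}_0\cap\mathfrak{C}}$, $\mu_{wm}=\mu_{|\mathcal{N}_+\cap\mathcal{N}}$, $\mu_{ne}=\mu_{|\mathfrak{P}}$. **Poisson suspensions.** Fix a countable measurable partition $\{A_n\}$ of $\Omega$ with $\mu(A_n)<\infty$. $M_\Omega$ is the space of measures $\nu$ on $(\Omega,\mathcal{F})$ with $\nu(A_n)\in\mathbb{N}$ for all $n$, $\mathcal{M}_{\mathcal{F}}$ the smallest $\sigma$-algebra making $\nu\mapsto\nu(A)$ measurable for all $A\in\mathcal{F}$ of finite $\mu$-measure, and $N$ the identity on $M_\Omega$. For a measure $\mu'\le\mu$ on $\Omega$, $\mathcal{P}_{\mu'}$ is the unique probability on $(M_\Omega,\mathcal{M}_{\mathcal{F}})$ under which, for every finite collection of disjoint sets $B_i$ of finite $\mu'$-measure, the $N(B_i)$ are independent Poisson variables of parameters $\mu'(B_i)$.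 If $\mu'$ is $T$-invariant, the map $T^\star(\nu)=\nu\circ T^{-1}$ preserves $\mathcal{P}_{\mu'}$, and $(M_\Omega,\mathcal{M}_{\mathcal{F}},\mathcal{P}_{\mu'},T^\star)$ is the Poisson suspension. **Ergodic properties** (for a probability-preserving system $(Y,\mathcal{Y},p,S)$): weakly mixing means $\frac1n\sum_{k=1}^n|p(A\cap S^{-k}B)-p(A)p(B)|\to0$ for all $A,B$; mixing means $p(A\cap S^{-n}B)\to p(A)p(B)$. Mixing of order $m$ means that for all $A_1,\dots,A_m$ and all strictly increasing integer sequences $(n_{1,k})_k,\dots,(n_{m,k})_k$, $p(S^{n_{1,k}}A_1\cap S^{n_{1,k}+n_{2,k}}A_2\cap\cdots\cap S^{n_{1,k}+\cdots+n_{m,k}}A_m)\to p(A_1)\cdots p(A_m)$; mixing of all orders means this for every $m$. A system is Bernoulli if it is isomorphic to the shift system of an i.i.d. process (Bernoulli scheme). *)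

theory Defs
  imports "HOL-Probability.Probability"
begin

section \<open>Isomorphism modulo null sets and Lebesgue spaces\<close>

text \<open>
  \<open>f\<close> is a bimeasurable, measure preserving bijection between the full-measure sets \<open>X0\<close> and \<open>Y0\<close>.
  As usual for Lebesgue spaces, measurability refers to the completed sigma-algebras.
\<close>

definition mod0_isomorphism ::
  "'a measure \<Rightarrow> 'b measure \<Rightarrow> 'a set \<Rightarrow> 'b set \<Rightarrow> ('a \<Rightarrow> 'b) \<Rightarrow> bool" where
  "mod0_isomorphism M N X0 Y0 f \<longleftrightarrow>
     X0 \<in> sets (completion M) \<and> space M - X0 \<in> null_sets (completion M) \<and>
     Y0 \<in> sets (completion N) \<and> space N - Y0 \<in> null_sets (completion N) \<and>
     bij_betw f X0 Y0 \<and>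
     f \<in> restrict_space (completion M) X0 \<rightarrow>\<^sub>M restrict_space (completion N) Y0 \<and>
     the_inv_into X0 f \<in> restrict_space (completion N) Y0 \<rightarrow>\<^sub>M restrict_space (completion M) X0 \<and>
     distr (restrict_space (completion M) X0) (restrict_space (completion N) Y0) f
       = restrict_space (completion N) Y0"

text \<open>
  Lebesgue probability spaces in the sense of Rokhlin: complete, and isomorphic mod 0 to an interval
  \<open>[0, s]\<close> with Lebesgue measure together with countably many atoms.  In the model \<open>L\<close> below, the
  \<open>n\<close>-th atom, of mass \<open>p n\<close> (possibly 0), is placed at the point \<open>- (n + 1)\<close>.
\<close>

definition lebesgue_prob_space :: "'a measure \<Rightarrow> bool" where
  "lebesgue_prob_space \<nu> \<longleftrightarrow>
     prob_space \<nu> \<and> complete_measure \<nu> \<and>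
     (\<exists>(L :: real measure) (s :: real) (p :: nat \<Rightarrow> ennreal) X0 Y0 f.
        prob_space L \<and> sets L = sets borel \<and>
        (\<forall>B \<in> sets borel. emeasure L B =
           emeasure lborel (B \<inter> {0..s}) + (\<Sum>n. p n * indicator B (- real (Suc n)))) \<and>
        mod0_isomorphism \<nu> L X0 Y0 f)"

section \<open>Dynamical systems\<close>

definition equivalent_measures :: "'a measure \<Rightarrow> 'a measure \<Rightarrow> bool" where
  "equivalent_measures M N \<longleftrightarrow>
     sets M = sets N \<and> absolutely_continuous M N \<and> absolutely_continuous N M"

definition dynamical_system :: "'a measure \<Rightarrow> ('a \<Rightarrow> 'a) \<Rightarrow> bool" where
  "dynamical_system M T \<longleftrightarrow>
     sigma_finite_measure M \<and>
     (\<exists>\<nu>. lebesgue_prob_space \<nu> \<and> equivalent_measures M \<nu>) \<and>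
     bij_betw T (space M) (space M) \<and>
     T \<in> M \<rightarrow>\<^sub>M M \<and> the_inv_into (space M) T \<in> M \<rightarrow>\<^sub>M M \<and>
     distr M M T = M"

text \<open>
  The set \<open>S\<^sup>n A\<close> for an integer \<open>n\<close>.  Forward images (for \<open>n \<ge> 0\<close>) and preimages (for \<open>n < 0\<close>) are
  both taken inside \<open>space M\<close>, so that this is also meaningful if \<open>S\<close> maps \<open>space M\<close> into itself
  only almost everywhere (as the map of a Poisson suspension does).
\<close>

definition iterate_set :: "'a measure \<Rightarrow> ('a \<Rightarrow> 'a) \<Rightarrow> int \<Rightarrow> 'a set \<Rightarrow> 'a set" where
  "iterate_set M S n A =
     (if 0 \<le> n then (S ^^ nat n) ` A \<inter> space M else (S ^^ nat (- n)) -` A \<inter> space M)"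

text \<open>Invariance of sets is understood modulo null sets.\<close>

definition invariant_set :: "'a measure \<Rightarrow> ('a \<Rightarrow> 'a) \<Rightarrow> 'a set \<Rightarrow> bool" where
  "invariant_set M S A \<longleftrightarrow>
     A \<in> sets M \<and> sym_diff (iterate_set M S (- 1) A) A \<in> null_sets M"

section \<open>The canonical decomposition\<close>

definition wandering :: "'a measure \<Rightarrow> ('a \<Rightarrow> 'a) \<Rightarrow> 'a set \<Rightarrow> bool" where
  "wandering M T A \<longleftrightarrow>
     A \<in> sets M \<and> disjoint_family (\<lambda>n :: int. iterate_set M T (- n) A)"

text \<open>
  The measurable union (essential supremum) of a possibly uncountable family of sets, which is
  determined up to a null set: the least measurable set, mod null sets, containing all of them.
\<close>

definition is_measurable_union :: "'a measure \<Rightarrow> 'a set set \<Rightarrow> 'a set \<Rightarrow> bool" where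
  "is_measurable_union M \<A> D \<longleftrightarrow>
     D \<in> sets M \<and> (\<forall>A \<in> \<A>. A - D \<in> null_sets M) \<and>
     (\<forall>E \<in> sets M. (\<forall>A \<in> \<A>. A - E \<in> null_sets M) \<longrightarrow> D - E \<in> null_sets M)"

text \<open>The restriction of \<open>M\<close> to \<open>E\<close>, as a measure on the whole space.\<close>

definition measure_on :: "'a measure \<Rightarrow> 'a set \<Rightarrow> 'a measure" where
  "measure_on M E = density M (indicator E)"

definition invariant_prob :: "'a measure \<Rightarrow> ('a \<Rightarrow> 'a) \<Rightarrow> 'a measure \<Rightarrow> bool" where
  "invariant_prob M T \<nu> \<longleftrightarrow> prob_space \<nu> \<and> sets \<nu> = sets M \<and> distr \<nu> M T = \<nu>"

definition invariant_partition ::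
  "'a measure \<Rightarrow> ('a \<Rightarrow> 'a) \<Rightarrow> 'a set \<Rightarrow> 'a set \<Rightarrow> bool" where
  "invariant_partition M T X Y \<longleftrightarrow>
     invariant_set M T X \<and> invariant_set M T Y \<and> X \<inter> Y = {} \<and> X \<union> Y = space M"

text \<open>
  \<open>D\<close> and \<open>C\<close> are the dissipative and conservative parts, \<open>Pos\<close> and \<open>Nul\<close> the positive part and
  its complement, and \<open>N0\<close> and \<open>Np\<close> the pair written \<open>\<N>\<^sub>0\<close>, \<open>\<N>\<^sub>+\<close> in the literature.
  The measures of the decomposition are \<open>measure_on M D\<close>, \<open>measure_on M (N0 \<inter> C)\<close>,
  \<open>measure_on M (Np \<inter> Nul)\<close> and \<open>measure_on M Pos\<close>.
\<close>

definition canonical_decomposition ::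
  "'a measure \<Rightarrow> ('a \<Rightarrow> 'a) \<Rightarrow> 'a set \<Rightarrow> 'a set \<Rightarrow> 'a set \<Rightarrow> 'a set \<Rightarrow> 'a set \<Rightarrow> 'a set \<Rightarrow> bool" where
  "canonical_decomposition M T D C Pos Nul N0 Np \<longleftrightarrow>
     is_measurable_union M {A. wandering M T A} D \<and> C = space M - D \<and>
     invariant_partition M T Pos Nul \<and>
     (emeasure M Pos = 0 \<or>
       (\<exists>\<nu>. invariant_prob M T \<nu> \<and> equivalent_measures \<nu> (measure_on M Pos))) \<and>
     \<not> (\<exists>\<nu>. invariant_prob M T \<nu> \<and> absolutely_continuous (measure_on M Nul) \<nu>) \<and>
     invariant_partition M T N0 Np \<and>
     (\<forall>A \<in> sets M. A \<subseteq> N0 \<and> 0 < emeasure M A \<and> emeasure M A < \<infinity> \<longrightarrow>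
        (\<lambda>k. emeasure M (A \<inter> iterate_set M T (- int k) A)) \<longlonglongrightarrow> 0) \<and>
     (\<forall>A \<in> sets M. A \<subseteq> Np \<and> 0 < emeasure M A \<longrightarrow>
        0 < limsup (\<lambda>k. emeasure M (A \<inter> iterate_set M T (- int k) A)))"

section \<open>Poisson suspensions\<close>

definition finite_measure_partition :: "'a measure \<Rightarrow> (nat \<Rightarrow> 'a set) \<Rightarrow> bool" where
  "finite_measure_partition M A \<longleftrightarrow>
     (\<forall>n. A n \<in> sets M \<and> emeasure M (A n) < \<infinity>) \<and> disjoint_family A \<and> (\<Union>n. A n) = space M"

definition configurations :: "'a measure \<Rightarrow> (nat \<Rightarrow> 'a set) \<Rightarrow> 'a measure set" where
  "configurations M A = {\<nu>. sets \<nu> = sets M \<and> (\<forall>n. emeasure \<nu> (A n) \<in> \<nat>)}"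

text \<open>
  Configurations with the smallest sigma-algebra making the evaluations at sets of finite measure
  measurable; only the space and the sigma-algebra of this measure are relevant.
\<close>

definition configuration_space :: "'a measure \<Rightarrow> (nat \<Rightarrow> 'a set) \<Rightarrow> 'a measure measure" where
  "configuration_space M A =
     (SUP B \<in> {B \<in> sets M. emeasure M B < \<infinity>}.
        vimage_algebra (configurations M A) (\<lambda>\<nu>. emeasure \<nu> B) borel)"

lemma space_configuration_space: "space (configuration_space M A) = configurations M A"
proof -
  have "{} \<in> {B \<in> sets M. emeasure M B < \<infinity>}" by simp
  then show ?thesis
    unfolding configuration_space_def by (subst space_Sup_eq_UN) auto
qed

lemma measurable_emeasure_configuration_space:
  assumes "B \<in> sets M" "emeasure M B < \<infinity>"
  shows "(\<lambda>\<nu>. emeasure \<nu> B) \<in> borel_measurable (configuration_space M A)"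
  unfolding configuration_space_def
  by (rule measurable_Sup1[where m = "vimage_algebra (configurations M A) (\<lambda>\<nu>. emeasure \<nu> B) borel"])
     (use assms in \<open>auto intro!: measurable_vimage_algebra1\<close>)

text \<open>
  \<open>P\<close> is the (unique) law \<open>\<P>\<^bsub>\<mu>'\<^esub>\<close> of the Poisson measure of intensity \<open>\<mu>' \<le> M\<close>.
  A Poisson variable of parameter 0 is almost surely 0 (as \<open>0 ^ 0 = 1\<close>).
\<close>

definition poisson_measure ::
  "'a measure \<Rightarrow> (nat \<Rightarrow> 'a set) \<Rightarrow> 'a measure \<Rightarrow> 'a measure measure \<Rightarrow> bool" where
  "poisson_measure M A \<mu>' P \<longleftrightarrow>
     prob_space P \<and> sets P = sets (configuration_space M A) \<and>
     (\<forall>(I :: nat set) B. finite I \<and> disjoint_family_on B I \<and>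
        (\<forall>i \<in> I. B i \<in> sets M \<and> emeasure \<mu>' (B i) < \<infinity>) \<longrightarrow>
        prob_space.indep_vars P (\<lambda>_. borel) (\<lambda>i \<nu>. emeasure \<nu> (B i)) I \<and>
        (\<forall>i \<in> I. \<forall>k :: nat. measure P {\<nu> \<in> space P. emeasure \<nu> (B i) = of_nat k} =
           measure \<mu>' (B i) ^ k / fact k * exp (- measure \<mu>' (B i))))"

definition suspension_map :: "'a measure \<Rightarrow> ('a \<Rightarrow> 'a) \<Rightarrow> 'a measure \<Rightarrow> 'a measure" where
  "suspension_map M T \<nu> = distr \<nu> M T"

section \<open>Ergodic properties of probability preserving systems\<close>

definition ergodic :: "'a measure \<Rightarrow> ('a \<Rightarrow> 'a) \<Rightarrow> bool" where
  "ergodic P S \<longleftrightarrow> (\<forall>A. invariant_set P S A \<longrightarrow> measure P A = 0 \<or> measure P A = 1)"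

definition weakly_mixing :: "'a measure \<Rightarrow> ('a \<Rightarrow> 'a) \<Rightarrow> bool" where
  "weakly_mixing P S \<longleftrightarrow>
     (\<forall>A \<in> sets P. \<forall>B \<in> sets P.
        (\<lambda>n. (\<Sum>k = 1..n. \<bar>measure P (A \<inter> iterate_set P S (- int k) B) - measure P A * measure P B\<bar>)
              / real n) \<longlonglongrightarrow> 0)"

definition mixing :: "'a measure \<Rightarrow> ('a \<Rightarrow> 'a) \<Rightarrow> bool" where
  "mixing P S \<longleftrightarrow>
     (\<forall>A \<in> sets P. \<forall>B \<in> sets P.
        (\<lambda>n. measure P (A \<inter> iterate_set P S (- int n) B)) \<longlonglongrightarrow> measure P A * measure P B)"

definition mixing_of_order :: "nat \<Rightarrow> 'a measure \<Rightarrow> ('a \<Rightarrow> 'a) \<Rightarrow> bool" where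
  "mixing_of_order m P S \<longleftrightarrow>
     (\<forall>(A :: nat \<Rightarrow> 'a set) (n :: nat \<Rightarrow> nat \<Rightarrow> int).
        (\<forall>i \<in> {1..m}. A i \<in> sets P \<and> strict_mono (n i)) \<longrightarrow>
        (\<lambda>k. measure P (\<Inter>i \<in> {1..m}. iterate_set P S (\<Sum>j = 1..i. n j k) (A i)))
          \<longlonglongrightarrow> (\<Prod>i = 1..m. measure P (A i)))"

definition mixing_of_all_orders :: "'a measure \<Rightarrow> ('a \<Rightarrow> 'a) \<Rightarrow> bool" where
  "mixing_of_all_orders P S \<longleftrightarrow> (\<forall>m \<ge> 1. mixing_of_order m P S)"

definition isomorphic_systems ::
  "'a measure \<Rightarrow> ('a \<Rightarrow> 'a) \<Rightarrow> 'b measure \<Rightarrow> ('b \<Rightarrow> 'b) \<Rightarrow> bool" where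
  "isomorphic_systems P S Q R \<longleftrightarrow>
     (\<exists>X0 Y0 f. mod0_isomorphism P Q X0 Y0 f \<and> (\<forall>x \<in> X0. S x \<in> X0 \<and> f (S x) = R (f x)))"

text \<open>
  The shift of an i.i.d. sequence of real random variables of law \<open>q\<close> indexed by the integers.
  Real state space is no restriction, as every Lebesgue probability space is isomorphic mod 0 to a
  Borel probability on the reals.
\<close>

definition bernoulli :: "'a measure \<Rightarrow> ('a \<Rightarrow> 'a) \<Rightarrow> bool" where
  "bernoulli P S \<longleftrightarrow>
     (\<exists>q :: real measure. prob_space q \<and> sets q = sets borel \<and>
        isomorphic_systems P S (\<Pi>\<^sub>M _ \<in> (UNIV :: int set). q) (\<lambda>x n. x (n + 1)))"

end

theory Submission
  imports Defs
begin

text \<open>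
  Counts in disjoint regions are independent, so two events observed in regions \<open>G\<close> and \<open>H\<close> of finite
  measure decorrelate up to twice the mass of \<open>G \<inter> H\<close>, the probability that the overlap contains a point
  being at most its mass.  Mixing properties of the suspension are thus read off from
  \<open>\<mu> (G \<inter> T\<^sup>-\<^sup>k G)\<close>: this tends to 0 on \<open>\<N>\<^sub>0\<close>, which gives mixing of all orders; it does not on \<open>\<N>\<^sub>+\<close>,
  and then the events that \<open>G\<close> and \<open>T\<^sup>-\<^sup>k G\<close> contain no points stay correlated.  On the null part it tends
  to 0 in the Cesaro sense: otherwise some set on which the upper limit of the ergodic averages of an indicator exceeds
  \<open>c > 0\<close> would be invariant, non-null and, by the maximal ergodic theorem, of finite measure.
  On the positive part, a superlevel set \<open>F\<close> of the density of the invariant probability is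
  invariant with \<open>0 < \<mu> F < \<infinity>\<close>, so that the absence of points in \<open>F\<close> is a nontrivial invariant event.
  The dissipative part is a disjoint union of translates of one wandering set \<open>W\<close>; the
  restrictions of the configuration to these translates are i.i.d., and each is coded by one real number
  through a Borel coordinate on \<open>W\<close>.
\<close>

section \<open>Isomorphism by retracts, approximation of events and binary coding\<close>

text \<open>Three obstacles shape the details. A configuration has to be integer valued only on the
  sets \<open>A n\<close>, and its image under \<open>T\<close> may violate this; counts on any set
  of finite mean are almost surely integers because the Poisson weights sum to 1, so each shift is
  handled on a set of full probability. The decorrelation bound needs regions of finite measure:
  every event is approximated in probability by one observed in a finite union of the sets
  \<open>A n\<close>, and by stationarity the error is the same for all shifts. In the Bernoulli
  part the coordinates of a measurable set form a Borel set only up to a null set, so the decoder is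
  measurable only for the completion of the law of the codes. It is enough that it is a left inverse
  of the encoder on a set of full probability. Enumerating points from the left also requires
  finitely many of them below each coordinate, hence a coordinate whose left half-lines have finite
  measure.\<close>

lemma mod0_isomorphism_retract:
  assumes e: "e \<in> P \<rightarrow>\<^sub>M N" and X0: "X0 \<in> sets P" "space P - X0 \<in> null_sets P"
    and g: "g \<in> completion (distr P N e) \<rightarrow>\<^sub>M P"
    and ge: "\<And>x. x \<in> X0 \<Longrightarrow> g (e x) = x"
    and eq: "{y \<in> space N. e (g y) = y} \<in> sets (completion (distr P N e))"
  shows "mod0_isomorphism P (distr P N e) X0 {y \<in> space N. g y \<in> X0 \<and> e (g y) = y} e"
proof -
  define Q where "Q = distr P N e"
  \<comment> \<open>\<open>Y0\<close> has full measure because its preimage under \<open>e\<close>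
    contains \<open>X0\<close>; between \<open>X0\<close> and \<open>Y0\<close> the maps
    \<open>e\<close> and \<open>g\<close> are mutually inverse.\<close>
  define Y0 where "Y0 = {y \<in> space N. g y \<in> X0 \<and> e (g y) = y}"
  have spQ: "space Q = space N" and setsQ: "sets Q = sets N" by (simp_all add: Q_def)
  have e': "e \<in> P \<rightarrow>\<^sub>M Q" using e by (simp add: Q_def)
  have dQ: "distr P Q e = Q" unfolding Q_def by (rule measure_eqI) (auto simp: emeasure_distr e)
  have dQ': "distr (completion P) Q e = Q" using distr_completion[OF e'] dQ by simp
  have e1: "e \<in> completion P \<rightarrow>\<^sub>M Q" using e' by (rule measurable_completion)
  have ec: "e \<in> completion P \<rightarrow>\<^sub>M completion Q"
    by (rule completion.measurable_completion2[OF e1]) (simp add: dQ')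
  have dc: "distr (completion P) (completion Q) e = completion Q"
    using completion.completion_distr_eq[OF e1] dQ' by simp
  have emQ: "emeasure (completion Q) Z = emeasure (completion P) (e -` Z \<inter> space P)"
    if "Z \<in> sets (completion Q)" for Z
    using emeasure_distr[OF ec that] dc by simp
  have g': "g \<in> completion Q \<rightarrow>\<^sub>M P" using g by (simp add: Q_def)
  have gc: "g \<in> completion Q \<rightarrow>\<^sub>M completion P"
  proof (rule completion.measurable_completion2[OF g'])
    \<comment> \<open>This lifts \<open>g\<close> to the completed target: on \<open>X0\<close> the
      composition of \<open>e\<close> and \<open>g\<close> is the identity, so the preimage of a
      null set \<open>K\<close> pulls back under \<open>e\<close> into \<open>K\<close> and the
      complement of \<open>X0\<close>.\<close>
    show "null_sets P \<subseteq> null_sets (distr (completion Q) P g)"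
    proof
      fix K assume K: "K \<in> null_sets P"
      let ?Z = "g -` K \<inter> space Q"
      have Z: "?Z \<in> sets (completion Q)" using measurable_sets[OF g', of K] K by auto
      have "e -` ?Z \<inter> space P \<subseteq> K \<union> (space P - X0)" using ge by auto
      moreover have "K \<union> (space P - X0) \<in> null_sets P" using K X0 by auto
      ultimately have "e -` ?Z \<inter> space P \<in> null_sets (completion P)"
        unfolding null_sets_completion_iff2 by blast
      then have "emeasure (completion Q) ?Z = 0" unfolding emQ[OF Z] by (rule null_setsD1)
      then show "K \<in> null_sets (distr (completion Q) P g)"
        using K g' by (auto simp: null_sets_def emeasure_distr simp del: emeasure_completion)
    qed
  qed
  have "Y0 = (g -` X0 \<inter> space Q) \<inter> {y \<in> space N. e (g y) = y}"
    by (auto simp: Y0_def spQ)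
  moreover have "g -` X0 \<inter> space Q \<in> sets (completion Q)"
    using measurable_sets[OF g' X0(1)] by simp
  ultimately have Y0s: "Y0 \<in> sets (completion Q)" using eq by (simp add: Q_def)
  have eX0: "e x \<in> Y0" if "x \<in> X0" for x
    using that ge[OF that] measurable_space[OF e] sets.sets_into_space[OF X0(1)] by (auto simp: Y0_def)
  have gY0: "g y \<in> X0" "e (g y) = y" if "y \<in> Y0" for y using that by (auto simp: Y0_def)
  have Zs: "space Q - Y0 \<in> sets (completion Q)" using Y0s by (metis sets.compl_sets space_completion)
  have "e -` (space Q - Y0) \<inter> space P \<subseteq> space P - X0" using eX0 by auto
  then have "e -` (space Q - Y0) \<inter> space P \<in> null_sets (completion P)"
    unfolding null_sets_completion_iff2 using X0(2) by blast
  then have Y0n: "space Q - Y0 \<in> null_sets (completion Q)"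
    using emQ[OF Zs] Zs by (auto simp: null_sets_def simp del: emeasure_completion)
  have bij: "bij_betw e X0 Y0"
    by (rule bij_betwI[where g = g]) (auto simp: eX0 gY0 ge)
  have inv: "the_inv_into X0 e y = g y" if "y \<in> Y0" for y
    using the_inv_into_f_eq[OF bij_betw_imp_inj_on[OF bij], of "g y" y] gY0[OF that] by simp
  have spX: "space (restrict_space (completion P) X0) = X0"
    using sets.sets_into_space[OF X0(1)] by (auto simp: space_restrict_space)
  have spY: "space (restrict_space (completion Q) Y0) = Y0"
    by (auto simp: space_restrict_space Y0_def spQ)
  have m1: "e \<in> restrict_space (completion P) X0 \<rightarrow>\<^sub>M restrict_space (completion Q) Y0"
    by (rule measurable_restrict_space3[OF ec]) (auto simp: eX0)
  have "g \<in> restrict_space (completion Q) Y0 \<rightarrow>\<^sub>M restrict_space (completion P) X0"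
    by (rule measurable_restrict_space3[OF gc]) (auto simp: gY0)
  then have m2: "the_inv_into X0 e \<in> restrict_space (completion Q) Y0 \<rightarrow>\<^sub>M restrict_space (completion P) X0"
    by (subst measurable_cong[where g = g]) (auto simp: inv spY)
  have d: "distr (restrict_space (completion P) X0) (restrict_space (completion Q) Y0) e
      = restrict_space (completion Q) Y0"
  proof (rule measure_eqI)
    fix B assume "B \<in> sets (distr (restrict_space (completion P) X0) (restrict_space (completion Q) Y0) e)"
    then have B: "B \<in> sets (restrict_space (completion Q) Y0)" by simp
    then have B': "B \<subseteq> Y0" "B \<in> sets (completion Q)"
      using Y0s sets.sets_into_space[OF Y0s] by (auto simp: sets_restrict_space)
    have "emeasure (distr (restrict_space (completion P) X0) (restrict_space (completion Q) Y0) e) B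
      = emeasure (restrict_space (completion P) X0) (e -` B \<inter> X0)"
      by (simp add: emeasure_distr[OF m1 B] spX del: emeasure_completion)
    also have "\<dots> = emeasure (completion P) (e -` B \<inter> X0)"
      using X0 by (intro emeasure_restrict_space) auto
    also have "\<dots> = emeasure (completion P) (e -` B \<inter> space P)"
    proof (rule emeasure_eq_AE)
      have "AE x in P. x \<in> X0" using X0 by (intro AE_I'[OF X0(2)]) auto
      then have "AE x in completion P. x \<in> X0" by (rule AE_completion)
      then show "AE x in completion P. (x \<in> e -` B \<inter> X0) = (x \<in> e -` B \<inter> space P)"
        by (rule AE_mp) (use sets.sets_into_space[OF X0(1)] in auto)
      show "e -` B \<inter> space P \<in> sets (completion P)" using measurable_sets[OF ec B'(2)] by simp
      moreover have "e -` B \<inter> X0 = (e -` B \<inter> space P) \<inter> X0" using sets.sets_into_space[OF X0(1)] by auto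
      ultimately show "e -` B \<inter> X0 \<in> sets (completion P)" using X0(1) by auto
    qed
    also have "\<dots> = emeasure (completion Q) B" using emQ[OF B'(2)] by simp
    also have "\<dots> = emeasure (restrict_space (completion Q) Y0) B"
      using Y0s B' by (intro emeasure_restrict_space[symmetric]) auto
    finally show "emeasure (distr (restrict_space (completion P) X0) (restrict_space (completion Q) Y0) e) B
      = emeasure (restrict_space (completion Q) Y0) B" .
  qed simp
  show ?thesis
    unfolding mod0_isomorphism_def Q_def[symmetric] Y0_def[symmetric]
    using X0 Y0s Y0n bij m1 m2 d by (auto intro: null_sets_completionI)
qed

text \<open>The approximable sets form a sigma-algebra. Complements keep the symmetric difference; a
  countable union is cut to \<open>N\<close> terms at cost \<open>e/2\<close>, and each term is
  approximated within \<open>e / (2 * (real N + 1))\<close>, where the added 1 avoids a division by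
  zero.\<close>

lemma (in prob_space) approximation_by_increasing_algebras:
  fixes F :: "nat \<Rightarrow> 'a set set"
  assumes alg: "\<And>n. sigma_algebra (space M) (F n)" and mono: "\<And>m n. m \<le> n \<Longrightarrow> F m \<subseteq> F n"
    and sub: "\<And>n. F n \<subseteq> events"
    and X: "X \<in> sigma_sets (space M) (\<Union>n. F n)" and "0 < e"
  shows "\<exists>n. \<exists>X' \<in> F n. prob (sym_diff X X') < e"
  using X \<open>0 < e\<close>
proof (induction arbitrary: e rule: sigma_sets.induct)
  case (Basic a)
  then obtain n where "a \<in> F n" by auto
  then show ?case using Basic(2) by (intro exI[of _ n] bexI[of _ a]) auto
next
  case Empty
  interpret sigma_algebra "space M" "F 0" by (rule alg)
  show ?case using Empty by (intro exI[of _ 0] bexI[of _ "{}"]) auto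
next
  case (Compl a)
  have ss: "sigma_sets (space M) (\<Union>n. F n) \<subseteq> events"
    using sub by (intro sets.sigma_sets_subset) auto
  obtain n X' where X': "X' \<in> F n" "prob (sym_diff a X') < e" using Compl by meson
  interpret sigma_algebra "space M" "F n" by (rule alg)
  have "a \<subseteq> space M" "X' \<subseteq> space M" using Compl(1) ss X' sets_into_space sets.sets_into_space by blast+
  then have "sym_diff (space M - a) (space M - X') = sym_diff a X'" by auto
  then show ?case using X' by (intro exI[of _ n] bexI[of _ "space M - X'"]) auto
next
  case (Union a)
  have ss: "sigma_sets (space M) (\<Union>n. F n) \<subseteq> events"
    using sub by (intro sets.sigma_sets_subset) auto
  have a: "a i \<in> events" for i using Union(1) ss by auto
  define U where "U n = (\<Union>i<n. a i)" for n
  have "(\<lambda>n. prob (U n)) \<longlonglongrightarrow> prob (\<Union>n. U n)"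
    using a by (intro finite_Lim_measure_incseq) (auto simp: U_def incseq_def intro: less_le_trans)
  moreover have "(\<Union>n. U n) = (\<Union>i. a i)" by (auto simp: U_def)
  ultimately have "(\<lambda>n. prob (U n)) \<longlonglongrightarrow> prob (\<Union>i. a i)" by simp
  from LIMSEQ_D[OF this, of "e/2"] obtain N where "norm (prob (U N) - prob (\<Union>i. a i)) < e/2"
    using Union(3) by auto
  then have 1: "prob (\<Union>i. a i) - prob (U N) < e/2" by (simp add: abs_if split: if_splits)
  have Us: "U N \<in> events" using a by (auto simp: U_def)
  have 2: "prob ((\<Union>i. a i) - U N) < e/2"
    using 1 a Us by (subst finite_measure_Diff) (auto simp: U_def)
  have "\<forall>i. \<exists>n X'. X' \<in> F n \<and> prob (sym_diff (a i) X') < e / (2 * (real N + 1))"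
    using Union(2)[of "e / (2 * (real N + 1))"] Union(3) by (simp add: Bex_def)
  then obtain n X' where X': "\<And>i. X' i \<in> F (n i)" "\<And>i. prob (sym_diff (a i) (X' i)) < e / (2 * (real N + 1))"
    by metis
  \<comment> \<open>The sum dominates every level \<open>n i\<close> with \<open>i < N\<close>, so
    one algebra \<open>F m\<close> contains all the approximants.\<close>
  define m where "m = (\<Sum>i<N. n i)"
  have m: "n i \<le> m" if "i < N" for i unfolding m_def using that by (intro member_le_sum) auto
  interpret sigma_algebra "space M" "F m" by (rule alg)
  define V where "V = (\<Union>i<N. X' i)"
  have V: "V \<in> F m" unfolding V_def using X'(1) mono[OF m] by (intro finite_UN) auto
  have X'e: "X' i \<in> events" for i using X'(1) sub by auto
  have "sym_diff (\<Union>i. a i) V \<subseteq> ((\<Union>i. a i) - U N) \<union> (\<Union>i<N. sym_diff (a i) (X' i))"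
    by (auto simp: V_def U_def)
  then have "prob (sym_diff (\<Union>i. a i) V) \<le> prob (((\<Union>i. a i) - U N) \<union> (\<Union>i<N. sym_diff (a i) (X' i)))"
    using a X'e Us by (intro finite_measure_mono) auto
  also have "\<dots> \<le> prob ((\<Union>i. a i) - U N) + prob (\<Union>i<N. sym_diff (a i) (X' i))"
    using a X'e Us by (intro measure_Un_le) auto
  also have "prob (\<Union>i<N. sym_diff (a i) (X' i)) \<le> (\<Sum>i<N. prob (sym_diff (a i) (X' i)))"
    using a X'e by (intro finite_measure_subadditive_finite) auto
  also have "\<dots> \<le> (\<Sum>i<N. e / (2 * (real N + 1)))"
    using X'(2) by (intro sum_mono) (auto intro: less_imp_le)
  also have "\<dots> \<le> e/2"
    using Union(3) by (simp add: field_simps)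
  finally have "prob (sym_diff (\<Union>i. a i) V) < e" using 2 by simp
  then show ?case using V by (intro exI[of _ m] bexI[of _ V]) auto
qed

text \<open>Base 4 instead of base 2 leaves room to recover the digits with the floor function.\<close>

definition encode_bits :: "(nat \<Rightarrow> bool) \<Rightarrow> real" where
  "encode_bits x = (\<Sum>i. of_bool (x i) / 4 ^ Suc i)"

definition decode_bit :: "nat \<Rightarrow> real \<Rightarrow> bool" where
  "decode_bit i t \<longleftrightarrow> \<lfloor>t * 4 ^ Suc i\<rfloor> mod 4 = 1"

lemma summable_encode_bits: "summable (\<lambda>i. of_bool (x i) / (4::real) ^ Suc i)"
proof (rule summable_comparison_test')
  show "summable (\<lambda>i. (1/4 :: real) ^ Suc i)" by (subst summable_Suc_iff) (simp add: summable_geometric)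
  show "\<And>n. 0 \<le> n \<Longrightarrow> norm (of_bool (x n) / (4::real) ^ Suc n) \<le> (1/4) ^ Suc n"
    by (auto simp: power_divide)
qed

lemma encode_bits_bounds: "0 \<le> encode_bits x" "encode_bits x \<le> 1 / 3"
proof -
  show "0 \<le> encode_bits x" unfolding encode_bits_def
    by (rule suminf_nonneg[OF summable_encode_bits]) auto
  have s: "(\<lambda>i. (1/4 :: real) * (1/4) ^ i) sums (1/4 * (1 / (1 - 1/4)))"
    by (intro sums_mult geometric_sums) auto
  have "encode_bits x \<le> (\<Sum>i. (1/4 :: real) * (1/4) ^ i)" unfolding encode_bits_def
    by (rule suminf_le[OF _ summable_encode_bits sums_summable[OF s]]) (auto simp: power_divide)
  also have "\<dots> = 1/3" using sums_unique[OF s] by simp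
  finally show "encode_bits x \<le> 1 / 3" .
qed

lemma encode_bits_Suc: "encode_bits x = (of_bool (x 0) + encode_bits (\<lambda>i. x (Suc i))) / 4"
proof -
  have "encode_bits x = of_bool (x 0) / 4 + (\<Sum>i. of_bool (x (Suc i)) / 4 ^ Suc (Suc i))"
    unfolding encode_bits_def using suminf_split_head[OF summable_encode_bits[of x]] by simp
  also have "(\<Sum>i. of_bool (x (Suc i)) / (4::real) ^ Suc (Suc i)) = (\<Sum>i. of_bool (x (Suc i)) / 4 ^ Suc i) / 4"
    using suminf_divide[OF summable_encode_bits[of "\<lambda>i. x (Suc i)"], of 4] by (simp add: field_simps)
  finally show ?thesis by (simp add: encode_bits_def field_simps)
qed

text \<open>Multiplication by \<open>4 ^ Suc i\<close> turns the earlier digits into a multiple of 4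
  and brings digit \<open>i\<close> to the units place. The tail is again a code, hence at most 1/3,
  and the floor removes exactly this tail.\<close>

lemma decode_encode_bits: "decode_bit i (encode_bits x) = x i"
proof -
  have *: "\<exists>k::int. encode_bits x * 4 ^ Suc i = 4 * of_int k + of_bool (x i) + encode_bits (\<lambda>j. x (j + Suc i))"
  proof (induction i arbitrary: x)
    case 0
    show ?case by (intro exI[of _ 0]) (simp add: encode_bits_Suc[of x])
  next
    case (Suc i)
    obtain k :: int where k: "encode_bits (\<lambda>i. x (Suc i)) * 4 ^ Suc i
        = 4 * of_int k + of_bool (x (Suc i)) + encode_bits (\<lambda>j. x (Suc (j + Suc i)))"
      using Suc[of "\<lambda>i. x (Suc i)"] by auto
    have "encode_bits x * 4 ^ Suc (Suc i) = of_bool (x 0) * 4 ^ Suc i + encode_bits (\<lambda>i. x (Suc i)) * 4 ^ Suc i"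
      by (subst encode_bits_Suc) (simp add: field_simps)
    also have "\<dots> = 4 * of_int (k + of_bool (x 0) * 4 ^ i) + of_bool (x (Suc i)) + encode_bits (\<lambda>j. x (j + Suc (Suc i)))"
      unfolding k by simp
    finally show ?case by blast
  qed
  obtain k :: int where k: "encode_bits x * 4 ^ Suc i = 4 * of_int k + of_bool (x i) + encode_bits (\<lambda>j. x (j + Suc i))"
    using * by blast
  have "\<lfloor>encode_bits x * 4 ^ Suc i\<rfloor> = 4 * k + of_bool (x i)"
    unfolding k using encode_bits_bounds[of "\<lambda>j. x (j + Suc i)"]
    by (intro floor_unique) auto
  then show ?thesis by (simp add: decode_bit_def)
qed

lemma measurable_decode_bit [measurable]: "Measurable.pred borel (decode_bit i)"
  unfolding decode_bit_def by measurable

lemma measurable_encode_bits: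
  assumes [measurable]: "\<And>i. Measurable.pred M (\<lambda>w. b w i)"
  shows "(\<lambda>w. encode_bits (b w)) \<in> borel_measurable M"
  unfolding encode_bits_def by measurable

section \<open>Invertible measure preserving maps\<close>

lemma sets_sym_diff: "X \<in> sets M \<Longrightarrow> Y \<in> sets M \<Longrightarrow> sym_diff X Y \<in> sets M"
  by blast

locale mpt = sigma_finite_measure M for M :: "'a measure" and T :: "'a \<Rightarrow> 'a" +
  assumes bij: "bij_betw T (space M) (space M)"
    and T_measurable: "T \<in> M \<rightarrow>\<^sub>M M"
    and inv_measurable: "the_inv_into (space M) T \<in> M \<rightarrow>\<^sub>M M"
    and distr_T: "distr M M T = M"
begin

definition zpow :: "int \<Rightarrow> 'a \<Rightarrow> 'a" where
  "zpow n = (if 0 \<le> n then T ^^ nat n else the_inv_into (space M) T ^^ nat (- n))"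

text \<open>The sign convention is opposite to that of \<open>iterate_set\<close>: \<open>pre n B\<close> is \<open>T\<^sup>-\<^sup>n B\<close>.\<close>

definition pre :: "int \<Rightarrow> 'a set \<Rightarrow> 'a set" where
  "pre n B = zpow n -` B \<inter> space M"

lemma zpow_0 [simp]: "zpow 0 x = x"
  by (simp add: zpow_def)

lemma zpow_of_nat: "zpow (int k) = T ^^ k"
  by (simp add: zpow_def)

lemma measurable_zpow [measurable]: "zpow n \<in> M \<rightarrow>\<^sub>M M"
  unfolding zpow_def using measurable_compose_n[OF T_measurable] measurable_compose_n[OF inv_measurable]
  by auto

lemma zpow_in_space [simp]: "x \<in> space M \<Longrightarrow> zpow n x \<in> space M"
  by (rule measurable_space[OF measurable_zpow])

lemma T_inv: "x \<in> space M \<Longrightarrow> T (the_inv_into (space M) T x) = x"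
  by (rule f_the_inv_into_f_bij_betw[OF bij])

lemma inv_T: "x \<in> space M \<Longrightarrow> the_inv_into (space M) T (T x) = x"
  by (rule the_inv_into_f_f[OF bij_betw_imp_inj_on[OF bij]])

lemma zpow_succ: "x \<in> space M \<Longrightarrow> zpow (n + 1) x = T (zpow n x)"
proof (cases "0 \<le> n")
  case True
  then have "nat (n + 1) = Suc (nat n)" by simp
  then show ?thesis using True by (simp add: zpow_def)
next
  case False
  assume x: "x \<in> space M"
  define k where "k = nat (- n - 1)"
  have n: "n = - int k - 1" using False by (simp add: k_def)
  have "zpow n x = the_inv_into (space M) T (zpow (n + 1) x)"
    by (cases "k = 0") (simp_all add: zpow_def n nat_add_distrib)
  then show ?thesis using T_inv[OF zpow_in_space[OF x]] by simp
qed

lemma zpow_add: "x \<in> space M \<Longrightarrow> zpow (m + n) x = zpow m (zpow n x)"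
proof (induction m rule: int_induct[where k = 0])
  case (step1 i)
  then show ?case using zpow_succ[of x "i + n"] zpow_succ[of "zpow n x" i] by (simp add: algebra_simps)
next
  case (step2 i)
  have "T (zpow (i - 1 + n) x) = T (zpow (i - 1) (zpow n x))"
    using step2 zpow_succ[of x "i - 1 + n"] zpow_succ[of "zpow n x" "i - 1"] by (simp add: algebra_simps)
  then show ?case
    using inj_onD[OF bij_betw_imp_inj_on[OF bij]] step2 by simp
qed simp

lemma zpow_cancel [simp]: "x \<in> space M \<Longrightarrow> zpow n (zpow (- n) x) = x" "x \<in> space M \<Longrightarrow> zpow (- n) (zpow n x) = x"
  using zpow_add[of x n "-n"] zpow_add[of x "-n" n] by simp_all

lemma pre_0 [simp]: "B \<subseteq> space M \<Longrightarrow> pre 0 B = B"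
  by (auto simp: pre_def)

lemma sets_pre [simp]: "B \<in> sets M \<Longrightarrow> pre n B \<in> sets M"
  unfolding pre_def by (rule measurable_sets[OF measurable_zpow])

lemma pre_subset: "pre n B \<subseteq> space M"
  by (auto simp: pre_def)

lemma pre_pre: "pre m (pre n B) = pre (m + n) B"
  by (auto simp: pre_def zpow_add[symmetric] add.commute)

lemma pre_Int: "pre n (B \<inter> B') = pre n B \<inter> pre n B'"
  and pre_Un: "pre n (B \<union> B') = pre n B \<union> pre n B'"
  and pre_Diff: "pre n (B - B') = pre n B - pre n B'"
  and pre_UN: "pre n (\<Union>i\<in>I. C i) = (\<Union>i\<in>I. pre n (C i))"
  and pre_mono: "B \<subseteq> B' \<Longrightarrow> pre n B \<subseteq> pre n B'"
  by (auto simp: pre_def)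

lemma pre_empty [simp]: "pre n {} = {}" by (simp add: pre_def)

lemma pre_space [simp]: "pre n (space M) = space M" by (auto simp: pre_def)

lemma iterate_set_eq_pre: "B \<subseteq> space M \<Longrightarrow> iterate_set M T n B = pre (- n) B"
proof (cases "0 \<le> n")
  case True
  assume B: "B \<subseteq> space M"
  have "T ^^ nat n = zpow n" using True by (simp add: zpow_def)
  moreover have "zpow n ` B \<inter> space M = pre (- n) B"
  proof (intro equalityI subsetI)
    fix x assume "x \<in> zpow n ` B \<inter> space M" then show "x \<in> pre (- n) B" using B by (auto simp: pre_def)
  next
    fix x assume "x \<in> pre (- n) B"
    then have "x \<in> space M" "zpow (- n) x \<in> B" by (auto simp: pre_def)
    then show "x \<in> zpow n ` B \<inter> space M" by (auto intro!: image_eqI[of _ _ "zpow (- n) x"])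
  qed
  ultimately show ?thesis using True by (simp add: iterate_set_def)
next
  case False
  then show ?thesis by (simp add: iterate_set_def pre_def zpow_def)
qed

lemma distr_inv: "distr M M (the_inv_into (space M) T) = M"
proof -
  have "distr (distr M M T) M (the_inv_into (space M) T) = distr M M (\<lambda>x. x)"
    unfolding distr_distr[OF inv_measurable T_measurable] by (rule distr_cong) (simp_all add: inv_T)
  then show ?thesis by (simp add: distr_T distr_id2)
qed

lemma distr_zpow: "distr M M (zpow n) = M"
proof -
  have *: "distr M M (f ^^ k) = M" if f: "f \<in> M \<rightarrow>\<^sub>M M" "distr M M f = M" for f k
  proof (induction k)
    case 0 show ?case by (simp add: id_def distr_id2)
  next
    case (Suc k)
    have "distr M M (f ^^ Suc k) = distr (distr M M (f ^^ k)) M f"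
      unfolding distr_distr[OF f(1) measurable_compose_n[OF f(1)]] by simp
    then show ?case using Suc f(2) by (simp only:)
  qed
  show ?thesis unfolding zpow_def using *[OF T_measurable distr_T] *[OF inv_measurable distr_inv] by auto
qed

lemma emeasure_pre [simp]: "B \<in> sets M \<Longrightarrow> emeasure M (pre n B) = emeasure M B"
  using emeasure_distr[OF measurable_zpow, of B n] distr_zpow[of n] by (simp add: pre_def)

lemma null_sets_pre: "B \<in> null_sets M \<Longrightarrow> pre n B \<in> null_sets M"
  by (auto simp: null_sets_def)

definition invariant :: "'a set \<Rightarrow> bool" where
  "invariant E \<longleftrightarrow> E \<in> sets M \<and> (\<forall>n. sym_diff (pre n E) E \<in> null_sets M)"

lemma invariantD: "invariant E \<Longrightarrow> E \<in> sets M" "invariant E \<Longrightarrow> sym_diff (pre n E) E \<in> null_sets M"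
  by (auto simp: invariant_def)

lemma null_sym_diff_trans:
  "sym_diff X Y \<in> null_sets M \<Longrightarrow> sym_diff Y Z \<in> null_sets M \<Longrightarrow> X \<in> sets M \<Longrightarrow> Z \<in> sets M \<Longrightarrow> sym_diff X Z \<in> null_sets M"
  by (rule null_sets_subset[of "sym_diff X Y \<union> sym_diff Y Z"]) auto

text \<open>The null discrepancy at time 1 is translated by \<open>pre i\<close> and added up by
  induction in both directions of the integers.\<close>

lemma invariantI:
  assumes E: "E \<in> sets M" and 1: "sym_diff (pre 1 E) E \<in> null_sets M"
  shows "invariant E"
proof -
  have "sym_diff (pre n E) E \<in> null_sets M" for n
  proof (induction n rule: int_induct[where k = 0])
    case base
    show ?case using pre_0[OF sets.sets_into_space[OF E]] by simp
  next
    case (step1 i)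
    have "sym_diff (pre (i + 1) E) (pre i E) = pre i (sym_diff (pre 1 E) E)"
      by (simp add: pre_Un pre_Diff pre_pre)
    then have "sym_diff (pre (i + 1) E) (pre i E) \<in> null_sets M" using null_sets_pre[OF 1] by simp
    from null_sym_diff_trans[OF this step1(2)] show ?case using E by simp
  next
    case (step2 i)
    have "sym_diff (pre i E) (pre (i - 1) E) = pre (i - 1) (sym_diff (pre 1 E) E)"
      by (simp add: pre_Un pre_Diff pre_pre)
    then have "sym_diff (pre (i - 1) E) (pre i E) \<in> null_sets M"
      using null_sets_pre[OF 1, of "i - 1"] by (metis Un_commute)
    from null_sym_diff_trans[OF this step2(2)] show ?case using E by simp
  qed
  then show ?thesis using E by (simp add: invariant_def)
qed

lemma invariant_set_iff: "invariant_set M T E \<longleftrightarrow> invariant E"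
proof
  assume "invariant_set M T E"
  then show "invariant E"
    unfolding invariant_set_def
    by (intro invariantI) (auto simp: iterate_set_eq_pre[OF sets.sets_into_space])
next
  assume "invariant E"
  then show "invariant_set M T E"
    using invariantD(2)[of E 1]
    by (auto simp: invariant_set_def invariantD iterate_set_eq_pre[OF sets.sets_into_space])
qed

lemma invariant_Int: "invariant E \<Longrightarrow> invariant F \<Longrightarrow> invariant (E \<inter> F)"
  unfolding invariant_def
proof (safe)
  fix n assume E: "E \<in> sets M" "F \<in> sets M" and *: "\<forall>n. sym_diff (pre n E) E \<in> null_sets M"
    "\<forall>n. sym_diff (pre n F) F \<in> null_sets M"
  have "sym_diff (pre n E) E \<union> sym_diff (pre n F) F \<in> null_sets M" using * by blast
  then show "sym_diff (pre n (E \<inter> F)) (E \<inter> F) \<in> null_sets M"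
    by (rule null_sets_subset) (use E in \<open>auto simp: pre_Int intro!: sets_sym_diff\<close>)
qed auto

lemma invariant_compl: "invariant E \<Longrightarrow> invariant (space M - E)"
  unfolding invariant_def
proof (safe)
  fix n assume E: "E \<in> sets M" and *: "\<forall>n. sym_diff (pre n E) E \<in> null_sets M"
  have "sym_diff (pre n E) E \<in> null_sets M" using * by blast
  then show "sym_diff (pre n (space M - E)) (space M - E) \<in> null_sets M"
    by (rule null_sets_subset) (use E in \<open>auto simp: pre_Diff intro!: sets_sym_diff\<close>)
qed auto

lemma invariant_cong_null:
  assumes "invariant E" "F \<in> sets M" "sym_diff E F \<in> null_sets M"
  shows "invariant F"
proof (rule invariantI)
  have "sym_diff (pre 1 E) E \<union> sym_diff E F \<union> pre 1 (sym_diff E F) \<in> null_sets M"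
    using assms invariantD(2)[OF assms(1), of 1] null_sets_pre[OF assms(3), of 1] by blast
  then show "sym_diff (pre 1 F) F \<in> null_sets M"
    by (rule null_sets_subset) (use assms in \<open>auto simp: pre_Un pre_Diff intro!: sets_sym_diff\<close>)
qed fact

text \<open>Up to a null set \<open>E\<close> may be replaced by \<open>pre n E\<close>, which makes
  the intersection a translate of \<open>E \<inter> B\<close>. Restricting \<open>M\<close> to an
  invariant set thus gives an invariant intensity.\<close>

lemma emeasure_invariant_pre:
  assumes E: "invariant E" and B: "B \<in> sets M"
  shows "emeasure M (E \<inter> pre n B) = emeasure M (E \<inter> B)"
proof -
  have "emeasure M (E \<inter> pre n B) = emeasure M (pre n E \<inter> pre n B)"
  proof (rule emeasure_eq_AE)
    have "AE x in M. x \<notin> sym_diff (pre n E) E" by (rule AE_not_in[OF invariantD(2)[OF E]])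
    then show "AE x in M. (x \<in> E \<inter> pre n B) = (x \<in> pre n E \<inter> pre n B)" by (rule AE_mp) auto
  qed (use B invariantD(1)[OF E] in auto)
  then show ?thesis using B invariantD(1)[OF E] by (simp add: pre_Int[symmetric])
qed

end

lemma dynamical_system_imp_mpt: "dynamical_system M T \<Longrightarrow> mpt M T"
  unfolding dynamical_system_def mpt_def mpt_axioms_def by blast

lemma measure_on_simps [simp]: "sets (measure_on M E) = sets M" "space (measure_on M E) = space M"
  by (simp_all add: measure_on_def)

lemma emeasure_measure_on: "E \<in> sets M \<Longrightarrow> B \<in> sets M \<Longrightarrow> emeasure (measure_on M E) B = emeasure M (E \<inter> B)"
  by (simp add: measure_on_def emeasure_density Int_commute flip: indicator_inter_arith)

section \<open>Maximal inequality, null part and wandering sets\<close>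

context mpt begin

text \<open>The maximum of 0 and the first \<open>N\<close> ergodic sums of \<open>h\<close>.
  Splitting off the first summand gives the recursion, which is the form needed for comparing the
  function with its composition with \<open>T\<close>.\<close>

primrec max_sum :: "('a \<Rightarrow> real) \<Rightarrow> nat \<Rightarrow> 'a \<Rightarrow> real" where
  "max_sum h 0 x = 0"
| "max_sum h (Suc N) x = max 0 (h x + max_sum h N (T x))"

lemma integrable_max_sum: "integrable M h \<Longrightarrow> integrable M (max_sum h N)"
proof (induction N)
  case (Suc N)
  have "integrable (distr M M T) (max_sum h N)" using Suc by (simp add: distr_T)
  then have "integrable M (\<lambda>x. max_sum h N (T x))"
    using Suc by (subst (asm) integrable_distr_eq[OF T_measurable]) auto
  then show ?case using Suc by simp
next
  case 0
  have "max_sum h 0 = (\<lambda>x. 0)" by (rule ext) simp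
  then show ?case by simp
qed

lemma max_sum_nonneg: "0 \<le> max_sum h N x"
  by (cases N) auto

lemma max_sum_mono: "max_sum h N x \<le> max_sum h (Suc N) x"
proof (induction N arbitrary: x)
  case (Suc N)
  show ?case using Suc[of "T x"] by auto
qed auto

lemma max_sum_ge: "x \<in> space M \<Longrightarrow> (\<Sum>k<N. h (zpow (int k) x)) \<le> max_sum h N x"
proof (induction N arbitrary: x)
  case (Suc N)
  have "(\<Sum>k<Suc N. h (zpow (int k) x)) = h x + (\<Sum>k<N. h (zpow (int k) (T x)))"
    by (subst sum.lessThan_Suc_shift) (simp add: zpow_of_nat funpow_swap1 del: of_nat_Suc)
  also have "\<dots> \<le> h x + max_sum h N (T x)"
    using Suc.IH[of "T x"] Suc.prems measurable_space[OF T_measurable] by simp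
  finally show ?case by simp
qed simp

text \<open>Garsia's proof: \<open>h\<close> dominates the coboundary of \<open>max_sum h N\<close> wherever the latter is positive.\<close>

lemma maximal_ergodic:
  assumes h: "integrable M h"
  shows "0 \<le> (\<integral>x. indicator {x \<in> space M. 0 < max_sum h N x} x * h x \<partial>M)"
proof -
  let ?S = "max_sum h N"
  have S: "integrable M ?S" by (rule integrable_max_sum[OF h])
  have [measurable]: "?S \<in> borel_measurable M" "h \<in> borel_measurable M" using S h by auto
  have ST: "integrable M (\<lambda>x. ?S (T x))" "(\<integral>x. ?S (T x) \<partial>M) = (\<integral>x. ?S x \<partial>M)"
    using integrable_distr_eq[OF T_measurable, of ?S] integral_distr[OF T_measurable, of ?S] S
    by (auto simp: distr_T)
  have "0 = (\<integral>x. ?S x - ?S (T x) \<partial>M)" using S ST by simp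
  also have "\<dots> \<le> (\<integral>x. indicator {x \<in> space M. 0 < ?S x} x * h x \<partial>M)"
  proof (rule integral_mono)
    show "integrable M (\<lambda>x. ?S x - ?S (T x))" using S ST by simp
    show "integrable M (\<lambda>x. indicator {x \<in> space M. 0 < ?S x} x * h x)"
      using h by (subst mult.commute) (intro integrable_real_mult_indicator; measurable)
    fix x assume x: "x \<in> space M"
    show "?S x - ?S (T x) \<le> indicator {x \<in> space M. 0 < ?S x} x * h x"
    proof (cases "0 < ?S x")
      case True
      then obtain N' where N': "N = Suc N'" by (cases N) auto
      then have "?S x = h x + max_sum h N' (T x)" using True by (auto simp: max_def split: if_splits)
      then show ?thesis using max_sum_mono[of h N' "T x"] True x N' by simp
    next
      case False
      then show ?thesis using max_sum_nonneg[of h N "T x"] x by simp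
    qed
  qed
  finally show ?thesis .
qed

text \<open>For \<open>F \<subseteq> E\<close> of finite measure apply the maximal ergodic theorem
  to \<open>indicator B - c * indicator F\<close>. Since \<open>indicator F\<close> is at most 1
  along the orbit, every point of \<open>F\<close> has a positive sum, so the sets
  \<open>H N\<close> exhaust \<open>F\<close>. Finiteness of \<open>F\<close> makes the function
  integrable; sigma-finiteness then passes from \<open>F\<close> to \<open>E\<close>, whose measure
  is thereby shown to be finite.\<close>

lemma maximal_inequality:
  assumes B: "B \<in> sets M" "emeasure M B < \<infinity>" and c: "0 < c" and E: "E \<in> sets M"
    and large: "\<And>x. x \<in> E \<Longrightarrow> \<exists>n. real n * c < (\<Sum>k<n. indicator B (zpow (int k) x))"
  shows "emeasure M E \<le> ennreal (measure M B / c)"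
proof -
  have fin: "emeasure M F \<le> ennreal (measure M B / c)"
    if F: "F \<in> sets M" "emeasure M F < \<infinity>" "F \<subseteq> E" for F
  proof -
    define h where "h x = indicator B x - c * indicator F x" for x
    have h: "integrable M h" unfolding h_def using B F by simp
    define H where "H N = {x \<in> space M. 0 < max_sum h N x}" for N
    have Hs: "H N \<in> sets M" for N
      unfolding H_def using borel_measurable_integrable[OF integrable_max_sum[OF h]] by measurable
    have Hle: "c * measure M (F \<inter> H N) \<le> measure M B" for N
    proof -
      have i: "integrable M (indicator (B \<inter> H N) :: 'a \<Rightarrow> real)" "integrable M (indicator (F \<inter> H N) :: 'a \<Rightarrow> real)"
        using B F Hs[of N] emeasure_mono[of "B \<inter> H N" B M] emeasure_mono[of "F \<inter> H N" F M]
        by (auto intro!: le_less_trans[of "emeasure M (B \<inter> H N)"] le_less_trans[of "emeasure M (F \<inter> H N)"])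
      have "0 \<le> (\<integral>x. indicator (H N) x * h x \<partial>M)"
        unfolding H_def by (rule maximal_ergodic[OF h])
      also have "\<dots> = (\<integral>x. indicator (B \<inter> H N) x - c * indicator (F \<inter> H N) x \<partial>M)"
        by (rule Bochner_Integration.integral_cong) (auto simp: h_def indicator_def)
      also have "\<dots> = measure M (B \<inter> H N) - c * measure M (F \<inter> H N)"
        using i Hs B F by (subst Bochner_Integration.integral_diff) (auto simp: sets.Int_space_eq2)
      also have "measure M (B \<inter> H N) \<le> measure M B"
        using B Hs by (intro measure_mono_fmeasurable) (auto simp: fmeasurable_def)
      finally show ?thesis by simp
    qed
    have "incseq (\<lambda>N. F \<inter> H N)"
    proof (rule incseq_SucI)
      fix N
      have "H N \<subseteq> H (Suc N)"
        unfolding H_def using less_le_trans[OF _ max_sum_mono] by blast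
      then show "F \<inter> H N \<subseteq> F \<inter> H (Suc N)" by blast
    qed
    moreover have "(\<Union>N. F \<inter> H N) = F"
    proof safe
      fix x assume x: "x \<in> F"
      then have xs: "x \<in> space M" using F sets.sets_into_space by blast
      obtain n where n: "real n * c < (\<Sum>k<n. indicator B (zpow (int k) x))" using large x F by blast
      have "(\<Sum>k<n. h (zpow (int k) x)) \<ge> (\<Sum>k<n. indicator B (zpow (int k) x) - c)"
        using c by (intro sum_mono) (auto simp: h_def indicator_def)
      then have "0 < (\<Sum>k<n. h (zpow (int k) x))" using n by (simp add: sum_subtractf)
      then have "x \<in> H n" using max_sum_ge[OF xs, of h n] xs by (simp add: H_def)
      then show "x \<in> (\<Union>N. F \<inter> H N)" using x by auto
    qed
    ultimately have lim: "(\<lambda>N. measure M (F \<inter> H N)) \<longlonglongrightarrow> measure M F"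
      using Lim_measure_incseq[of "\<lambda>N. F \<inter> H N" M] F(1,2) Hs by (simp add: image_subset_iff)
    have "(\<lambda>N. c * measure M (F \<inter> H N)) \<longlonglongrightarrow> c * measure M F" by (intro tendsto_intros lim)
    then have "c * measure M F \<le> measure M B" using Hle by (intro LIMSEQ_le_const2) auto
    then have "measure M F \<le> measure M B / c" using c by (simp add: field_simps)
    then show ?thesis using F by (simp add: emeasure_eq_ennreal_measure ennreal_leI)
  qed
  obtain G :: "nat \<Rightarrow> 'a set" where G: "range G \<subseteq> sets M" "(\<Union>i. G i) = space M" "\<And>i. emeasure M (G i) \<noteq> \<infinity>" "incseq G"
    using sigma_finite_incseq by metis
  have "(\<lambda>i. emeasure M (E \<inter> G i)) \<longlonglongrightarrow> emeasure M (\<Union>i. E \<inter> G i)"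
    using G(1) E by (intro Lim_emeasure_incseq incseq_SucI Int_mono incseq_SucD[OF G(4)]) auto
  moreover have "(\<Union>i. E \<inter> G i) = E" using G(2) sets.sets_into_space[OF E] by blast
  moreover have "emeasure M (E \<inter> G i) \<le> ennreal (measure M B / c)" for i
  proof (rule fin)
    show "emeasure M (E \<inter> G i) < \<infinity>"
      using emeasure_mono[of "E \<inter> G i" "G i" M] G(1) G(3)[of i] by (auto simp: less_top[symmetric] top_unique)
  qed (use G E in auto)
  ultimately show ?thesis by (intro LIMSEQ_le_const2) auto
qed

text \<open>With respect to an equivalent finite measure, the supremum of the masses of countable
  unions is attained by merging near-optimal sequences. Adding one more member to the optimal
  sequence cannot increase the mass, so it adds only a null set.\<close>

lemma exhausting_sequence:
  assumes \<A>: "\<A> \<subseteq> sets M" "\<A> \<noteq> {}"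
  obtains a :: "nat \<Rightarrow> 'a set" where "range a \<subseteq> \<A>" "\<And>B. B \<in> \<A> \<Longrightarrow> B - (\<Union>i. a i) \<in> null_sets M"
proof -
  obtain h :: "'a \<Rightarrow> ennreal" where h: "h \<in> borel_measurable M" "integral\<^sup>N M h \<noteq> \<infinity>" "\<And>x. x \<in> space M \<Longrightarrow> 0 < h x"
    using Ex_finite_integrable_function by metis
  define N where "N = density M h"
  have sN [simp]: "sets N = sets M" "space N = space M" by (simp_all add: N_def)
  interpret N: finite_measure N
    by (rule finite_measureI) (use h in \<open>simp add: N_def emeasure_density\<close>)
  have null: "B \<in> null_sets M" if B: "B \<in> sets M" "measure N B = 0" for B
  proof -
    have "B \<in> null_sets N" using B by (simp add: null_sets_def N.emeasure_eq_measure)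
    then have "AE x in M. x \<in> B \<longrightarrow> h x = 0" using null_sets_density_iff[OF h(1)] by (simp add: N_def)
    moreover have "AE x in M. h x \<noteq> 0" using h(3) by (intro AE_I2) (metis less_irrefl)
    ultimately have "AE x in M. x \<notin> B" by eventually_elim auto
    then show ?thesis using B by (simp add: AE_iff_null_sets)
  qed
  define S where "S = (\<lambda>a. measure N (\<Union>i. a i)) ` (UNIV \<rightarrow> \<A> :: (nat \<Rightarrow> 'a set) set)"
  have bdd: "bdd_above S" unfolding S_def by (intro bdd_aboveI2[where M = "measure N (space N)"] N.bounded_measure)
  have ne: "S \<noteq> {}" using \<A> by (auto simp: S_def Pi_def)
  have "\<exists>a\<in>UNIV \<rightarrow> \<A>. Sup S - 1 / real (Suc n) < measure N (\<Union>i::nat. a i)" for n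
  proof -
    obtain s where "s \<in> S" "Sup S - 1 / real (Suc n) < s"
      using less_cSupD[OF ne, of "Sup S - 1 / real (Suc n)"] by auto
    then obtain a :: "nat \<Rightarrow> 'a set" where "a \<in> UNIV \<rightarrow> \<A>" "s = measure N (\<Union>i. a i)" unfolding S_def by auto
    then show ?thesis using \<open>Sup S - 1 / real (Suc n) < s\<close> by (intro bexI[of _ a]) simp_all
  qed
 then have "\<exists>b. \<forall>n. b n \<in> (UNIV :: nat set) \<rightarrow> \<A> \<and> Sup S - 1 / real (Suc n) < measure N (\<Union>i. b n i)"
    by (intro choice) blast
  then obtain b where b: "\<And>n. b n \<in> (UNIV :: nat set) \<rightarrow> \<A>" "\<And>n. Sup S - 1 / real (Suc n) < measure N (\<Union>i. b n i)"
    by blast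
  \<comment> \<open>\<open>prod_decode\<close> merges the countably many sequences
    \<open>b n\<close> into a single one.\<close>
  define a where "a k = (case prod_decode k of (n, i) \<Rightarrow> b n i)" for k
  have a: "a \<in> UNIV \<rightarrow> \<A>" using b(1) by (auto simp: a_def Pi_def split: prod.split)
  have sub: "(\<Union>i. b n i) \<subseteq> (\<Union>k. a k)" for n
  proof
    fix x assume "x \<in> (\<Union>i. b n i)"
    then obtain i where "x \<in> b n i" by auto
    then have "x \<in> a (prod_encode (n, i))" by (simp add: a_def)
    then show "x \<in> (\<Union>k. a k)" by blast
  qed
  have as: "(\<Union>k. a k) \<in> sets M" by (intro sets.countable_UN) (use a \<A> in auto)
  have ge: "Sup S \<le> measure N (\<Union>k. a k)"
  proof (rule LIMSEQ_le_const2)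
    show "(\<lambda>n. Sup S - 1 / real (Suc n)) \<longlonglongrightarrow> Sup S"
      using tendsto_diff[OF tendsto_const LIMSEQ_inverse_real_of_nat, of "Sup S"] by (simp add: inverse_eq_divide)
    show "\<exists>N'. \<forall>n\<ge>N'. Sup S - 1 / real (Suc n) \<le> measure N (\<Union>k. a k)"
      using b(2) N.finite_measure_mono[OF sub] as by (intro exI[of _ 0]) (auto intro: less_imp_le less_le_trans)
  qed
  show ?thesis
  proof (rule that)
    show "range a \<subseteq> \<A>" using a by auto
    fix B assume B: "B \<in> \<A>"
    define a' where "a' = case_nat B a"
    have a': "a' \<in> UNIV \<rightarrow> \<A>" using a B by (auto simp: a'_def Pi_def split: nat.split)
    have un: "(\<Union>i. a' i) = B \<union> (\<Union>i. a i)" by (auto simp: a'_def split: nat.splits)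
    have "measure N (\<Union>i. a' i) \<le> Sup S" using a' by (intro cSup_upper bdd) (auto simp: S_def)
    then have "measure N (B \<union> (\<Union>i. a i)) \<le> measure N (\<Union>i. a i)" using ge un by simp
    moreover have "measure N (B \<union> (\<Union>i. a i)) = measure N (\<Union>i. a i) + measure N (B - (\<Union>i. a i))"
      using as B \<A> N.finite_measure_Union[of "\<Union>i. a i" "B - (\<Union>i. a i)"] by (auto simp: Un_commute)
    ultimately have "measure N (B - (\<Union>i. a i)) = 0" using measure_nonneg[of N "B - (\<Union>i. a i)"] by linarith
    then show "B - (\<Union>i. a i) \<in> null_sets M" using as B \<A> by (intro null) auto
  qed
qed

lemma wandering_iff: "wandering M T B \<longleftrightarrow> B \<in> sets M \<and> disjoint_family (\<lambda>n. pre n B)"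
  by (auto simp: wandering_def iterate_set_eq_pre[OF sets.sets_into_space])

lemma wandering_pre: "wandering M T B \<Longrightarrow> wandering M T (pre n B)"
  unfolding wandering_iff disjoint_family_on_def by (auto simp: pre_pre)

text \<open>From the \<open>i\<close>-th set of an exhausting sequence of wandering sets only those
  points are kept whose orbits miss all earlier sets. Two visits of an orbit to \<open>W\<close>
  then occur in the same \<open>a i\<close>, which is wandering, so they coincide; and no orbit is
  lost.\<close>

lemma ex_wandering_generator:
  assumes D: "is_measurable_union M {B. wandering M T B} D"
  obtains W where "wandering M T W" "sym_diff D (\<Union>n. pre n W) \<in> null_sets M"
proof -
  have "{B. wandering M T B} \<subseteq> sets M" "{B. wandering M T B} \<noteq> {}"
    by (auto simp: wandering_iff disjoint_family_on_def intro: exI[of _ "{}"])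
  then obtain a :: "nat \<Rightarrow> 'a set" where a: "range a \<subseteq> {B. wandering M T B}"
      "\<And>B. B \<in> {B. wandering M T B} \<Longrightarrow> B - (\<Union>i. a i) \<in> null_sets M"
    using exhausting_sequence by metis
  have aw: "wandering M T (a i)" for i using a(1) by auto
  have as: "a i \<in> sets M" for i using aw by (auto simp: wandering_iff)
  define W where "W = (\<Union>i. a i - (\<Union>j<i. \<Union>n. pre n (a j)))"
  have Ws: "W \<in> sets M"
    unfolding W_def using as by (intro sets.countable_UN sets.Diff sets.finite_UN image_subsetI) auto
  have dis: "m = n" if x: "x \<in> space M" and mn: "zpow m x \<in> W" "zpow n x \<in> W" for x m n
  proof -
    obtain i where i: "zpow m x \<in> a i" "\<And>j k. j < i \<Longrightarrow> zpow m x \<notin> pre k (a j)" using mn by (auto simp: W_def)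
    obtain j where j: "zpow n x \<in> a j" "\<And>i k. i < j \<Longrightarrow> zpow n x \<notin> pre k (a i)" using mn by (auto simp: W_def)
    have "zpow m x \<in> pre (n - m) (a j)" "zpow n x \<in> pre (m - n) (a i)"
      using x i j by (auto simp: pre_def zpow_add[symmetric])
    then have "i = j" using i j by (metis linorder_neqE_nat)
    then have "x \<in> pre m (a i)" "x \<in> pre n (a i)" using x i j by (auto simp: pre_def)
    then show "m = n" using aw[of i] by (auto simp: wandering_iff disjoint_family_on_def)
  qed
  have "disjoint_family (\<lambda>n. pre n W)"
    unfolding disjoint_family_on_def using dis by (auto simp: pre_def)
  then have W: "wandering M T W" using Ws by (simp add: wandering_iff)
  have UW: "(\<Union>n. pre n W) = (\<Union>i. \<Union>n. pre n (a i))"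
  proof (intro equalityI subsetI)
    fix x assume "x \<in> (\<Union>n. pre n W)" then show "x \<in> (\<Union>i. \<Union>n. pre n (a i))" by (auto simp: W_def pre_def)
  next
    fix x assume "x \<in> (\<Union>i. \<Union>n. pre n (a i))"
    then have ex: "\<exists>i. \<exists>n. x \<in> pre n (a i)" by auto
    \<comment> \<open>The least index among the sets visited by the orbit of \<open>x\<close>; the
      visit to this set survives in \<open>W\<close>.\<close>
    define i where "i = (LEAST i. \<exists>n. x \<in> pre n (a i))"
    obtain n where n: "x \<in> pre n (a i)" unfolding i_def using LeastI_ex[OF ex] by auto
    have less: "x \<notin> pre k (a j)" if "j < i" for j k using not_less_Least[OF that[unfolded i_def]] by auto
    have "zpow n x \<notin> pre k (a j)" if "j < i" for j k
    proof
      assume "zpow n x \<in> pre k (a j)"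
      then have "x \<in> pre n (pre k (a j))" using n by (auto simp: pre_def)
      then show False using less[OF that] by (simp add: pre_pre)
    qed
    then have "zpow n x \<in> W" using n by (auto simp: W_def pre_def)
    then show "x \<in> (\<Union>n. pre n W)" using n by (auto simp: pre_def)
  qed
  have aE: "a i \<subseteq> (\<Union>n. pre n W)" for i
    unfolding UW using pre_0[OF sets.sets_into_space[OF as], of i] by blast
  have 1: "D - (\<Union>n. pre n W) \<in> null_sets M"
  proof -
    have "B - (\<Union>n. pre n W) \<in> null_sets M" if "wandering M T B" for B
    proof (rule null_sets_subset)
      show "B - (\<Union>i. a i) \<in> null_sets M" using a(2) that by simp
      show "B - (\<Union>n. pre n W) \<in> sets M"
        using that Ws by (intro sets.Diff sets.countable_UN image_subsetI) (auto simp: wandering_iff)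
    qed (use aE in blast)
    moreover have "(\<Union>n. pre n W) \<in> sets M" using Ws by auto
    ultimately show ?thesis using D unfolding is_measurable_union_def by blast
  qed
  have "pre n (a i) - D \<in> null_sets M" for n i
    using D wandering_pre[OF aw] unfolding is_measurable_union_def by blast
  then have "(\<Union>i. \<Union>n. pre n (a i) - D) \<in> null_sets M" by (intro null_sets_UN)
  moreover have "(\<Union>i. \<Union>n. pre n (a i) - D) = (\<Union>n. pre n W) - D" unfolding UW by auto
  ultimately have "sym_diff D (\<Union>n. pre n W) \<in> null_sets M" using 1 by auto
  then show ?thesis using W that by blast
qed

lemma null_part_cesaro:
  assumes Nul: "invariant Nul"
    and no_inv: "\<not> (\<exists>\<nu>. invariant_prob M T \<nu> \<and> absolutely_continuous (measure_on M Nul) \<nu>)"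
    and B: "B \<in> sets M" "B \<subseteq> Nul" "emeasure M B < \<infinity>"
  shows "(\<lambda>n. (\<Sum>k<n. measure M (B \<inter> pre (int k) B)) / real n) \<longlonglongrightarrow> 0"
proof (rule ccontr)
  define a where "a n = (\<Sum>k<n. measure M (B \<inter> pre (int k) B)) / real n" for n
  define f where "f n x = (\<Sum>k<n. indicator B (zpow (int k) x)) / real n" for n :: nat and x
  note [measurable] = B(1)
  have [measurable]: "f n \<in> borel_measurable M" for n unfolding f_def by measurable
  have a0: "0 \<le> a n" for n unfolding a_def by (intro divide_nonneg_nonneg sum_nonneg) auto
  have f01: "0 \<le> f n x" "f n x \<le> 1" for n x
  proof -
    have "(\<Sum>k<n. indicator B (zpow (int k) x)) \<le> (\<Sum>k<n. 1 :: real)" by (intro sum_mono) (auto simp: indicator_def)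
    then show "f n x \<le> 1" by (auto simp: f_def divide_le_eq)
    show "0 \<le> f n x" unfolding f_def by (intro divide_nonneg_nonneg sum_nonneg) auto
  qed
  have iB: "integrable M (indicator (B \<inter> X) :: 'a \<Rightarrow> real)" if "X \<in> sets M" for X
    using B that emeasure_mono[of "B \<inter> X" B M] by (auto intro!: le_less_trans[of "emeasure M (B \<inter> X)"])
  assume "\<not> (\<lambda>n. (\<Sum>k<n. measure M (B \<inter> pre (int k) B)) / real n) \<longlonglongrightarrow> 0"
  then obtain e where e: "0 < e" "\<And>N. \<exists>n\<ge>N. e \<le> a n"
    unfolding a_def[symmetric] LIMSEQ_iff using a0 by (auto simp: not_less)
  \<comment> \<open>Chosen so that the part of \<open>B\<close> where the average is at most
    \<open>2 * c\<close> contributes at most \<open>e / 2\<close>; the added 1 covers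
    \<open>measure M B = 0\<close>.\<close>
  define c where "c = e / (4 * (measure M B + 1))"
  have c: "0 < c" unfolding c_def using e by (intro divide_pos_pos) (auto intro: add_nonneg_pos)
  have cB: "2 * c * measure M B \<le> e / 2"
  proof -
    have "4 * (measure M B + 1) > 0" by (auto intro: add_nonneg_pos)
    then have "c * (4 * (measure M B + 1)) = e" by (simp add: c_def)
    then have "4 * (c * measure M B) + 4 * c = e" by (simp add: algebra_simps)
    then show ?thesis using c by simp
  qed
  \<comment> \<open>As the averages are at most 1, the integral of \<open>f n\<close> over
    \<open>B\<close> is at most \<open>2 * c * measure M B\<close> plus the measure of
    \<open>BB n\<close>. Hence every \<open>BB N\<close> has mass at least \<open>e / 2\<close>, and
    so has the intersection of this decreasing family.\<close>
  define BB where "BB N = {x \<in> space M. x \<in> B \<and> (\<exists>n\<ge>N. 2 * c < f n x)}" for N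
  have BBs [measurable]: "BB N \<in> sets M" for N unfolding BB_def by measurable
  have BBfin: "emeasure M (BB N) < \<infinity>" for N
    by (rule le_less_trans[OF emeasure_mono B(3)]) (use B in \<open>auto simp: BB_def\<close>)
  have an: "a n \<le> 2 * c * measure M B + measure M (BB n)" for n
  proof -
    have meq: "measure M (B \<inter> pre (int k) B) = (\<integral>x. indicator B x * indicator B (zpow (int k) x) \<partial>M)" for k
    proof -
      have "measure M (B \<inter> pre (int k) B) = (\<integral>x. indicator (B \<inter> pre (int k) B) x \<partial>M)"
        using pre_subset[of "int k" B] by (simp add: Int_absorb2 le_infI2)
      also have "\<dots> = (\<integral>x. indicator B x * indicator B (zpow (int k) x) \<partial>M)"
        by (rule Bochner_Integration.integral_cong) (auto simp: indicator_def pre_def)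
      finally show ?thesis .
    qed
    have ik: "integrable M (\<lambda>x. indicator B x * indicator B (zpow (int k) x) :: real)" for k
    proof -
      have "integrable M (\<lambda>x. indicator B x * indicator B (zpow (int k) x) :: real) \<longleftrightarrow>
        integrable M (indicator (B \<inter> pre (int k) B) :: 'a \<Rightarrow> real)"
        by (rule Bochner_Integration.integrable_cong) (auto simp: indicator_def pre_def)
      then show ?thesis using iB[of "pre (int k) B"] B by simp
    qed
    have feq: "indicator B x * f n x = (\<Sum>k<n. indicator B x * indicator B (zpow (int k) x)) / real n" for x
      unfolding f_def by (simp only: sum_distrib_left times_divide_eq_right)
    have "a n = (\<integral>x. indicator B x * f n x \<partial>M)"
      unfolding a_def meq feq
      by (subst Bochner_Integration.integral_divide_zero, subst Bochner_Integration.integral_sum[OF ik]) (rule refl)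
    also have "\<dots> \<le> (\<integral>x. 2 * c * indicator B x + indicator (BB n) x \<partial>M)"
    proof (rule integral_mono)
      show "integrable M (\<lambda>x. indicator B x * f n x)"
        unfolding feq by (intro integrable_divide Bochner_Integration.integrable_sum ik)
      show "integrable M (\<lambda>x. 2 * c * indicator B x + indicator (BB n) x)" using B BBfin by simp
      fix x assume "x \<in> space M"
      then show "indicator B x * f n x \<le> 2 * c * indicator B x + indicator (BB n) x"
        using f01[of n x] c by (auto simp: indicator_def BB_def not_less)
    qed
    also have "\<dots> = 2 * c * measure M B + measure M (BB n)"
      using B BBfin[of n] by (subst Bochner_Integration.integral_add) auto
    finally show ?thesis .
  qed
  have dec: "decseq BB" by (auto simp: decseq_def BB_def intro: le_trans)
  have BBe: "e / 2 \<le> measure M (BB N)" for N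
  proof -
    obtain n where n: "n \<ge> N" "e \<le> a n" using e(2) by blast
    then have "e / 2 \<le> measure M (BB n)" using an[of n] cB by linarith
    also have "\<dots> \<le> measure M (BB N)"
      using dec n BBfin[of N] by (intro measure_mono_fmeasurable) (auto simp: decseq_def fmeasurable_def)
    finally show ?thesis .
  qed
  have "(\<lambda>N. measure M (BB N)) \<longlonglongrightarrow> measure M (\<Inter>N. BB N)"
    using dec BBfin by (intro Lim_measure_decseq) (auto simp: less_top)
  then have pos: "e / 2 \<le> measure M (\<Inter>N. BB N)" using BBe by (intro LIMSEQ_le_const) auto
  \<comment> \<open>The upper limit of the averages exceeds \<open>c\<close>, stated with a margin
    \<open>1 / real (Suc m)\<close>. The margin tolerates errors of order \<open>1 / real n\<close>,
    which makes \<open>E\<close> invariant exactly and not only up to a null set.\<close>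
  define E where "E = {x \<in> space M. \<exists>m::nat. \<forall>N. \<exists>n\<ge>N. c + 1 / real (Suc m) < f n x}"
  have Es: "E \<in> sets M" unfolding E_def by measurable
  have BE: "(\<Inter>N. BB N) \<subseteq> E \<inter> B"
  proof
    fix x assume x: "x \<in> (\<Inter>N. BB N)"
    obtain m where m: "1 / real (Suc m) < c" using c nat_approx_posE by blast
    have "\<forall>N. \<exists>n\<ge>N. c + 1 / real (Suc m) < f n x"
    proof
      fix N
      have "x \<in> BB N" using x by auto
      then obtain n where "n \<ge> N" "2 * c < f n x" by (auto simp: BB_def)
      then show "\<exists>n\<ge>N. c + 1 / real (Suc m) < f n x" using m by (intro exI[of _ n]) auto
    qed
    moreover have "x \<in> BB 0" using x by blast
    ultimately show "x \<in> E \<inter> B" by (auto simp: E_def BB_def)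
  qed
  have close: "\<bar>f n (T x) - f n x\<bar> \<le> 1 / real n" if "x \<in> space M" for n x
  proof -
    have "(\<Sum>k<n. indicator B (zpow (int k) (T x)) :: real) + indicator B x = (\<Sum>k<Suc n. indicator B (zpow (int k) x))"
      by (subst sum.lessThan_Suc_shift) (simp add: zpow_of_nat funpow_swap1 del: of_nat_Suc)
    then have "(\<Sum>k<n. indicator B (zpow (int k) (T x)) :: real) - (\<Sum>k<n. indicator B (zpow (int k) x))
        = indicator B (zpow (int n) x) - indicator B x" by simp
    then have "f n (T x) - f n x = (indicator B (zpow (int n) x) - indicator B x) / real n"
      unfolding f_def by (simp add: diff_divide_distrib[symmetric])
    then show ?thesis by (auto simp: indicator_def abs_if)
  qed
  \<comment> \<open>A new margin below half of the old one absorbs the error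
    \<open>1 / real n\<close> as soon as \<open>n\<close> is at least \<open>Suc p\<close>.\<close>
  have persist: "\<exists>m::nat. \<forall>N. \<exists>n\<ge>N. c + 1 / real (Suc m) < h n"
    if gh: "\<And>n. \<bar>g n - h n\<bar> \<le> 1 / real n" and g: "\<forall>N. \<exists>n\<ge>N. c + 1 / real (Suc m) < g n" for g h :: "nat \<Rightarrow> real" and m :: nat
  proof -
    define d where "d = 1 / real (Suc m)"
    have "0 < d / 2" by (simp add: d_def)
    then obtain p where p: "1 / real (Suc p) < d / 2" by (rule nat_approx_posE)
    show ?thesis
    proof (rule exI[of _ p], rule allI)
      fix N
      obtain n where n: "n \<ge> max N (Suc p)" "c + d < g n" using g unfolding d_def by blast
      have "1 / real n \<le> 1 / real (Suc p)" using n by (intro divide_left_mono) auto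
      moreover have "g n - h n \<le> 1 / real n" using gh[of n] by linarith
      ultimately have "c + 1 / real (Suc p) < h n" using n(2) p by linarith
      then show "\<exists>n\<ge>N. c + 1 / real (Suc p) < h n" using n by (intro exI[of _ n]) auto
    qed
  qed
  have "pre 1 E = E"
  proof (intro equalityI subsetI)
    fix x assume "x \<in> pre 1 E"
    then have x: "x \<in> space M" "T x \<in> E" using zpow_succ[of x 0] by (auto simp: pre_def)
    then obtain m where "\<forall>N. \<exists>n\<ge>N. c + 1 / real (Suc m) < f n (T x)" by (auto simp: E_def)
    from persist[OF close[OF x(1)] this] show "x \<in> E" using x by (simp add: E_def)
  next
    fix x assume "x \<in> E"
    then obtain m where x: "x \<in> space M" and m: "\<forall>N. \<exists>n\<ge>N. c + 1 / real (Suc m) < f n x" by (auto simp: E_def)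
    have "\<bar>f n x - f n (T x)\<bar> \<le> 1 / real n" for n using close[OF x, of n] by (simp add: abs_minus_commute)
    from persist[OF this m] show "x \<in> pre 1 E"
      using x zpow_succ[of x 0] measurable_space[OF T_measurable x] by (simp add: E_def pre_def)
  qed
  then have Einv: "invariant E" using Es by (intro invariantI) auto
  have "emeasure M E \<le> ennreal (measure M B / c)"
  proof (rule maximal_inequality[OF B(1,3) c Es])
    fix x assume "x \<in> E"
    then obtain m :: nat where m: "\<forall>N. \<exists>n\<ge>N. c + 1 / real (Suc m) < f n x" by (auto simp: E_def)
    from m[rule_format, of 1] obtain n where n: "n \<ge> 1" "c + 1 / real (Suc m) < f n x" by blast
    moreover have "0 < 1 / real (Suc m)" by simp
    ultimately have "c < f n x" by linarith
    then show "\<exists>n. real n * c < (\<Sum>k<n. indicator B (zpow (int k) x))"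
      using n(1) by (intro exI[of _ n]) (simp add: f_def field_simps)
  qed
  then have Efin: "emeasure M E < \<infinity>" by (simp add: le_less_trans)
  define F where "F = E \<inter> Nul"
  have Finv: "invariant F" unfolding F_def by (rule invariant_Int[OF Einv Nul])
  then have Fs: "F \<in> sets M" by (rule invariantD)
  have Ffin: "emeasure M F \<noteq> \<infinity>"
    using emeasure_mono[of F E M] Efin Es by (auto simp: F_def top_unique)
  have F0: "emeasure M F \<noteq> 0"
  proof
    assume "emeasure M F = 0"
    then have "emeasure M (\<Inter>N. BB N) = 0"
      using emeasure_mono[of "\<Inter>N. BB N" F M] BE B Fs by (auto simp: F_def)
    then show False using pos e by (simp add: measure_def)
  qed
  \<comment> \<open>Conditioning on an invariant set of positive finite measure yields an invariant
    probability, here one living on \<open>Nul\<close>.\<close>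
  define \<nu> where "\<nu> = uniform_measure M F"
  have "invariant_prob M T \<nu>"
    unfolding invariant_prob_def
  proof (intro conjI)
    show "prob_space \<nu>" unfolding \<nu>_def by (rule prob_space_uniform_measure[OF F0 Ffin])
    show s: "sets \<nu> = sets M" by (simp add: \<nu>_def)
    show "distr \<nu> M T = \<nu>"
    proof (rule measure_eqI)
      fix X assume "X \<in> sets (distr \<nu> M T)"
      then have X: "X \<in> sets M" by simp
      have T: "T \<in> \<nu> \<rightarrow>\<^sub>M M" using T_measurable s by simp
      have "T -` X \<inter> space \<nu> = pre 1 X"
        using zpow_succ[of _ 0] by (auto simp: pre_def \<nu>_def)
      then show "emeasure (distr \<nu> M T) X = emeasure \<nu> X"
        using emeasure_distr[OF T X] emeasure_invariant_pre[OF Finv X, of 1] X Fs by (simp add: \<nu>_def)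
    qed (simp add: s)
  qed
  moreover have "absolutely_continuous (measure_on M Nul) \<nu>"
    unfolding absolutely_continuous_def
  proof
    fix X assume "X \<in> null_sets (measure_on M Nul)"
    then have X: "X \<in> sets M" "emeasure M (Nul \<inter> X) = 0"
      using emeasure_measure_on[OF invariantD(1)[OF Nul], of X] by (auto simp: null_sets_def)
    then have "emeasure M (F \<inter> X) = 0"
      using emeasure_mono[of "F \<inter> X" "Nul \<inter> X" M] invariantD(1)[OF Nul] by (auto simp: F_def)
    then show "X \<in> null_sets \<nu>" using X Fs by (auto simp: \<nu>_def null_sets_def)
  qed
  ultimately show False using no_inv by blast
qed

end

section \<open>Poisson laws\<close>

lemma sets_Nats_ennreal [measurable]: "(\<nat> :: ennreal set) \<in> sets borel"
  by (rule sets.countable) (auto simp: Nats_def)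

text \<open>The cells of the partition of \<open>\<Union>\<B>\<close> generated by
  \<open>\<B>\<close>: two points are equivalent when they lie in the same members. Counts on
  overlapping sets become sums of counts on disjoint cells, to which the Poisson property
  applies.\<close>

definition atoms :: "'a set set \<Rightarrow> 'a set set" where
  "atoms \<B> = (\<lambda>x. {y \<in> \<Union>\<B>. \<forall>B \<in> \<B>. y \<in> B \<longleftrightarrow> x \<in> B}) ` \<Union>\<B>"

lemma finite_atoms:
  assumes "finite \<B>"
  shows "finite (atoms \<B>)"
proof -
  have "atoms \<B> \<subseteq> (\<lambda>a. {y \<in> \<Union>\<B>. {B \<in> \<B>. y \<in> B} = a}) ` Pow \<B>"
    unfolding atoms_def
  proof (rule image_subsetI)
    fix x
    show "{y \<in> \<Union>\<B>. \<forall>B \<in> \<B>. y \<in> B \<longleftrightarrow> x \<in> B} \<in> (\<lambda>a. {y \<in> \<Union>\<B>. {B \<in> \<B>. y \<in> B} = a}) ` Pow \<B>"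
      by (rule image_eqI[of _ _ "{B \<in> \<B>. x \<in> B}"]) auto
  qed
  then show ?thesis using assms by (meson finite_Pow_iff finite_imageI finite_subset)
qed

lemma atoms_disjoint: "C \<in> atoms \<B> \<Longrightarrow> C' \<in> atoms \<B> \<Longrightarrow> C \<noteq> C' \<Longrightarrow> C \<inter> C' = {}"
proof -
  assume "C \<in> atoms \<B>" "C' \<in> atoms \<B>" and ne: "C \<noteq> C'"
  then obtain x x' where C: "C = {y \<in> \<Union>\<B>. \<forall>B \<in> \<B>. y \<in> B \<longleftrightarrow> x \<in> B}" "C' = {y \<in> \<Union>\<B>. \<forall>B \<in> \<B>. y \<in> B \<longleftrightarrow> x' \<in> B}"
    by (auto simp: atoms_def)
  show "C \<inter> C' = {}"
  proof (rule equals0I)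
    fix y assume y: "y \<in> C \<inter> C'"
    then have "x \<in> B \<longleftrightarrow> x' \<in> B" if "B \<in> \<B>" for B using that unfolding C by blast
    then have "C = C'" unfolding C by blast
    then show False using ne by contradiction
  qed
qed

lemma atoms_nonempty: "C \<in> atoms \<B> \<Longrightarrow> C \<noteq> {}"
  unfolding atoms_def by auto

lemma atoms_subset: "C \<in> atoms \<B> \<Longrightarrow> C \<subseteq> \<Union>\<B>"
  unfolding atoms_def by auto

lemma Union_atoms: "B \<in> \<B> \<Longrightarrow> \<Union>{C \<in> atoms \<B>. C \<subseteq> B} = B"
proof (intro equalityI subsetI)
  fix x assume B: "B \<in> \<B>" and x: "x \<in> B"
  have "{y \<in> \<Union>\<B>. \<forall>B \<in> \<B>. y \<in> B \<longleftrightarrow> x \<in> B} \<in> {C \<in> atoms \<B>. C \<subseteq> B}"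
    using B x by (auto simp: atoms_def)
  moreover have "x \<in> {y \<in> \<Union>\<B>. \<forall>B \<in> \<B>. y \<in> B \<longleftrightarrow> x \<in> B}" using B x by auto
  ultimately show "x \<in> \<Union>{C \<in> atoms \<B>. C \<subseteq> B}" by blast
qed auto

lemma sets_atoms:
  assumes "finite \<B>" "\<B> \<subseteq> sets M" "C \<in> atoms \<B>"
  shows "C \<in> sets M"
proof -
  obtain x where C: "C = {y \<in> \<Union>\<B>. \<forall>B \<in> \<B>. y \<in> B \<longleftrightarrow> x \<in> B}" using assms(3) by (auto simp: atoms_def)
  have "C = \<Union>\<B> - (\<Union>B\<in>{B \<in> \<B>. x \<in> B}. \<Union>\<B> - B) - \<Union>{B \<in> \<B>. x \<notin> B}" unfolding C by auto
  also have "\<dots> \<in> sets M"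
    using assms by (intro sets.Diff sets.finite_UN sets.finite_Union) auto
  finally show ?thesis .
qed

lemma emeasure_eq_sum_atoms:
  assumes "finite \<B>" "\<B> \<subseteq> sets \<nu>" "B \<in> \<B>"
  shows "emeasure \<nu> B = (\<Sum>C\<in>{C \<in> atoms \<B>. C \<subseteq> B}. emeasure \<nu> C)"
proof -
  have "(\<Sum>C\<in>{C \<in> atoms \<B>. C \<subseteq> B}. emeasure \<nu> C) = emeasure \<nu> (\<Union>C\<in>{C \<in> atoms \<B>. C \<subseteq> B}. C)"
    using assms finite_atoms[OF assms(1)] sets_atoms[OF assms(1,2)] atoms_disjoint[of _ \<B>]
    by (intro sum_emeasure) (auto simp: disjoint_family_on_def)
  then show ?thesis using Union_atoms[OF assms(3)] by simp
qed

text \<open>\<open>poisson_measure\<close> speaks of families indexed by naturals, whereas atoms are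
  indexed by themselves; this transports independence between index sets.\<close>

lemma (in prob_space) indep_vars_reindex_bij:
  assumes h: "bij_betw h I J" and ind: "indep_vars (\<lambda>_. N) (\<lambda>i. X (h i)) I"
  shows "indep_vars (\<lambda>_. N) X J"
proof -
  have J: "J = h ` I" and inj: "inj_on h I" using h by (auto simp: bij_betw_def)
  have "indep_sets (\<lambda>j. {X j -` S \<inter> space M |S. S \<in> sets N}) J"
  proof (rule indep_setsI)
    fix j assume "j \<in> J"
    then show "{X j -` S \<inter> space M |S. S \<in> sets N} \<subseteq> events"
      using ind unfolding indep_vars_def2 J by (auto intro: measurable_sets)
  next
    fix Z K assume K: "K \<noteq> {}" "K \<subseteq> J" "finite K" and Z: "\<forall>j\<in>K. Z j \<in> {X j -` S \<inter> space M |S. S \<in> sets N}"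
    define K' where "K' = {i \<in> I. h i \<in> K}"
    have KK: "K = h ` K'" using K(2) by (auto simp: K'_def J)
    have inj': "inj_on h K'" using inj by (rule inj_on_subset) (auto simp: K'_def)
    have "finite K'" using K(3) inj' unfolding KK by (rule finite_imageD)
    moreover have "K' \<noteq> {}" using K(1) KK by auto
    ultimately have "prob (\<Inter>i\<in>K'. Z (h i)) = (\<Prod>i\<in>K'. prob (Z (h i)))"
      using ind Z unfolding indep_vars_def2
      by (intro indep_setsD[where F = "\<lambda>i. {X (h i) -` S \<inter> space M |S. S \<in> sets N}" and I = I]) (auto simp: KK, auto simp: K'_def)
    then show "prob (\<Inter>j\<in>K. Z j) = (\<Prod>j\<in>K. prob (Z j))"
      by (simp add: KK prod.reindex[OF inj'])
  qed
  then show ?thesis using ind unfolding indep_vars_def2 J by auto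
qed

lemma (in prob_space) abs_prob_diff_le:
  assumes "U \<in> events" "U' \<in> events" "W \<in> events" "sym_diff U U' \<subseteq> W"
  shows "\<bar>prob U - prob U'\<bar> \<le> prob W"
proof -
  have "prob U \<le> prob (U' \<union> W)" "prob U' \<le> prob (U \<union> W)" using assms by (auto intro!: finite_measure_mono)
  moreover have "prob (U' \<union> W) \<le> prob U' + prob W" "prob (U \<union> W) \<le> prob U + prob W"
    using assms by (auto intro: measure_Un_le)
  ultimately show ?thesis by linarith
qed

section \<open>Counts under a Poisson law with intensity restricted to \<open>E\<close>\<close>

locale poisson_law =
  fixes M :: "'a measure" and A :: "nat \<Rightarrow> 'a set" and E :: "'a set" and P :: "'a measure measure"
  assumes partition: "finite_measure_partition M A"
    and E: "E \<in> sets M"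
    and poisson: "poisson_measure M A (measure_on M E) P"

sublocale poisson_law \<subseteq> prob_space P
  using poisson by (simp add: poisson_measure_def)

context poisson_law
begin

lemma A_sets [simp]: "A n \<in> sets M" and A_finite: "emeasure M (A n) < \<infinity>"
  and A_disjoint: "disjoint_family A" and UN_A: "(\<Union>n. A n) = space M"
  using partition by (auto simp: finite_measure_partition_def)

lemma sets_P: "sets P = sets (configuration_space M A)"
  using poisson by (simp add: poisson_measure_def)

lemma space_P: "space P = configurations M A"
  using sets_eq_imp_space_eq[OF sets_P] space_configuration_space by simp

lemma sets_config: "\<nu> \<in> space P \<Longrightarrow> sets \<nu> = sets M"
  by (simp add: space_P configurations_def)

lemma measurable_into_P:
  assumes sp: "\<And>x. x \<in> space N \<Longrightarrow> f x \<in> configurations M A"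
    and ev: "\<And>B. B \<in> sets M \<Longrightarrow> emeasure M B < \<infinity> \<Longrightarrow> (\<lambda>x. emeasure (f x) B) \<in> borel_measurable N"
  shows "f \<in> N \<rightarrow>\<^sub>M P"
proof -
  have "f \<in> N \<rightarrow>\<^sub>M configuration_space M A"
    unfolding configuration_space_def
    by (rule measurable_SUP2) (use sp ev in \<open>auto intro!: measurable_vimage_algebra2 exI[of _ "{}"]\<close>)
  then show ?thesis by (simp add: measurable_cong_sets[OF refl sets_P])
qed

lemma measurable_count_finite: "B \<in> sets M \<Longrightarrow> emeasure M B < \<infinity> \<Longrightarrow> (\<lambda>\<nu>. emeasure \<nu> B) \<in> borel_measurable P"
  using measurable_emeasure_configuration_space[of B M A] by (simp add: measurable_cong_sets[OF sets_P refl])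

lemma finite_Int_A: "B \<in> sets M \<Longrightarrow> emeasure M (B \<inter> A n) < \<infinity>"
  using emeasure_mono[of "B \<inter> A n" "A n" M] A_finite[of n] by (simp add: le_less_trans)

lemma emeasure_eq_suminf:
  assumes "sets \<nu> = sets M" "B \<in> sets M"
  shows "emeasure \<nu> B = (\<Sum>n. emeasure \<nu> (B \<inter> A n))"
proof -
  have "(\<Sum>n. emeasure \<nu> (B \<inter> A n)) = emeasure \<nu> (\<Union>n. B \<inter> A n)"
    using assms A_disjoint by (intro suminf_emeasure) (auto simp: disjoint_family_on_def)
  also have "(\<Union>n. B \<inter> A n) = B" using UN_A sets.sets_into_space[OF assms(2)] by blast
  finally show ?thesis by simp
qed

text \<open>Sets of infinite measure are cut by the partition; the count is a countable sum of the
  counts that generate the sigma-algebra.\<close>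

lemma measurable_count [measurable]: "B \<in> sets M \<Longrightarrow> (\<lambda>\<nu>. emeasure \<nu> B) \<in> borel_measurable P"
proof -
  assume B: "B \<in> sets M"
  have "(\<lambda>\<nu>. \<Sum>n. emeasure \<nu> (B \<inter> A n)) \<in> borel_measurable P"
    using B finite_Int_A by (intro borel_measurable_suminf_order measurable_count_finite) auto
  then show ?thesis
    by (rule measurable_cong[THEN iffD1, rotated]) (use emeasure_eq_suminf[OF sets_config B] in auto)
qed

text \<open>The Poisson parameter as a real number. It is 0 when \<open>E \<inter> B\<close> has
  infinite measure, whence the finiteness hypotheses below.\<close>

definition mean :: "'a set \<Rightarrow> real" where
  "mean B = measure M (E \<inter> B)"

lemma mean_eq: "B \<in> sets M \<Longrightarrow> measure (measure_on M E) B = mean B"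
  using emeasure_measure_on[OF E] by (simp add: mean_def measure_def)

lemma mean_nonneg [simp]: "0 \<le> mean B" by (simp add: mean_def)

lemma finite_E_Int: "emeasure M B < \<infinity> \<Longrightarrow> B \<in> sets M \<Longrightarrow> emeasure M (E \<inter> B) < \<infinity>"
  using emeasure_mono[of "E \<inter> B" B M] by (simp add: le_less_trans)

lemma mean_mono: "B \<in> sets M \<Longrightarrow> B' \<in> sets M \<Longrightarrow> B \<subseteq> B' \<Longrightarrow> emeasure M (E \<inter> B') < \<infinity> \<Longrightarrow> mean B \<le> mean B'"
  unfolding mean_def using E by (intro measure_mono_fmeasurable) (auto simp: fmeasurable_def)

lemma mean_UN_le:
  assumes "finite I" "\<And>i. i \<in> I \<Longrightarrow> C i \<in> sets M" "\<And>i. i \<in> I \<Longrightarrow> emeasure M (E \<inter> C i) < \<infinity>"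
  shows "mean (\<Union>i\<in>I. C i) \<le> (\<Sum>i\<in>I. mean (C i))"
proof -
  have "measure M (\<Union>i\<in>I. E \<inter> C i) \<le> (\<Sum>i\<in>I. measure M (E \<inter> C i))"
    using assms E by (intro measure_UNION_le) auto
  then show ?thesis by (simp add: mean_def)
qed

lemma counts_indep:
  assumes I: "finite (I :: 'i set)" and dis: "disjoint_family_on B I"
    and B: "\<And>i. i \<in> I \<Longrightarrow> B i \<in> sets M" "\<And>i. i \<in> I \<Longrightarrow> emeasure M (E \<inter> B i) < \<infinity>"
  shows "indep_vars (\<lambda>_. borel) (\<lambda>i \<nu>. emeasure \<nu> (B i)) I"
proof -
  obtain h where h: "bij_betw h {0..<card I} I" using ex_bij_betw_nat_finite[OF I] by blast
  have hI: "h i \<in> I" if "i \<in> {0..<card I}" for i using h that by (auto simp: bij_betw_def)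
  have "disjoint_family_on (\<lambda>i. B (h i)) {0..<card I}"
    using dis h hI unfolding disjoint_family_on_def bij_betw_def inj_on_def by blast
  then have "indep_vars (\<lambda>_. borel) (\<lambda>i \<nu>. emeasure \<nu> (B (h i))) {0..<card I}"
    using poisson B hI emeasure_measure_on[OF E] unfolding poisson_measure_def by auto
  then show ?thesis by (rule indep_vars_reindex_bij[OF h])
qed

lemma prob_count_eq:
  assumes "B \<in> sets M" "emeasure M (E \<inter> B) < \<infinity>"
  shows "prob {\<nu> \<in> space P. emeasure \<nu> B = of_nat k} = mean B ^ k / fact k * exp (- mean B)"
proof -
  have "\<forall>i\<in>{0::nat}. \<forall>k :: nat. prob {\<nu> \<in> space P. emeasure \<nu> ((\<lambda>_. B) i) = of_nat k} =
           measure (measure_on M E) ((\<lambda>_. B) i) ^ k / fact k * exp (- measure (measure_on M E) ((\<lambda>_. B) i))"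
    using poisson assms emeasure_measure_on[OF E, of B] unfolding poisson_measure_def
    by (elim conjE allE[of _ "{0}"] allE[of _ "\<lambda>_. B"]) (auto simp: disjoint_family_on_def)
  then show ?thesis using mean_eq[OF assms(1)] by simp
qed

text \<open>Natural values are required explicitly because a configuration may take others on a set
  \<open>B\<close> that is not one of the \<open>A n\<close>.\<close>

lemma emeasure_count_in:
  assumes B: "B \<in> sets M" "emeasure M (E \<inter> B) < \<infinity>" and X: "X \<in> sets borel"
  shows "emeasure P {\<nu> \<in> space P. emeasure \<nu> B \<in> \<nat> \<and> emeasure \<nu> B \<in> X}
    = (\<Sum>k. if of_nat k \<in> X then ennreal (mean B ^ k / fact k * exp (- mean B)) else 0)"
proof -
  define Z where "Z k = {\<nu> \<in> space P. emeasure \<nu> B = of_nat k \<and> of_nat k \<in> X}" for k :: nat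
  have [measurable]: "B \<in> sets M" by fact
  have "Z k \<in> events" for k unfolding Z_def by measurable
  then have "(\<Sum>k. emeasure P (Z k)) = emeasure P (\<Union>k. Z k)"
    by (intro suminf_emeasure) (auto simp: Z_def disjoint_family_on_def)
  moreover have "(\<Union>k. Z k) = {\<nu> \<in> space P. emeasure \<nu> B \<in> \<nat> \<and> emeasure \<nu> B \<in> X}"
    by (auto simp: Z_def Nats_def)
  moreover have "emeasure P (Z k) = (if of_nat k \<in> X then ennreal (mean B ^ k / fact k * exp (- mean B)) else 0)" for k
    using prob_count_eq[OF B, of k] by (simp add: Z_def emeasure_eq_measure)
  ultimately show ?thesis by simp
qed

text \<open>The Poisson weights of the natural values sum to 1, which leaves no probability for any
  other value.\<close>

lemma AE_count_Nats:
  assumes B: "B \<in> sets M" "emeasure M (E \<inter> B) < \<infinity>"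
  shows "AE \<nu> in P. emeasure \<nu> B \<in> \<nat>"
proof -
  have "(\<lambda>k. mean B ^ k / fact k * exp (- mean B)) sums (exp (mean B) * exp (- mean B))"
    using exp_converges[of "mean B"] by (intro sums_mult2) (simp add: divide_inverse mult.commute)
  then have s: "(\<lambda>k. mean B ^ k / fact k * exp (- mean B)) sums 1" by (simp add: exp_minus)
  have U: "(UNIV :: ennreal set) \<in> sets borel" by simp
  have "emeasure P {\<nu> \<in> space P. emeasure \<nu> B \<in> \<nat>} = (\<Sum>k. ennreal (mean B ^ k / fact k * exp (- mean B)))"
    using emeasure_count_in[OF B U] by (simp only: UNIV_I if_True simp_thms)
  also have "\<dots> = ennreal 1" using s by (subst suminf_ennreal_eq[OF _ s]) auto
  finally have "prob {\<nu> \<in> space P. emeasure \<nu> B \<in> \<nat>} = 1" by (simp add: measure_def)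
  moreover have "{\<nu> \<in> space P. emeasure \<nu> B \<in> \<nat>} \<in> events" using B(1) by measurable
  ultimately show ?thesis using AE_in_set_eq_1 by fastforce
qed

lemma distr_count_cong:
  assumes B: "B \<in> sets M" "emeasure M (E \<inter> B) < \<infinity>" and B': "B' \<in> sets M" "emeasure M (E \<inter> B') = emeasure M (E \<inter> B)"
  shows "distr P borel (\<lambda>\<nu>. emeasure \<nu> B) = distr P borel (\<lambda>\<nu>. emeasure \<nu> B')"
proof (rule measure_eqI)
  fix X assume "X \<in> sets (distr P borel (\<lambda>\<nu>. emeasure \<nu> B))"
  then have X [measurable]: "X \<in> sets borel" by simp
  have *: "emeasure (distr P borel (\<lambda>\<nu>. emeasure \<nu> C)) X
      = (\<Sum>k. if of_nat k \<in> X then ennreal (mean C ^ k / fact k * exp (- mean C)) else 0)"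
    if C: "C \<in> sets M" "emeasure M (E \<inter> C) < \<infinity>" for C
  proof -
    have [measurable]: "C \<in> sets M" by fact
    have "emeasure (distr P borel (\<lambda>\<nu>. emeasure \<nu> C)) X = emeasure P ((\<lambda>\<nu>. emeasure \<nu> C) -` X \<inter> space P)"
      by (rule emeasure_distr) auto
    also have "\<dots> = emeasure P {\<nu> \<in> space P. emeasure \<nu> C \<in> \<nat> \<and> emeasure \<nu> C \<in> X}"
      by (rule emeasure_eq_AE) (use AE_count_Nats[OF C] in auto)
    finally show ?thesis using emeasure_count_in[OF C X] by simp
  qed
  have "mean B' = mean B" using B'(2) by (simp add: mean_def measure_def)
  show "emeasure (distr P borel (\<lambda>\<nu>. emeasure \<nu> B)) X = emeasure (distr P borel (\<lambda>\<nu>. emeasure \<nu> B')) X"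
    unfolding *[OF B] *[OF B'(1) B'(2)[THEN ord_eq_less_trans, OF B(2)]] \<open>mean B' = mean B\<close> by (rule refl)
qed simp

text \<open>Disjointness makes both joint laws products of Poisson laws, and equal means give equal
  factors. With \<open>B'\<close> the translates of \<open>B\<close>, this is the stationarity of
  the suspension.\<close>

lemma distr_counts_cong:
  assumes I: "finite (I :: 'i set)" and dis: "disjoint_family_on B I" "disjoint_family_on B' I"
    and B: "\<And>i. i \<in> I \<Longrightarrow> B i \<in> sets M" "\<And>i. i \<in> I \<Longrightarrow> emeasure M (E \<inter> B i) < \<infinity>"
    and B': "\<And>i. i \<in> I \<Longrightarrow> B' i \<in> sets M" "\<And>i. i \<in> I \<Longrightarrow> emeasure M (E \<inter> B' i) = emeasure M (E \<inter> B i)"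
  shows "distr P (\<Pi>\<^sub>M i\<in>I. borel) (\<lambda>\<nu>. \<lambda>i\<in>I. emeasure \<nu> (B i)) = distr P (\<Pi>\<^sub>M i\<in>I. borel) (\<lambda>\<nu>. \<lambda>i\<in>I. emeasure \<nu> (B' i))"
proof (cases "I = {}")
  case True
  then show ?thesis by (simp add: restrict_def)
next
  case False
  have *: "distr P (\<Pi>\<^sub>M i\<in>I. borel) (\<lambda>\<nu>. \<lambda>i\<in>I. emeasure \<nu> (C i)) = (\<Pi>\<^sub>M i\<in>I. distr P borel (\<lambda>\<nu>. emeasure \<nu> (C i)))"
    if "disjoint_family_on C I" "\<And>i. i \<in> I \<Longrightarrow> C i \<in> sets M" "\<And>i. i \<in> I \<Longrightarrow> emeasure M (E \<inter> C i) < \<infinity>" for C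
  proof -
    have "indep_vars (\<lambda>_. borel) (\<lambda>i \<nu>. emeasure \<nu> (C i)) I" using that by (intro counts_indep[OF I])
    then show ?thesis
      by (rule iffD1[OF indep_vars_iff_distr_eq_PiM'[OF False], rotated]) (use that(2) in simp)
  qed
  have "(\<Pi>\<^sub>M i\<in>I. distr P borel (\<lambda>\<nu>. emeasure \<nu> (B i))) = (\<Pi>\<^sub>M i\<in>I. distr P borel (\<lambda>\<nu>. emeasure \<nu> (B' i)))"
    using B B' by (intro PiM_cong refl distr_count_cong)
  then show ?thesis
    using *[OF dis(1) B] *[OF dis(2) B'(1)] B(2) B'(2) by simp
qed

section \<open>Events observed in a region\<close>

definition cyl :: "'a set set \<Rightarrow> ('a set \<Rightarrow> ennreal set) \<Rightarrow> 'a measure set" where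
  "cyl \<B> V = {\<nu> \<in> space P. \<forall>B\<in>\<B>. emeasure \<nu> B \<in> V B}"

text \<open>An intersection-stable generator. Only test sets of finite measure occur, so that each
  count involved has a Poisson law.\<close>

definition cyls :: "'a set \<Rightarrow> 'a measure set set" where
  "cyls G = {cyl \<B> V | \<B> V. finite \<B> \<and> \<B> \<subseteq> {B \<in> sets M. emeasure M B < \<infinity> \<and> B \<subseteq> G} \<and> (\<forall>B. V B \<in> sets borel)}"

definition observed :: "'a set \<Rightarrow> 'a measure set set" where
  "observed G = sigma_sets (space P) (cyls G)"

lemma cylsI: "finite \<B> \<Longrightarrow> (\<And>B. B \<in> \<B> \<Longrightarrow> B \<in> sets M) \<Longrightarrow> (\<And>B. B \<in> \<B> \<Longrightarrow> emeasure M B < \<infinity>) \<Longrightarrow>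
    (\<And>B. B \<in> \<B> \<Longrightarrow> B \<subseteq> G) \<Longrightarrow> (\<And>B. V B \<in> sets borel) \<Longrightarrow> cyl \<B> V \<in> cyls G"
  unfolding cyls_def by blast

lemma cylsE:
  assumes "X \<in> cyls G"
  obtains \<B> V where "X = cyl \<B> V" "finite \<B>" "\<And>B. B \<in> \<B> \<Longrightarrow> B \<in> sets M" "\<And>B. B \<in> \<B> \<Longrightarrow> emeasure M B < \<infinity>"
    "\<And>B. B \<in> \<B> \<Longrightarrow> B \<subseteq> G" "\<And>B. V B \<in> sets borel"
  using assms unfolding cyls_def by blast

text \<open>The map \<open>f\<close> may identify several test sets; their constraints are then
  intersected over the fibre.\<close>

lemma cyls_image:
  assumes "finite \<B>" "\<And>B. B \<in> \<B> \<Longrightarrow> f B \<in> sets M" "\<And>B. B \<in> \<B> \<Longrightarrow> emeasure M (f B) < \<infinity>"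
    "\<And>B. B \<in> \<B> \<Longrightarrow> f B \<subseteq> G" "\<And>B. V B \<in> sets borel"
  shows "{\<nu> \<in> space P. \<forall>B\<in>\<B>. emeasure \<nu> (f B) \<in> V B} \<in> cyls G"
proof -
  define V' where "V' C = (\<Inter>B\<in>{B \<in> \<B>. f B = C}. V B)" for C
  have "V' C \<in> sets borel" for C
  proof (cases "{B \<in> \<B>. f B = C} = {}")
    case True
    then have "V' C = UNIV" unfolding V'_def by blast
    then show ?thesis by simp
  next
    case False
    then show ?thesis unfolding V'_def using assms(1,5) by (intro sets.finite_INT) auto
  qed
  then have "cyl (f ` \<B>) V' \<in> cyls G" using assms(1-4) by (intro cylsI) blast+
  moreover have "cyl (f ` \<B>) V' = {\<nu> \<in> space P. \<forall>B\<in>\<B>. emeasure \<nu> (f B) \<in> V B}"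
    by (auto simp: cyl_def V'_def)
  ultimately show ?thesis by simp
qed

lemma cyls_mono: "G \<subseteq> H \<Longrightarrow> cyls G \<subseteq> cyls H"
  unfolding cyls_def by blast

lemma observed_mono: "G \<subseteq> H \<Longrightarrow> observed G \<subseteq> observed H"
  unfolding observed_def by (intro sigma_sets_mono' cyls_mono)

lemma cyls_events: "cyls G \<subseteq> events"
proof
  fix X assume "X \<in> cyls G"
  then obtain \<B> V where X: "X = cyl \<B> V" "finite \<B>" "\<And>B. B \<in> \<B> \<Longrightarrow> B \<in> sets M" "\<And>B. V B \<in> sets borel"
    by (rule cylsE) blast
  have "{\<nu> \<in> space P. emeasure \<nu> B \<in> V B} \<in> events" if "B \<in> \<B>" for B
    using measurable_sets[OF measurable_count[OF X(3)[OF that]] X(4)[of B]] by (simp add: vimage_def Int_def conj_commute)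
  then show "X \<in> events" unfolding X(1) cyl_def using X(2) by (intro sets.sets_Collect_finite_All) auto
qed

lemma cyls_Pow: "cyls G \<subseteq> Pow (space P)"
  by (auto simp: cyls_def cyl_def)

lemma observed_sigma_algebra: "sigma_algebra (space P) (observed G)"
  unfolding observed_def by (rule sigma_algebra_sigma_sets[OF cyls_Pow])

lemma observed_events: "observed G \<subseteq> events"
  unfolding observed_def by (rule sets.sigma_sets_subset[OF cyls_events])

lemma space_in_cyls: "space P \<in> cyls G"
proof -
  have "cyl {} (\<lambda>_. UNIV) \<in> cyls G" by (rule cylsI) auto
  then show ?thesis by (simp add: cyl_def)
qed

lemma Int_stable_cyls: "Int_stable (cyls G)"
proof (rule Int_stableI)
  fix X Y assume "X \<in> cyls G" "Y \<in> cyls G"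
  obtain \<B> V where X: "X = cyl \<B> V" "finite \<B>" "\<And>B. B \<in> \<B> \<Longrightarrow> B \<in> sets M" "\<And>B. B \<in> \<B> \<Longrightarrow> emeasure M B < \<infinity>"
    "\<And>B. B \<in> \<B> \<Longrightarrow> B \<subseteq> G" "\<And>B. V B \<in> sets borel" using \<open>X \<in> cyls G\<close> by (rule cylsE) blast
  obtain \<B>' V' where Y: "Y = cyl \<B>' V'" "finite \<B>'" "\<And>B. B \<in> \<B>' \<Longrightarrow> B \<in> sets M" "\<And>B. B \<in> \<B>' \<Longrightarrow> emeasure M B < \<infinity>"
    "\<And>B. B \<in> \<B>' \<Longrightarrow> B \<subseteq> G" "\<And>B. V' B \<in> sets borel" using \<open>Y \<in> cyls G\<close> by (rule cylsE) blast
  define U where "U B = (if B \<in> \<B> then V B else UNIV) \<inter> (if B \<in> \<B>' then V' B else UNIV)" for B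
  have "X \<inter> Y = cyl (\<B> \<union> \<B>') U" unfolding X(1) Y(1) cyl_def U_def by auto
  also have "\<dots> \<in> cyls G"
  proof (rule cylsI)
    show "B \<subseteq> G" if "B \<in> \<B> \<union> \<B>'" for B using that X(5) Y(5) by blast
  qed (use X Y in \<open>auto simp: U_def\<close>)
  finally show "X \<inter> Y \<in> cyls G" .
qed

text \<open>A cylinder condition expressed through the counts of the atoms: the count of each member
  of \<open>\<B>\<close> is the sum over the atoms inside it.\<close>

definition atom_region :: "'a set set \<Rightarrow> ('a set \<Rightarrow> ennreal set) \<Rightarrow> ('a set \<Rightarrow> ennreal) set" where
  "atom_region \<B> V = {f \<in> space (\<Pi>\<^sub>M C\<in>atoms \<B>. borel). \<forall>B\<in>\<B>. (\<Sum>C\<in>{C \<in> atoms \<B>. C \<subseteq> B}. f C) \<in> V B}"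

lemma sets_atom_region:
  assumes "finite \<B>" "\<And>B. V B \<in> sets borel"
  shows "atom_region \<B> V \<in> sets (\<Pi>\<^sub>M C\<in>atoms \<B>. borel)"
proof -
  let ?N = "\<Pi>\<^sub>M C\<in>atoms \<B>. (borel :: ennreal measure)"
  have "{f \<in> space ?N. (\<Sum>C\<in>{C \<in> atoms \<B>. C \<subseteq> B}. f C) \<in> V B} \<in> sets ?N" for B
  proof -
    have "(\<lambda>f. \<Sum>C\<in>{C \<in> atoms \<B>. C \<subseteq> B}. f C) \<in> borel_measurable ?N"
      by (intro borel_measurable_sum measurable_component_singleton) auto
    from measurable_sets[OF this assms(2)[of B]] show ?thesis by (simp add: vimage_def Int_def conj_commute)
  qed
  then show ?thesis unfolding atom_region_def using assms(1) by (intro sets.sets_Collect_finite_All) auto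
qed

lemma cyl_eq_vimage_atom_region:
  assumes "finite \<B>" "\<B> \<subseteq> sets M"
  shows "cyl \<B> V = (\<lambda>\<nu>. \<lambda>C\<in>atoms \<B>. emeasure \<nu> C) -` atom_region \<B> V \<inter> space P"
proof -
  have "emeasure \<nu> B = (\<Sum>C\<in>{C \<in> atoms \<B>. C \<subseteq> B}. (\<lambda>C\<in>atoms \<B>. emeasure \<nu> C) C)" if "\<nu> \<in> space P" "B \<in> \<B>" for \<nu> B
  proof -
    have "emeasure \<nu> B = (\<Sum>C\<in>{C \<in> atoms \<B>. C \<subseteq> B}. emeasure \<nu> C)"
      using assms that sets_config by (intro emeasure_eq_sum_atoms) auto
    then show ?thesis by simp
  qed
  then show ?thesis by (auto simp: cyl_def atom_region_def space_PiM)
qed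

lemma atoms_finite_mean:
  assumes "finite \<B>" "\<And>B. B \<in> \<B> \<Longrightarrow> B \<in> sets M" "\<And>B. B \<in> \<B> \<Longrightarrow> emeasure M B < \<infinity>" "C \<in> atoms \<B>"
  shows "C \<in> sets M" "emeasure M C < \<infinity>"
proof -
  show C: "C \<in> sets M" using assms sets_atoms[of \<B> M C] by auto
  obtain x where "x \<in> C" using atoms_nonempty[OF assms(4)] by auto
  then obtain B where B: "B \<in> \<B>" "x \<in> B" using atoms_subset[OF assms(4)] by auto
  then have "C \<subseteq> B" using \<open>x \<in> C\<close> assms(4) by (auto simp: atoms_def)
  then show "emeasure M C < \<infinity>"
    using emeasure_mono[of C B M] assms(2,3)[OF B(1)] by (simp add: le_less_trans)
qed

text \<open>Each cylinder is rewritten in terms of the atoms of its test sets. All atoms from all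
  regions together are pairwise disjoint, so their counts are independent, and grouping them by
  region preserves independence.\<close>

lemma cyls_indep:
  assumes G: "disjoint_family_on G J"
  shows "indep_sets (\<lambda>j. cyls (G j)) J"
proof (rule indep_setsI)
  show "cyls (G j) \<subseteq> events" for j by (rule cyls_events)
  fix X K assume K: "K \<noteq> {}" "K \<subseteq> J" "finite K" and X: "\<forall>j\<in>K. X j \<in> cyls (G j)"
  define R where "R j \<B> V \<longleftrightarrow> X j = cyl \<B> V \<and> finite \<B> \<and>
    (\<forall>B\<in>\<B>. B \<in> sets M \<and> emeasure M B < \<infinity> \<and> B \<subseteq> G j) \<and> (\<forall>B. V B \<in> sets borel)" for j \<B> V
  have "\<forall>j\<in>K. \<exists>\<B>. \<exists>V. R j \<B> V"
  proof
    fix j assume "j \<in> K"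
    then have "X j \<in> cyls (G j)" using X by blast
    then show "\<exists>\<B> V. R j \<B> V" by (rule cylsE) (unfold R_def, blast)
  qed
  from bchoice[OF this] obtain \<B> where "\<forall>j\<in>K. \<exists>V. R j (\<B> j) V" by blast
  from bchoice[OF this] obtain V where "\<forall>j\<in>K. R j (\<B> j) (V j)" by blast
  then have XV: "\<And>j. j \<in> K \<Longrightarrow> X j = cyl (\<B> j) (V j)" "\<And>j. j \<in> K \<Longrightarrow> finite (\<B> j)"
    "\<And>j B. j \<in> K \<Longrightarrow> B \<in> \<B> j \<Longrightarrow> B \<in> sets M" "\<And>j B. j \<in> K \<Longrightarrow> B \<in> \<B> j \<Longrightarrow> emeasure M B < \<infinity>"
    "\<And>j B. j \<in> K \<Longrightarrow> B \<in> \<B> j \<Longrightarrow> B \<subseteq> G j" "\<And>j B. j \<in> K \<Longrightarrow> V j B \<in> sets borel"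
    by (auto simp: R_def)
  have Gj: "C \<subseteq> G j" if "j \<in> K" "C \<in> atoms (\<B> j)" for C j
    using atoms_subset[OF that(2)] XV(5)[OF that(1)] by blast
  have GG: "G i \<inter> G j = {}" if "i \<in> K" "j \<in> K" "i \<noteq> j" for i j
    using G that K(2) by (auto simp: disjoint_family_on_def)
  define I where "I = (\<Union>j\<in>K. atoms (\<B> j))"
  have "disjoint_family_on (\<lambda>C. C) I"
    unfolding disjoint_family_on_def I_def
  proof (intro ballI impI equals0I)
    fix C C' x assume "C \<in> (\<Union>j\<in>K. atoms (\<B> j))" "C' \<in> (\<Union>j\<in>K. atoms (\<B> j))" and ne: "C \<noteq> C'" and "x \<in> C \<inter> C'"
    then obtain i j where *: "i \<in> K" "C \<in> atoms (\<B> i)" "j \<in> K" "C' \<in> atoms (\<B> j)" "x \<in> C" "x \<in> C'" by blast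
    have "i = j" using Gj GG * by blast
    then show False using * ne atoms_disjoint by blast
  qed
  then have iv: "indep_vars (\<lambda>_. borel) (\<lambda>C \<nu>. emeasure \<nu> C) I"
  proof (intro counts_indep)
    show "finite I" unfolding I_def using K(3) XV(2) finite_atoms by blast
    fix C assume "C \<in> I"
    then obtain j where j: "j \<in> K" "C \<in> atoms (\<B> j)" unfolding I_def by blast
    show "C \<in> sets M" by (rule atoms_finite_mean(1)[OF XV(2-4)[OF j(1)] j(2)])
    moreover have "emeasure M C < \<infinity>" by (rule atoms_finite_mean(2)[OF XV(2-4)[OF j(1)] j(2)])
    ultimately show "emeasure M (E \<inter> C) < \<infinity>" by (intro finite_E_Int)
  qed
  \<comment> \<open>Grouping requires disjoint index sets: an atom shared by two regions would be
    empty, and atoms are not.\<close>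
  have dis: "disjoint_family_on (\<lambda>j. atoms (\<B> j)) K"
    unfolding disjoint_family_on_def
  proof (intro ballI impI equals0I)
    fix i j C assume *: "i \<in> K" "j \<in> K" "i \<noteq> j" "C \<in> atoms (\<B> i) \<inter> atoms (\<B> j)"
    then have "C \<subseteq> G i \<inter> G j" using Gj by blast
    then show False using * GG atoms_nonempty by blast
  qed
  have "indep_vars (\<lambda>j. PiM (atoms (\<B> j)) (\<lambda>_. borel)) (\<lambda>j \<nu>. restrict (\<lambda>C. emeasure \<nu> C) (atoms (\<B> j))) K"
    by (rule indep_vars_restrict[OF iv _ dis]) (auto simp: I_def)
  from indep_varsD[OF this K(1,3) subset_refl, of "\<lambda>j. atom_region (\<B> j) (V j)"]
  have "prob (\<Inter>j\<in>K. (\<lambda>\<nu>. \<lambda>C\<in>atoms (\<B> j). emeasure \<nu> C) -` atom_region (\<B> j) (V j) \<inter> space P)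
     = (\<Prod>j\<in>K. prob ((\<lambda>\<nu>. \<lambda>C\<in>atoms (\<B> j). emeasure \<nu> C) -` atom_region (\<B> j) (V j) \<inter> space P))"
    using XV sets_atom_region by auto
  moreover have "X j = (\<lambda>\<nu>. \<lambda>C\<in>atoms (\<B> j). emeasure \<nu> C) -` atom_region (\<B> j) (V j) \<inter> space P" if "j \<in> K" for j
    unfolding XV(1)[OF that] using XV(2,3)[OF that] by (intro cyl_eq_vimage_atom_region) auto
  ultimately show "prob (\<Inter>j\<in>K. X j) = (\<Prod>j\<in>K. prob (X j))"
    by (simp cong: INF_cong prod.cong)
qed

lemma observed_indep: "disjoint_family_on G J \<Longrightarrow> indep_sets (\<lambda>j. observed (G j)) J"
  unfolding observed_def by (rule indep_sets_sigma[OF cyls_indep Int_stable_cyls])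

lemma prob_Int_observed_disjoint:
  assumes "X \<in> observed G" "Y \<in> observed H" "G \<inter> H = {}"
  shows "prob (X \<inter> Y) = prob X * prob Y"
proof -
  have "indep_sets (\<lambda>b. observed (if b then G else H)) UNIV"
    using assms(3) by (intro observed_indep) (auto simp: disjoint_family_on_def)
  from indep_setsD[OF this, of UNIV "\<lambda>b. if b then X else Y"] assms(1,2)
  show ?thesis by (simp add: UNIV_bool Int_commute)
qed

section \<open>Exhaustion by windows of finite measure\<close>

definition window :: "nat \<Rightarrow> 'a set" where "window n = (\<Union>i\<le>n. A i)"

lemma window_sets [simp]: "window n \<in> sets M" by (auto simp: window_def)

lemma window_finite: "emeasure M (window n) < \<infinity>"
proof -
  have "emeasure M (window n) \<le> (\<Sum>i\<le>n. emeasure M (A i))" unfolding window_def by (intro emeasure_subadditive_finite) auto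
  also have "\<dots> < \<infinity>" using A_finite by (simp add: less_top sum_Pinfty)
  finally show ?thesis .
qed

lemma window_mono: "m \<le> n \<Longrightarrow> window m \<subseteq> window n" unfolding window_def by (intro UN_mono) auto

text \<open>Every count is a sum of counts on the pieces \<open>B \<inter> A n\<close>, each inside
  a window; hence the identity is measurable from the generated sigma-algebra to that of
  \<open>P\<close>.\<close>

lemma events_eq_sigma_window: "events = sigma_sets (space P) (\<Union>n. observed (window n))"
proof
  show "sigma_sets (space P) (\<Union>n. observed (window n)) \<subseteq> events"
    using observed_events by (intro sets.sigma_sets_subset) auto
  let ?N = "sigma (space P) (\<Union>n. observed (window n))"
  have Pow: "(\<Union>n. observed (window n)) \<subseteq> Pow (space P)" using observed_events sets.sets_into_space by blast
  have m1: "(\<lambda>\<nu>. emeasure \<nu> B) \<in> borel_measurable ?N" if B: "B \<in> sets M" "emeasure M B < \<infinity>" "B \<subseteq> window n" for B n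
  proof (rule measurableI)
    fix V :: "ennreal set" assume V: "V \<in> sets borel"
    have "cyl {B} (\<lambda>_. V) \<in> observed (window n)" unfolding observed_def using B V by (intro sigma_sets.Basic cylsI) auto
    moreover have "(\<lambda>\<nu>. emeasure \<nu> B) -` V \<inter> space ?N = cyl {B} (\<lambda>_. V)" using Pow by (auto simp: cyl_def)
    ultimately show "(\<lambda>\<nu>. emeasure \<nu> B) -` V \<inter> space ?N \<in> sets ?N" using Pow by (auto intro: sigma_sets.Basic)
  qed auto
  have m2: "(\<lambda>\<nu>. emeasure \<nu> B) \<in> borel_measurable ?N" if B: "B \<in> sets M" for B
  proof -
    have "(\<lambda>\<nu>. \<Sum>n. emeasure \<nu> (B \<inter> A n)) \<in> borel_measurable ?N"
      using B finite_Int_A by (intro borel_measurable_suminf_order m1) (auto simp: window_def)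
    then show ?thesis
      by (rule measurable_cong[THEN iffD1, rotated]) (use Pow emeasure_eq_suminf[OF sets_config B] in auto)
  qed
  have "(\<lambda>x. x) \<in> ?N \<rightarrow>\<^sub>M P"
    by (rule measurable_into_P) (use Pow m2 space_P in auto)
  then show "events \<subseteq> sigma_sets (space P) (\<Union>n. observed (window n))"
  proof (intro subsetI)
    fix X assume X: "X \<in> events"
    from measurable_sets[OF \<open>(\<lambda>x. x) \<in> ?N \<rightarrow>\<^sub>M P\<close> X] have "X \<inter> space P \<in> sets ?N" using Pow by simp
    then show "X \<in> sigma_sets (space P) (\<Union>n. observed (window n))" using Pow sets.sets_into_space[OF X] by (simp add: Int_absorb2)
  qed
qed

lemma events_eq_observed_space: "events = observed (space M)"
proof
  have "observed (window n) \<subseteq> observed (space M)" for n by (rule observed_mono[OF sets.sets_into_space[OF window_sets]])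
  then show "events \<subseteq> observed (space M)"
    unfolding events_eq_sigma_window by (intro sigma_algebra.sigma_sets_subset[OF observed_sigma_algebra]) auto
qed (rule observed_events)

lemma approximation_observed_window:
  assumes "X \<in> events" "0 < e"
  shows "\<exists>n. \<exists>X'\<in>observed (window n). prob (sym_diff X X') < e"
  using assms observed_sigma_algebra observed_mono[OF window_mono] observed_events
  by (intro approximation_by_increasing_algebras) (auto simp: events_eq_sigma_window[symmetric])

end

section \<open>Asymptotic independence\<close>

context poisson_law
begin

lemma sets_count_in: "B \<in> sets M \<Longrightarrow> V \<in> sets borel \<Longrightarrow> {\<nu> \<in> space P. emeasure \<nu> B \<in> V} \<in> events"
  using measurable_sets[OF measurable_count] by (simp add: vimage_def Int_def conj_commute)

lemma prob_count_nonzero_le: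
  assumes "B \<in> sets M" "emeasure M (E \<inter> B) < \<infinity>"
  shows "prob {\<nu> \<in> space P. emeasure \<nu> B \<noteq> 0} \<le> mean B"
proof -
  have [measurable]: "B \<in> sets M" by fact
  have "prob {\<nu> \<in> space P. emeasure \<nu> B \<noteq> 0} = 1 - prob {\<nu> \<in> space P. emeasure \<nu> B = 0}"
    by (subst prob_neg[symmetric]) auto
  also have "prob {\<nu> \<in> space P. emeasure \<nu> B = 0} = exp (- mean B)"
    using prob_count_eq[OF assms, of 0] by simp
  also have "1 - exp (- mean B) \<le> mean B" using exp_ge_add_one_self[of "- mean B"] by linarith
  finally show ?thesis .
qed

lemma AE_count_zero:
  assumes "B \<in> sets M" "emeasure M (E \<inter> B) = 0"
  shows "AE \<nu> in P. emeasure \<nu> B = 0"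
proof -
  have [measurable]: "B \<in> sets M" by fact
  have "prob {\<nu> \<in> space P. emeasure \<nu> B \<noteq> 0} \<le> 0"
    using prob_count_nonzero_le[OF assms(1)] assms(2) by (simp add: mean_def measure_def)
  then have "prob {\<nu> \<in> space P. emeasure \<nu> B \<noteq> 0} = 0" using measure_nonneg order.antisym by blast
  then show ?thesis
    by (intro AE_I[of _ _ "{\<nu> \<in> space P. emeasure \<nu> B \<noteq> 0}"]) (auto simp: emeasure_eq_measure)
qed

text \<open>Agreement on the good configurations \<open>R\<close> passes to complements and
  countable unions because \<open>R\<close> is the same for all \<open>X\<close>. It serves for
  removing a region, with \<open>h\<close> the identity, and for shifting.\<close>

lemma observed_transfer:
  assumes X: "X \<in> observed G"
    and base: "\<And>X. X \<in> cyls G \<Longrightarrow> \<exists>X'\<in>observed H. \<forall>\<nu>\<in>space P. R \<nu> \<longrightarrow> (h \<nu> \<in> X \<longleftrightarrow> \<nu> \<in> X')"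
    and h: "\<And>\<nu>. \<nu> \<in> space P \<Longrightarrow> R \<nu> \<Longrightarrow> h \<nu> \<in> space P"
  shows "\<exists>X'\<in>observed H. \<forall>\<nu>\<in>space P. R \<nu> \<longrightarrow> (h \<nu> \<in> X \<longleftrightarrow> \<nu> \<in> X')"
  using X unfolding observed_def[of G]
proof (induction rule: sigma_sets.induct)
  case (Basic X)
  then show ?case by (rule base)
next
  case Empty
  show ?case unfolding observed_def by (intro bexI[of _ "{}"]) (auto intro: sigma_sets.Empty)
next
  case (Compl X)
  then obtain X' where "X' \<in> observed H" "\<forall>\<nu>\<in>space P. R \<nu> \<longrightarrow> (h \<nu> \<in> X \<longleftrightarrow> \<nu> \<in> X')" by blast
  then show ?case
    unfolding observed_def using h by (intro bexI[of _ "space P - X'"]) (auto intro: sigma_sets.Compl)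
next
  case (Union X)
  then have "\<forall>i. \<exists>X'. X' \<in> observed H \<and> (\<forall>\<nu>\<in>space P. R \<nu> \<longrightarrow> (h \<nu> \<in> X i \<longleftrightarrow> \<nu> \<in> X'))" by blast
  from choice[OF this] obtain X' where "\<And>i. X' i \<in> observed H"
    "\<And>i \<nu>. \<nu> \<in> space P \<Longrightarrow> R \<nu> \<Longrightarrow> (h \<nu> \<in> X i \<longleftrightarrow> \<nu> \<in> X' i)" by blast
  then show ?case
    unfolding observed_def by (intro bexI[of _ "\<Union>i. X' i"]) (auto intro: sigma_sets.Union)
qed

text \<open>When \<open>G \<inter> F\<close> carries no mass, every test set \<open>B\<close> in
  \<open>G\<close> may be replaced by \<open>B - F\<close> without changing its count.\<close>

lemma observed_remove:
  assumes X: "X \<in> observed G" and G: "G \<in> sets M" and F: "F \<in> sets M"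
  shows "\<exists>X'\<in>observed (G - F). \<forall>\<nu>\<in>space P. emeasure \<nu> (G \<inter> F) = 0 \<longrightarrow> (\<nu> \<in> X \<longleftrightarrow> \<nu> \<in> X')"
proof (rule observed_transfer[OF X, where h = "\<lambda>\<nu>. \<nu>" and R = "\<lambda>\<nu>. emeasure \<nu> (G \<inter> F) = 0"])
  fix X assume "X \<in> cyls G"
  then obtain \<B> V where X: "X = cyl \<B> V" "finite \<B>" "\<And>B. B \<in> \<B> \<Longrightarrow> B \<in> sets M" "\<And>B. B \<in> \<B> \<Longrightarrow> emeasure M B < \<infinity>"
    "\<And>B. B \<in> \<B> \<Longrightarrow> B \<subseteq> G" "\<And>B. V B \<in> sets borel" by (rule cylsE) blast
  let ?X' = "{\<nu> \<in> space P. \<forall>B\<in>\<B>. emeasure \<nu> (B - F) \<in> V B}"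
  have "?X' \<in> cyls (G - F)"
  proof (rule cyls_image)
    fix B assume B: "B \<in> \<B>"
    then show "emeasure M (B - F) < \<infinity>"
      using emeasure_mono[of "B - F" B M] X(3,4)[OF B] by (simp add: le_less_trans)
    show "B - F \<in> sets M" using X(3)[OF B] F by auto
    show "B - F \<subseteq> G - F" using X(5)[OF B] by auto
  qed (use X in auto)
  moreover have "emeasure \<nu> (B - F) = emeasure \<nu> B"
    if \<nu>: "\<nu> \<in> space P" "emeasure \<nu> (G \<inter> F) = 0" and B: "B \<in> \<B>" for \<nu> B
  proof (rule emeasure_eq_AE)
    have "G \<inter> F \<in> null_sets \<nu>" using \<nu> G F sets_config[OF \<nu>(1)] by (auto simp: null_sets_def)
    then have "AE x in \<nu>. x \<notin> G \<inter> F" by (rule AE_not_in)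
    then show "AE x in \<nu>. (x \<in> B - F) = (x \<in> B)" by (rule AE_mp) (use X(5)[OF B] in auto)
  qed (use X(3)[OF B] F sets_config[OF \<nu>(1)] in auto)
  ultimately show "\<exists>X'\<in>observed (G - F). \<forall>\<nu>\<in>space P. emeasure \<nu> (G \<inter> F) = 0 \<longrightarrow> (\<nu> \<in> X \<longleftrightarrow> \<nu> \<in> X')"
    unfolding X(1) cyl_def observed_def by (intro bexI[of _ ?X']) (auto intro: sigma_sets.Basic)
qed

text \<open>The two events can only interact through points in \<open>G \<inter> H\<close>.\<close>

lemma prob_Int_observed_le:
  assumes X: "X \<in> observed G" and Y: "Y \<in> observed H" and G: "G \<in> sets M" and H: "H \<in> sets M"
    and fin: "emeasure M (E \<inter> (G \<inter> H)) < \<infinity>"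
  shows "\<bar>prob (X \<inter> Y) - prob X * prob Y\<bar> \<le> 2 * mean (G \<inter> H)"
proof -
  \<comment> \<open>\<open>X'\<close> is \<open>X\<close> as seen away from \<open>H\<close>, hence
    independent of \<open>Y\<close>. It replaces \<open>X\<close> once in the intersection and once
    in the product, which explains the factor 2.\<close>
  obtain X' where X': "X' \<in> observed (G - H)" "\<And>\<nu>. \<nu> \<in> space P \<Longrightarrow> emeasure \<nu> (G \<inter> H) = 0 \<Longrightarrow> (\<nu> \<in> X \<longleftrightarrow> \<nu> \<in> X')"
    using observed_remove[OF X G H] by blast
  define W where "W = {\<nu> \<in> space P. emeasure \<nu> (G \<inter> H) \<noteq> 0}"
  have [measurable]: "G \<inter> H \<in> sets M" using G H by auto
  have W: "W \<in> events" unfolding W_def by measurable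
  have ev: "X \<in> events" "Y \<in> events" "X' \<in> events" using X Y X' observed_events by auto
  have sd: "sym_diff X X' \<subseteq> W"
    using X'(2) sets.sets_into_space[OF ev(1)] sets.sets_into_space[OF ev(3)] by (auto simp: W_def)
  have 1: "\<bar>prob (X \<inter> Y) - prob (X' \<inter> Y)\<bar> \<le> prob W"
    using ev W sd by (intro abs_prob_diff_le) auto
  have 2: "\<bar>prob X' - prob X\<bar> \<le> prob W"
    using abs_prob_diff_le[OF ev(1,3) W sd] by (simp add: abs_minus_commute)
  have 3: "prob (X' \<inter> Y) = prob X' * prob Y" using X'(1) Y by (rule prob_Int_observed_disjoint) auto
  have "\<bar>prob X' * prob Y - prob X * prob Y\<bar> = \<bar>prob X' - prob X\<bar> * prob Y"
    by (simp add: left_diff_distrib[symmetric] abs_mult)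
  also have "\<dots> \<le> \<bar>prob X' - prob X\<bar>" by (intro mult_left_le) auto
  finally have "\<bar>prob (X \<inter> Y) - prob X * prob Y\<bar> \<le> 2 * prob W" using 1 2 3 by linarith
  also have "prob W \<le> mean (G \<inter> H)" unfolding W_def using fin by (intro prob_count_nonzero_le) auto
  finally show ?thesis by simp
qed

text \<open>By induction on \<open>m\<close>: the intersection of the earlier events is observed in
  the union of their regions, and the mean of its overlap with the next region is at most the sum of
  the pairwise overlaps. Intersecting with \<open>space P\<close> gives the empty intersection its
  meaning for \<open>m = 0\<close>.\<close>

lemma prob_INT_observed_le:
  fixes m :: nat
  assumes X: "\<And>i. i \<in> {1..m} \<Longrightarrow> X i \<in> observed (H i)"
    and H: "\<And>i. i \<in> {1..m} \<Longrightarrow> H i \<in> sets M" "\<And>i. i \<in> {1..m} \<Longrightarrow> emeasure M (H i) < \<infinity>"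
  shows "\<bar>prob (space P \<inter> (\<Inter>i\<in>{1..m}. X i)) - (\<Prod>i\<in>{1..m}. prob (X i))\<bar>
    \<le> 2 * (\<Sum>j\<in>{1..m}. \<Sum>i\<in>{1..<j}. mean (H i \<inter> H j))"
  using assms
proof (induction m)
  case 0
  then show ?case by (simp add: prob_space)
next
  case (Suc m)
  let ?Z = "space P \<inter> (\<Inter>i\<in>{1..m}. X i)"
  let ?H = "\<Union>i\<in>{1..m}. H i"
  have split: "{1..Suc m} = insert (Suc m) {1..m}" by auto
  have Hs: "H i \<in> sets M" "emeasure M (H i) < \<infinity>" if "i \<in> {1..Suc m}" for i using Suc.prems that by auto
  have fin: "emeasure M (E \<inter> (H i \<inter> H j)) < \<infinity>" if "i \<in> {1..Suc m}" "j \<in> {1..Suc m}" for i j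
    by (rule le_less_trans[OF emeasure_mono Hs(2)[OF that(1)]]) (use Hs[OF that(1)] in auto)
  interpret S: sigma_algebra "space P" "observed ?H" by (rule observed_sigma_algebra)
  have Z: "?Z \<in> observed ?H"
  proof (cases "m = 0")
    case False
    have "X i \<in> observed ?H" if "i \<in> {1..m}" for i
    proof -
      have "H i \<subseteq> ?H" using that by blast
      then show ?thesis using Suc.prems(1)[of i] observed_mono that by auto
    qed
    then have "(\<Inter>i\<in>{1..m}. X i) \<in> observed ?H" using False by (intro S.finite_INT) auto
    then show ?thesis by auto
  next
    case True
    then have "?Z = space P" by simp
    then show ?thesis using S.top by metis
  qed
  have "space P \<inter> (\<Inter>i\<in>{1..Suc m}. X i) = ?Z \<inter> X (Suc m)" unfolding split by auto
  then have 1: "\<bar>prob (space P \<inter> (\<Inter>i\<in>{1..Suc m}. X i)) - prob ?Z * prob (X (Suc m))\<bar> \<le> 2 * mean (?H \<inter> H (Suc m))"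
  proof (simp only:, intro prob_Int_observed_le Z)
    show "X (Suc m) \<in> observed (H (Suc m))" using Suc.prems by auto
    show "H (Suc m) \<in> sets M" using Hs by auto
    show "?H \<in> sets M" using Hs by (intro sets.finite_UN) auto
    then show "emeasure M (E \<inter> (?H \<inter> H (Suc m))) < \<infinity>"
      by (intro le_less_trans[OF emeasure_mono Hs(2)[of "Suc m"]] Hs(1)) auto
  qed
  have "?H \<inter> H (Suc m) = (\<Union>i\<in>{1..m}. H i \<inter> H (Suc m))" by auto
  then have 2: "mean (?H \<inter> H (Suc m)) \<le> (\<Sum>i\<in>{1..m}. mean (H i \<inter> H (Suc m)))"
    using Hs fin by (simp only:) (intro mean_UN_le; auto)
  have "\<bar>prob ?Z * prob (X (Suc m)) - (\<Prod>i\<in>{1..m}. prob (X i)) * prob (X (Suc m))\<bar>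
      = \<bar>prob ?Z - (\<Prod>i\<in>{1..m}. prob (X i))\<bar> * prob (X (Suc m))"
    by (simp add: left_diff_distrib[symmetric] abs_mult)
  also have "\<dots> \<le> \<bar>prob ?Z - (\<Prod>i\<in>{1..m}. prob (X i))\<bar>" by (intro mult_left_le) auto
  also have "\<dots> \<le> 2 * (\<Sum>j\<in>{1..m}. \<Sum>i\<in>{1..<j}. mean (H i \<inter> H j))"
    using Suc by auto
  finally have 3: "\<bar>prob ?Z * prob (X (Suc m)) - (\<Prod>i\<in>{1..m}. prob (X i)) * prob (X (Suc m))\<bar>
      \<le> 2 * (\<Sum>j\<in>{1..m}. \<Sum>i\<in>{1..<j}. mean (H i \<inter> H j))" .
  have 4: "(\<Prod>i\<in>{1..Suc m}. prob (X i)) = (\<Prod>i\<in>{1..m}. prob (X i)) * prob (X (Suc m))" unfolding split by simp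
  have "{1..<Suc m} = {1..m}" by auto
  then have 5: "(\<Sum>j\<in>{1..Suc m}. \<Sum>i\<in>{1..<j}. mean (H i \<inter> H j))
     = (\<Sum>i\<in>{1..m}. mean (H i \<inter> H (Suc m))) + (\<Sum>j\<in>{1..m}. \<Sum>i\<in>{1..<j}. mean (H i \<inter> H j))"
    unfolding split by simp
  have tri: "\<bar>a - c\<bar> \<le> 2 * (q + r)" if "\<bar>a - b\<bar> \<le> 2 * p" "p \<le> q" "\<bar>b - c\<bar> \<le> 2 * r" for a b c p q r :: real
    using that by (smt (verit))
  show ?case unfolding 4 5 by (rule tri[OF 1 2 3])
qed

end

section \<open>The shift of configurations and its stationarity\<close>

locale poisson_suspension = mpt M T + poisson_law M A E P
  for M :: "'a measure" and T :: "'a \<Rightarrow> 'a" and A E P +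
  assumes E_invariant: "invariant E"
begin

lemma emeasure_E_pre [simp]: "B \<in> sets M \<Longrightarrow> emeasure M (E \<inter> pre n B) = emeasure M (E \<inter> B)"
  by (rule emeasure_invariant_pre[OF E_invariant])

lemma mean_pre [simp]: "B \<in> sets M \<Longrightarrow> mean (pre n B) = mean B"
  by (simp add: mean_def measure_def)

definition shift :: "int \<Rightarrow> 'a measure \<Rightarrow> 'a measure" where
  "shift n \<nu> = distr \<nu> M (zpow n)"

lemma sets_shift [simp]: "sets (shift n \<nu>) = sets M" by (simp add: shift_def)

lemma space_shift [simp]: "space (shift n \<nu>) = space M" by (simp add: shift_def)

lemma emeasure_shift: "sets \<nu> = sets M \<Longrightarrow> B \<in> sets M \<Longrightarrow> emeasure (shift n \<nu>) B = emeasure \<nu> (pre n B)"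
proof -
  assume s: "sets \<nu> = sets M" and B: "B \<in> sets M"
  have "zpow n \<in> \<nu> \<rightarrow>\<^sub>M M" using measurable_zpow measurable_cong_sets[OF s refl] by blast
  from emeasure_distr[OF this B] show ?thesis
    by (simp add: shift_def pre_def sets_eq_imp_space_eq[OF s])
qed

lemma shift_shift: "sets \<nu> = sets M \<Longrightarrow> shift m (shift n \<nu>) = shift (m + n) \<nu>"
  by (rule measure_eqI) (auto simp: emeasure_shift pre_pre add.commute)

lemma shift_0: "sets \<nu> = sets M \<Longrightarrow> shift 0 \<nu> = \<nu>"
  by (rule measure_eqI) (auto simp: emeasure_shift sets.sets_into_space)

lemma suspension_map_eq: "suspension_map M T = shift 1"
proof -
  have "zpow 1 = T" using zpow_of_nat[of 1] by simp
  then show ?thesis by (intro ext) (simp only: suspension_map_def shift_def)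
qed

lemma funpow_suspension_map: "sets \<nu> = sets M \<Longrightarrow> (suspension_map M T ^^ k) \<nu> = shift (int k) \<nu>"
  by (induction k) (auto simp: suspension_map_eq shift_0 shift_shift)

definition shifted :: "int \<Rightarrow> 'a measure set \<Rightarrow> 'a measure set" where
  "shifted n U = {\<nu> \<in> space P. shift n \<nu> \<in> U}"

text \<open>On all measures with the right sigma-algebra \<open>shift n\<close> is invertible, even
  where it leaves \<open>space P\<close>. A forward image cut down to \<open>space P\<close> is
  therefore a preimage under the opposite shift.\<close>

lemma iterate_set_suspension: "U \<subseteq> space P \<Longrightarrow> iterate_set P (suspension_map M T) n U = shifted (- n) U"
proof (cases "0 \<le> n")
  case True
  assume U: "U \<subseteq> space P"
  let ?S = "suspension_map M T ^^ nat n"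
  have "?S ` U \<inter> space P = shifted (- n) U"
  proof (intro equalityI subsetI)
    fix \<nu> assume "\<nu> \<in> ?S ` U \<inter> space P"
    then obtain \<nu>' where "\<nu>' \<in> U" "\<nu> = ?S \<nu>'" "\<nu> \<in> space P" by auto
    then show "\<nu> \<in> shifted (- n) U"
      using U sets_config[of \<nu>'] True by (auto simp: shifted_def funpow_suspension_map shift_shift shift_0)
  next
    fix \<nu> assume "\<nu> \<in> shifted (- n) U"
    then have \<nu>: "\<nu> \<in> space P" "shift (- n) \<nu> \<in> U" by (auto simp: shifted_def)
    then have "?S (shift (- n) \<nu>) = \<nu>"
      using sets_config[OF \<nu>(1)] True by (simp add: funpow_suspension_map shift_shift shift_0)
    then show "\<nu> \<in> ?S ` U \<inter> space P" using \<nu> by (metis IntI imageI)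
  qed
  then show ?thesis using True by (simp add: iterate_set_def)
next
  case False
  then show ?thesis by (auto simp: iterate_set_def shifted_def funpow_suspension_map sets_config)
qed

lemma space_P_iff: "sets \<nu> = sets M \<Longrightarrow> \<nu> \<in> space P \<longleftrightarrow> (\<forall>j. emeasure \<nu> (A j) \<in> \<nat>)"
  by (simp add: space_P configurations_def)

lemma shift_in_P_iff: "\<nu> \<in> space P \<Longrightarrow> shift n \<nu> \<in> space P \<longleftrightarrow> (\<forall>j. emeasure \<nu> (pre n (A j)) \<in> \<nat>)"
  using space_P_iff[OF sets_shift] emeasure_shift[OF sets_config A_sets] by simp

lemma null_measure_in_P: "null_measure M \<in> space P"
  by (subst space_P_iff) simp_all

text \<open>Only the countably many sets \<open>pre n (A j)\<close> have to receive natural counts,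
  and each has finite mean.\<close>

lemma AE_good: "AE \<nu> in P. shift n \<nu> \<in> space P"
proof -
  have "AE \<nu> in P. \<forall>j. emeasure \<nu> (pre n (A j)) \<in> \<nat>"
    using A_finite finite_E_Int by (intro AE_all_countable[THEN iffD2] allI AE_count_Nats) auto
  then show ?thesis
    by (rule AE_mp) (simp add: shift_in_P_iff AE_I2)
qed

lemma sets_shifted_space: "{\<nu> \<in> space P. shift n \<nu> \<in> space P} \<in> events"
proof -
  have "{\<nu> \<in> space P. shift n \<nu> \<in> space P} = {\<nu> \<in> space P. \<forall>j. emeasure \<nu> (pre n (A j)) \<in> \<nat>}"
    using shift_in_P_iff by blast
  also have "\<dots> \<in> events"
    by (intro sets.sets_Collect_countable_All sets_count_in sets_Nats_ennreal) auto
  finally show ?thesis .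
qed

text \<open>A shifted configuration may fail to be a configuration, but only on a null set.\<close>

definition safe_shift :: "int \<Rightarrow> 'a measure \<Rightarrow> 'a measure" where
  "safe_shift n \<nu> = (if shift n \<nu> \<in> space P then shift n \<nu> else null_measure M)"

lemma measurable_safe_shift: "safe_shift n \<in> P \<rightarrow>\<^sub>M P"
proof (rule measurable_into_P)
  show "safe_shift n \<nu> \<in> configurations M A" for \<nu>
    using null_measure_in_P by (simp add: safe_shift_def space_P)
  fix B assume B [measurable]: "B \<in> sets M"
  have "(\<lambda>\<nu>. if shift n \<nu> \<in> space P then emeasure \<nu> (pre n B) else 0) \<in> borel_measurable P"
    using sets_shifted_space B by (intro measurable_If measurable_count) auto
  then show "(\<lambda>\<nu>. emeasure (safe_shift n \<nu>) B) \<in> borel_measurable P"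
    by (rule measurable_cong[THEN iffD1, rotated]) (auto simp: safe_shift_def emeasure_shift sets_config)
qed

lemma sets_shifted [simp]: "U \<in> events \<Longrightarrow> shifted n U \<in> events"
proof -
  assume U: "U \<in> events"
  have "shifted n U = (safe_shift n -` U \<inter> space P) \<inter> {\<nu> \<in> space P. shift n \<nu> \<in> space P}"
    using sets.sets_into_space[OF U] by (auto simp: shifted_def safe_shift_def)
  then show ?thesis using measurable_sets[OF measurable_safe_shift U] sets_shifted_space by auto
qed

text \<open>It suffices to compare cylinders, which generate the events. On good configurations a
  shifted cylinder is the same condition on the translated atoms, and these are disjoint with the
  same means.\<close>

lemma distr_safe_shift: "distr P P (safe_shift n) = P"
proof (rule measure_eqI_generator_eq[where E = "cyls (space M)" and \<Omega> = "space P" and A = "\<lambda>_. space P"])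
  show "Int_stable (cyls (space M))" by (rule Int_stable_cyls)
  show "cyls (space M) \<subseteq> Pow (space P)" by (rule cyls_Pow)
  show "sets (distr P P (safe_shift n)) = sigma_sets (space P) (cyls (space M))"
    using events_eq_observed_space by (simp add: observed_def)
  show "events = sigma_sets (space P) (cyls (space M))"
    using events_eq_observed_space by (simp add: observed_def)
  fix X assume X0: "X \<in> cyls (space M)"
  then obtain \<B> V where X: "X = cyl \<B> V" "finite \<B>" "\<And>B. B \<in> \<B> \<Longrightarrow> B \<in> sets M" "\<And>B. B \<in> \<B> \<Longrightarrow> emeasure M B < \<infinity>"
    "\<And>B. V B \<in> sets borel" by (rule cylsE) blast
  let ?N = "\<Pi>\<^sub>M C\<in>atoms \<B>. (borel :: ennreal measure)"
  have Xe: "X \<in> events" using X0 cyls_events by blast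
  have R: "atom_region \<B> V \<in> sets ?N" using X by (intro sets_atom_region) auto
  have at: "C \<in> sets M" "emeasure M (E \<inter> C) < \<infinity>" if "C \<in> atoms \<B>" for C
    using atoms_finite_mean[OF X(2-4) that] finite_E_Int by auto
  have m1: "(\<lambda>\<nu>. \<lambda>C\<in>atoms \<B>. emeasure \<nu> C) \<in> P \<rightarrow>\<^sub>M ?N" using at by (intro measurable_restrict) auto
  have m2: "(\<lambda>\<nu>. \<lambda>C\<in>atoms \<B>. emeasure \<nu> (pre n C)) \<in> P \<rightarrow>\<^sub>M ?N" using at by (intro measurable_restrict measurable_count sets_pre)
  have eq: "distr P ?N (\<lambda>\<nu>. \<lambda>C\<in>atoms \<B>. emeasure \<nu> C) = distr P ?N (\<lambda>\<nu>. \<lambda>C\<in>atoms \<B>. emeasure \<nu> (pre n C))"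
  proof (rule distr_counts_cong)
    show "finite (atoms \<B>)" by (rule finite_atoms[OF X(2)])
    show "disjoint_family_on (\<lambda>C. C) (atoms \<B>)" "disjoint_family_on (\<lambda>C. pre n C) (atoms \<B>)"
      using atoms_disjoint[of _ \<B>] by (simp_all add: disjoint_family_on_def pre_Int[symmetric])
  qed (use at in auto)
  have "emeasure (distr P P (safe_shift n)) X = emeasure P (safe_shift n -` X \<inter> space P)"
    by (rule emeasure_distr[OF measurable_safe_shift Xe])
  also have "\<dots> = emeasure P ((\<lambda>\<nu>. \<lambda>C\<in>atoms \<B>. emeasure \<nu> (pre n C)) -` atom_region \<B> V \<inter> space P)"
  proof (rule emeasure_eq_AE)
    show "AE \<nu> in P. (\<nu> \<in> safe_shift n -` X \<inter> space P) =
      (\<nu> \<in> (\<lambda>\<nu>. \<lambda>C\<in>atoms \<B>. emeasure \<nu> (pre n C)) -` atom_region \<B> V \<inter> space P)"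
      using AE_good[of n]
    proof (rule AE_mp, intro AE_I2 impI)
      fix \<nu> assume \<nu>: "\<nu> \<in> space P" "shift n \<nu> \<in> space P"
      have "X = (\<lambda>\<nu>. \<lambda>C\<in>atoms \<B>. emeasure \<nu> C) -` atom_region \<B> V \<inter> space P"
        unfolding X(1) using X by (intro cyl_eq_vimage_atom_region) auto
      moreover have "(\<lambda>C\<in>atoms \<B>. emeasure (shift n \<nu>) C) = (\<lambda>C\<in>atoms \<B>. emeasure \<nu> (pre n C))"
        using at \<nu> by (intro restrict_ext) (auto simp: emeasure_shift sets_config)
      ultimately show "(\<nu> \<in> safe_shift n -` X \<inter> space P) =
        (\<nu> \<in> (\<lambda>\<nu>. \<lambda>C\<in>atoms \<B>. emeasure \<nu> (pre n C)) -` atom_region \<B> V \<inter> space P)"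
        using \<nu> by (simp add: safe_shift_def)
    qed
    show "safe_shift n -` X \<inter> space P \<in> events" by (rule measurable_sets[OF measurable_safe_shift Xe])
    show "(\<lambda>\<nu>. \<lambda>C\<in>atoms \<B>. emeasure \<nu> (pre n C)) -` atom_region \<B> V \<inter> space P \<in> events"
      by (rule measurable_sets[OF m2 R])
  qed
  also have "\<dots> = emeasure (distr P ?N (\<lambda>\<nu>. \<lambda>C\<in>atoms \<B>. emeasure \<nu> (pre n C))) (atom_region \<B> V)"
    by (rule emeasure_distr[OF m2 R, symmetric])
  also have "\<dots> = emeasure (distr P ?N (\<lambda>\<nu>. \<lambda>C\<in>atoms \<B>. emeasure \<nu> C)) (atom_region \<B> V)"
    unfolding eq ..
  also have "\<dots> = emeasure P ((\<lambda>\<nu>. \<lambda>C\<in>atoms \<B>. emeasure \<nu> C) -` atom_region \<B> V \<inter> space P)"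
    by (rule emeasure_distr[OF m1 R])
  also have "\<dots> = emeasure P X"
    unfolding X(1) using X by (subst cyl_eq_vimage_atom_region) auto
  finally show "emeasure (distr P P (safe_shift n)) X = emeasure P X" .
qed (use space_in_cyls emeasure_distr[OF measurable_safe_shift] in \<open>auto simp: emeasure_eq_measure\<close>)

lemma prob_shifted [simp]: "U \<in> events \<Longrightarrow> prob (shifted n U) = prob U"
proof -
  assume U: "U \<in> events"
  have "prob (shifted n U) = prob (safe_shift n -` U \<inter> space P)"
  proof (rule measure_eq_AE)
    show "AE \<nu> in P. (\<nu> \<in> shifted n U) = (\<nu> \<in> safe_shift n -` U \<inter> space P)"
      using AE_good[of n] by (rule AE_mp) (auto simp: shifted_def safe_shift_def intro!: AE_I2)
  qed (use U measurable_sets[OF measurable_safe_shift U] in auto)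
  also have "\<dots> = prob U"
    using measure_distr[OF measurable_safe_shift U, of n] distr_safe_shift[of n] by simp
  finally show ?thesis .
qed

lemma shifted_observed:
  assumes "X \<in> observed G"
  shows "\<exists>X'\<in>observed (pre n G). \<forall>\<nu>\<in>space P. shift n \<nu> \<in> space P \<longrightarrow> (shift n \<nu> \<in> X \<longleftrightarrow> \<nu> \<in> X')"
proof (rule observed_transfer[OF assms])
  fix X assume "X \<in> cyls G"
  then obtain \<B> V where X: "X = cyl \<B> V" "finite \<B>" "\<And>B. B \<in> \<B> \<Longrightarrow> B \<in> sets M" "\<And>B. B \<in> \<B> \<Longrightarrow> emeasure M B < \<infinity>"
    "\<And>B. B \<in> \<B> \<Longrightarrow> B \<subseteq> G" "\<And>B. V B \<in> sets borel" by (rule cylsE) blast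
  let ?X' = "{\<nu> \<in> space P. \<forall>B\<in>\<B>. emeasure \<nu> (pre n B) \<in> V B}"
  have "?X' \<in> cyls (pre n G)"
    using X by (intro cyls_image pre_mono) auto
  moreover have "shift n \<nu> \<in> X \<longleftrightarrow> \<nu> \<in> ?X'" if "\<nu> \<in> space P" "shift n \<nu> \<in> space P" for \<nu>
    using that X by (auto simp: cyl_def emeasure_shift sets_config)
  ultimately show "\<exists>X'\<in>observed (pre n G). \<forall>\<nu>\<in>space P. shift n \<nu> \<in> space P \<longrightarrow> (shift n \<nu> \<in> X \<longleftrightarrow> \<nu> \<in> X')"
    unfolding observed_def by (intro bexI[of _ ?X']) (auto intro: sigma_sets.Basic)
qed

section \<open>Decorrelation of shifted events\<close>

lemma prob_INT_shifted_observed_le: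
  fixes m :: nat
  assumes X: "\<And>i. i \<in> {1..m} \<Longrightarrow> X i \<in> observed G" and G: "G \<in> sets M" "emeasure M G < \<infinity>"
  shows "\<bar>prob (space P \<inter> (\<Inter>i\<in>{1..m}. shifted (s i) (X i))) - (\<Prod>i\<in>{1..m}. prob (X i))\<bar>
    \<le> 2 * (\<Sum>j\<in>{1..m}. \<Sum>i\<in>{1..<j}. mean (pre (s i) G \<inter> pre (s j) G))"
proof -
  have "\<forall>i\<in>{1..m}. \<exists>X'. X' \<in> observed (pre (s i) G) \<and>
      (\<forall>\<nu>\<in>space P. shift (s i) \<nu> \<in> space P \<longrightarrow> (shift (s i) \<nu> \<in> X i \<longleftrightarrow> \<nu> \<in> X'))"
    using shifted_observed[OF X] by blast
  from bchoice[OF this] obtain X' where X': "\<And>i. i \<in> {1..m} \<Longrightarrow> X' i \<in> observed (pre (s i) G)"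
    "\<And>i \<nu>. i \<in> {1..m} \<Longrightarrow> \<nu> \<in> space P \<Longrightarrow> shift (s i) \<nu> \<in> space P \<Longrightarrow> (shift (s i) \<nu> \<in> X i \<longleftrightarrow> \<nu> \<in> X' i)"
    by blast
  have ev: "X i \<in> events" "X' i \<in> events" if "i \<in> {1..m}" for i using X[OF that] X'(1)[OF that] observed_events by auto
  have fI: "space P \<inter> (\<Inter>i\<in>{1..m}. Z i) \<in> events" if "\<And>i. i \<in> {1..m} \<Longrightarrow> Z i \<in> events" for Z :: "nat \<Rightarrow> 'a measure set"
    using that by (cases "m = 0") (auto intro!: sets.Int sets.finite_INT)
  have AEi: "AE \<nu> in P. \<forall>i\<in>{1..m}. shift (s i) \<nu> \<in> space P"
    by (rule AE_finite_allI) (auto intro: AE_good)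
  have 1: "prob (space P \<inter> (\<Inter>i\<in>{1..m}. shifted (s i) (X i))) = prob (space P \<inter> (\<Inter>i\<in>{1..m}. X' i))"
  proof (rule measure_eq_AE)
    show "AE \<nu> in P. (\<nu> \<in> space P \<inter> (\<Inter>i\<in>{1..m}. shifted (s i) (X i))) = (\<nu> \<in> space P \<inter> (\<Inter>i\<in>{1..m}. X' i))"
      using AEi by (rule AE_mp) (use X'(2) in \<open>auto simp: shifted_def intro!: AE_I2\<close>)
  qed (intro fI sets_shifted ev; assumption)+
  have 2: "prob (X i) = prob (X' i)" if i: "i \<in> {1..m}" for i
  proof -
    have "prob (shifted (s i) (X i)) = prob (X' i)"
    proof (rule measure_eq_AE)
      show "AE \<nu> in P. (\<nu> \<in> shifted (s i) (X i)) = (\<nu> \<in> X' i)"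
        using AE_good[of "s i"] by (rule AE_mp) (use X'(2)[OF i] in \<open>auto simp: shifted_def intro!: AE_I2\<close>)
    qed (use ev[OF i] in auto)
    then show ?thesis using ev[OF i] by simp
  qed
  have "\<bar>prob (space P \<inter> (\<Inter>i\<in>{1..m}. X' i)) - (\<Prod>i\<in>{1..m}. prob (X' i))\<bar>
    \<le> 2 * (\<Sum>j\<in>{1..m}. \<Sum>i\<in>{1..<j}. mean (pre (s i) G \<inter> pre (s j) G))"
    using X'(1) G by (intro prob_INT_observed_le) auto
  then show ?thesis unfolding 1 using 2 by simp
qed

text \<open>The region \<open>G\<close> is a window in which approximations of all the
  \<open>U i\<close> are observed. It does not depend on \<open>s\<close>, because a shifted event
  is approximated by the shifted approximant with the same error.\<close>

lemma asymptotic_independence: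
  fixes m :: nat
  assumes U: "\<And>i. i \<in> {1..m} \<Longrightarrow> U i \<in> events" and e: "0 < e"
  shows "\<exists>G. G \<in> sets M \<and> emeasure M G < \<infinity> \<and>
    (\<forall>s. \<bar>prob (space P \<inter> (\<Inter>i\<in>{1..m}. shifted (s i) (U i))) - (\<Prod>i\<in>{1..m}. prob (U i))\<bar>
      \<le> e + 2 * (\<Sum>j\<in>{1..m}. \<Sum>i\<in>{1..<j}. mean (pre (s i) G \<inter> pre (s j) G)))"
proof -
  \<comment> \<open>The approximation error \<open>real m * d\<close> occurs twice, for the
    intersection and for the product; the added 1 covers \<open>m = 0\<close>.\<close>
  define d where "d = e / (2 * real m + 1)"
  have d: "0 < d" "2 * (real m * d) \<le> e"
    using e by (auto simp: d_def field_simps)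
  have "\<forall>i\<in>{1..m}. \<exists>p. snd p \<in> observed (window (fst p)) \<and> prob (sym_diff (U i) (snd p)) < d"
    using approximation_observed_window[OF U d(1)] by fastforce
  from bchoice[OF this] obtain p where p: "\<And>i. i \<in> {1..m} \<Longrightarrow> snd (p i) \<in> observed (window (fst (p i)))"
    "\<And>i. i \<in> {1..m} \<Longrightarrow> prob (sym_diff (U i) (snd (p i))) < d" by blast
  define N where "N = (\<Sum>i\<in>{1..m}. fst (p i))"
  define X where "X i = snd (p i)" for i
  have X: "X i \<in> observed (window N)" if "i \<in> {1..m}" for i
  proof -
    have "fst (p i) \<le> N" unfolding N_def using that by (intro member_le_sum) auto
    then show ?thesis using p(1)[OF that] observed_mono[OF window_mono] by (auto simp: X_def)
  qed
  then have Xe: "X i \<in> events" if "i \<in> {1..m}" for i using that observed_events by auto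
  have Xd: "prob (sym_diff (U i) (X i)) \<le> d" if "i \<in> {1..m}" for i using p(2)[OF that] by (simp add: X_def)
  have "\<bar>prob (space P \<inter> (\<Inter>i\<in>{1..m}. shifted (s i) (U i))) - (\<Prod>i\<in>{1..m}. prob (U i))\<bar>
      \<le> e + 2 * (\<Sum>j\<in>{1..m}. \<Sum>i\<in>{1..<j}. mean (pre (s i) (window N) \<inter> pre (s j) (window N)))" for s
  proof -
    let ?W = "\<Union>i\<in>{1..m}. shifted (s i) (sym_diff (U i) (X i))"
    have We: "sym_diff (U i) (X i) \<in> events" if "i \<in> {1..m}" for i using U[OF that] Xe[OF that] by auto
    have fI: "space P \<inter> (\<Inter>i\<in>{1..m}. Z i) \<in> events" if "\<And>i. i \<in> {1..m} \<Longrightarrow> Z i \<in> events" for Z :: "nat \<Rightarrow> 'a measure set"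
      using that by (cases "m = 0") (auto intro!: sets.Int sets.finite_INT)
    have "\<bar>prob (space P \<inter> (\<Inter>i\<in>{1..m}. shifted (s i) (U i))) - prob (space P \<inter> (\<Inter>i\<in>{1..m}. shifted (s i) (X i)))\<bar> \<le> prob ?W"
    proof (rule abs_prob_diff_le)
      show "?W \<in> events" using We by (intro sets.finite_UN) auto
      show "space P \<inter> (\<Inter>i\<in>{1..m}. shifted (s i) (U i)) \<in> events" by (intro fI sets_shifted U)
      show "space P \<inter> (\<Inter>i\<in>{1..m}. shifted (s i) (X i)) \<in> events" by (intro fI sets_shifted Xe)
    qed (auto simp: shifted_def)
    also have "\<dots> \<le> (\<Sum>i\<in>{1..m}. prob (shifted (s i) (sym_diff (U i) (X i))))"
      using We by (intro finite_measure_subadditive_finite) auto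
    also have "\<dots> \<le> (\<Sum>i\<in>{1..m}. d)" using We Xd by (intro sum_mono) auto
    finally have 1: "\<bar>prob (space P \<inter> (\<Inter>i\<in>{1..m}. shifted (s i) (U i))) - prob (space P \<inter> (\<Inter>i\<in>{1..m}. shifted (s i) (X i)))\<bar> \<le> real m * d"
      by simp
    have 2: "\<bar>prob (space P \<inter> (\<Inter>i\<in>{1..m}. shifted (s i) (X i))) - (\<Prod>i\<in>{1..m}. prob (X i))\<bar>
      \<le> 2 * (\<Sum>j\<in>{1..m}. \<Sum>i\<in>{1..<j}. mean (pre (s i) (window N) \<inter> pre (s j) (window N)))"
      using X window_finite by (intro prob_INT_shifted_observed_le) auto
    have "norm ((\<Prod>i\<in>{1..m}. prob (X i)) - (\<Prod>i\<in>{1..m}. prob (U i))) \<le> (\<Sum>i\<in>{1..m}. norm (prob (X i) - prob (U i)))"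
      by (rule norm_prod_diff) auto
    also have "\<dots> \<le> (\<Sum>i\<in>{1..m}. d)"
    proof (rule sum_mono)
      fix i assume i: "i \<in> {1..m}"
      have "\<bar>prob (U i) - prob (X i)\<bar> \<le> prob (sym_diff (U i) (X i))"
        by (rule abs_prob_diff_le) (use U Xe We i in auto)
      then show "norm (prob (X i) - prob (U i)) \<le> d" using Xd[OF i] by (simp add: abs_minus_commute)
    qed
    finally have 3: "\<bar>(\<Prod>i\<in>{1..m}. prob (X i)) - (\<Prod>i\<in>{1..m}. prob (U i))\<bar> \<le> real m * d" by simp
    show ?thesis using 1 2 3 d(2) by (smt (verit))
  qed
  then show ?thesis using window_finite[of N] by (intro exI[of _ "window N"]) simp
qed

end

section \<open>Ergodic properties of Poisson suspensions\<close>

context poisson_suspension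
begin

lemma mean_pre_Int_pre:
  assumes "B \<in> sets M"
  shows "mean (pre m B \<inter> pre n B) = mean (B \<inter> pre (n - m) B)"
proof -
  have "pre m B \<inter> pre n B = pre m (B \<inter> pre (n - m) B)" by (simp add: pre_Int pre_pre)
  then show ?thesis using assms mean_pre[of "B \<inter> pre (n - m) B" m] by (simp add: sets.Int)
qed

text \<open>The absence of points in \<open>F\<close> is an invariant event of probability \<open>exp (- \<mu> F)\<close>.\<close>

lemma not_ergodic_if_finite_invariant:
  assumes F: "invariant F" and pos: "emeasure M (E \<inter> F) \<noteq> 0" and fin: "emeasure M (E \<inter> F) < \<infinity>"
  shows "\<not> ergodic P (suspension_map M T)"
proof
  assume erg: "ergodic P (suspension_map M T)"
  have Fs: "F \<in> sets M" using F by (rule invariantD)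
  define U where "U = {\<nu> \<in> space P. emeasure \<nu> F = 0}"
  have U: "U \<in> events" using sets_count_in[OF Fs, of "{0}"] by (simp add: U_def)
  have null: "sym_diff (pre 1 F) F \<in> null_sets M" using F by (rule invariantD)
  then have "emeasure M (E \<inter> sym_diff (pre 1 F) F) = 0"
    by (intro emeasure_eq_0[OF null_setsD2 null_setsD1]) blast+
  \<comment> \<open>A configuration may charge a null set of \<open>M\<close>. Almost surely it does
    not charge the discrepancy between \<open>F\<close> and its preimage, so both carry the same
    count.\<close>
  then have AE0: "AE \<nu> in P. emeasure \<nu> (sym_diff (pre 1 F) F) = 0"
    using null by (intro AE_count_zero) auto
  have "sym_diff (shifted 1 U) U \<in> null_sets P"
  proof -
    have "AE \<nu> in P. \<nu> \<notin> sym_diff (shifted 1 U) U"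
      using AE0 AE_good[of 1]
    proof (eventually_elim)
      fix \<nu> assume z: "emeasure \<nu> (sym_diff (pre 1 F) F) = 0" and s: "shift 1 \<nu> \<in> space P"
      show "\<nu> \<notin> sym_diff (shifted 1 U) U"
      proof (cases "\<nu> \<in> space P")
        case True
        have nu: "sets \<nu> = sets M" by (rule sets_config[OF True])
        have "AE x in \<nu>. x \<notin> sym_diff (pre 1 F) F"
        proof (intro AE_not_in null_setsI z)
          show "sym_diff (pre 1 F) F \<in> sets \<nu>" unfolding nu by (intro sets_sym_diff sets_pre Fs)
        qed
        then have "emeasure \<nu> (pre 1 F) = emeasure \<nu> F"
          using nu Fs by (intro emeasure_eq_AE) auto
        then have "emeasure (shift 1 \<nu>) F = emeasure \<nu> F" using emeasure_shift[OF nu Fs] by simp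
        then have "\<nu> \<in> shifted 1 U \<longleftrightarrow> \<nu> \<in> U" using True s unfolding shifted_def U_def by simp
        then show ?thesis by blast
      qed (auto simp: shifted_def U_def)
    qed
    then show ?thesis using U by (intro AE_iff_null_sets[THEN iffD2] sets_sym_diff sets_shifted)
  qed
  then have "invariant_set P (suspension_map M T) U"
    unfolding invariant_set_def using U sets.sets_into_space[OF U] by (simp add: iterate_set_suspension)
  then have "prob U = 0 \<or> prob U = 1" using erg by (simp add: ergodic_def)
  moreover have "prob U = exp (- mean F)" using prob_count_eq[OF Fs fin, of 0] by (simp add: U_def)
  moreover have "mean F \<noteq> 0" using pos fin by (simp add: mean_def measure_def enn2real_eq_0_iff)
  ultimately show False by simp
qed

text \<open>The Radon-Nikodym derivative \<open>f\<close> of the invariant probability is itself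
  invariant, by uniqueness of densities for a sigma-finite measure. Its superlevel sets are
  therefore invariant, and integrability of \<open>f\<close> bounds their measure.\<close>

lemma not_ergodic_if_invariant_prob:
  assumes \<nu>: "invariant_prob M T \<nu>" and eq: "equivalent_measures \<nu> (measure_on M E)"
  shows "\<not> ergodic P (suspension_map M T)"
proof -
  interpret \<nu>: prob_space \<nu> using \<nu> by (simp add: invariant_prob_def)
  have s [simp]: "sets \<nu> = sets M" and inv: "distr \<nu> M T = \<nu>" using \<nu> by (simp_all add: invariant_prob_def)
  have sp [simp]: "space \<nu> = space M" by (rule sets_eq_imp_space_eq[OF s])
  have nE: "B \<in> null_sets \<nu> \<longleftrightarrow> B \<in> sets M \<and> emeasure M (E \<inter> B) = 0" for B
  proof -
    have "null_sets \<nu> = null_sets (measure_on M E)"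
      using eq unfolding equivalent_measures_def absolutely_continuous_def by blast
    then have "B \<in> null_sets \<nu> \<longleftrightarrow> B \<in> null_sets (measure_on M E)" by simp
    also have "\<dots> \<longleftrightarrow> B \<in> sets M \<and> emeasure M (E \<inter> B) = 0"
      unfolding null_sets_def using emeasure_measure_on[OF E, of B] by auto
    finally show ?thesis .
  qed
  have ac: "absolutely_continuous M \<nu>"
    unfolding absolutely_continuous_def
  proof
    fix B assume "B \<in> null_sets M"
    then have "B \<in> sets M" "emeasure M (E \<inter> B) = 0"
      using emeasure_eq_0[of B M "E \<inter> B"] by auto
    then show "B \<in> null_sets \<nu>" by (simp add: nE)
  qed
  have sf: "sigma_finite_measure M" by (rule mpt.axioms(1)[OF mpt_axioms])
  define f where "f = RN_deriv M \<nu>"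
  have f [measurable]: "f \<in> borel_measurable M" and df: "density M f = \<nu>"
    unfolding f_def using sigma_finite_measure.density_RN_deriv[OF sf ac s] by simp_all
  have f': "(\<lambda>x. f (zpow (- 1) x)) \<in> borel_measurable M" by measurable
  \<comment> \<open>Both \<open>M\<close> and \<open>\<nu>\<close> are invariant, so translating a
    density of \<open>\<nu>\<close> gives a density of \<open>\<nu>\<close> again.\<close>
  have "density M (\<lambda>x. f (zpow (- 1) x)) = density M f"
  proof (rule measure_eqI)
    fix B assume "B \<in> sets (density M (\<lambda>x. f (zpow (- 1) x)))"
    then have B [measurable]: "B \<in> sets M" by simp
    have "emeasure (density M (\<lambda>x. f (zpow (- 1) x))) B = (\<integral>\<^sup>+x. f (zpow (- 1) x) * indicator B x \<partial>M)"
      by (rule emeasure_density[OF f' B])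
    also have "\<dots> = (\<integral>\<^sup>+x. f (zpow (- 1) x) * indicator B x \<partial>distr M M (zpow 1))"
      by (simp add: distr_zpow)
    also have "\<dots> = (\<integral>\<^sup>+x. f (zpow (- 1) (zpow 1 x)) * indicator B (zpow 1 x) \<partial>M)"
      by (rule nn_integral_distr) measurable
    also have "\<dots> = (\<integral>\<^sup>+x. f x * indicator (pre 1 B) x \<partial>M)"
      by (rule nn_integral_cong) (auto simp: pre_def indicator_def zpow_cancel(2)[of _ 1])
    also have "\<dots> = emeasure \<nu> (pre 1 B)"
      using B by (subst emeasure_density[symmetric]) (auto simp: df)
    also have "\<dots> = emeasure (distr \<nu> M T) B"
    proof -
      have "T \<in> \<nu> \<rightarrow>\<^sub>M M" using T_measurable measurable_cong_sets[OF s refl] by blast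
      moreover have "pre 1 B = T -` B \<inter> space \<nu>" using zpow_of_nat[of 1] by (simp add: pre_def)
      ultimately show ?thesis by (simp add: emeasure_distr)
    qed
    finally show "emeasure (density M (\<lambda>x. f (zpow (- 1) x))) B = emeasure (density M f) B"
      by (simp add: inv df)
  qed simp
  then have fAE: "AE x in M. f (zpow (- 1) x) = f x"
    using sigma_finite_measure.density_unique_iff[OF sf f' f] by simp
  \<comment> \<open>Here equivalence is used in the other direction: the zero set of
    \<open>f\<close> is null for \<open>\<nu>\<close>, hence its part in \<open>E\<close> is null
    for \<open>M\<close>. Some superlevel set thus meets \<open>E\<close> in positive
    measure.\<close>
  have fpos: "AE x in M. x \<in> E \<longrightarrow> f x \<noteq> 0"
  proof -
    define Z where "Z = {x \<in> space M. f x = 0}"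
    have Z: "Z \<in> sets M" unfolding Z_def by measurable
    have "emeasure \<nu> Z = (\<integral>\<^sup>+x. f x * indicator Z x \<partial>M)" using Z f by (simp add: emeasure_density flip: df)
    also have "\<dots> = (\<integral>\<^sup>+x. 0 \<partial>M)" by (rule nn_integral_cong) (auto simp: Z_def indicator_def)
    finally have "emeasure M (E \<inter> Z) = 0" using Z nE[of Z] by (auto simp: null_sets_def)
    then have "AE x in M. x \<notin> E \<inter> Z" using E Z by (intro AE_not_in) (auto simp: null_sets_def)
    then show ?thesis by (rule AE_mp) (auto simp: Z_def intro!: AE_I2)
  qed
  define F where "F n = {x \<in> space M. ennreal (1 / real (Suc n)) \<le> f x}" for n
  have Fs [measurable]: "F n \<in> sets M" for n unfolding F_def by measurable
  have Finv: "invariant (F n)" for n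
  proof -
    have "AE x in M. x \<notin> sym_diff (pre (- 1) (F n)) (F n)"
      using fAE by (rule AE_mp) (auto simp: F_def pre_def intro!: AE_I2)
    then have "sym_diff (pre (- 1) (F n)) (F n) \<in> null_sets M"
      using Fs by (intro AE_iff_null_sets[THEN iffD2] sets_sym_diff sets_pre)
    from null_sets_pre[OF this, of 1] have "sym_diff (pre 1 (F n)) (F n) \<in> null_sets M"
      using pre_0[OF sets.sets_into_space[OF Fs], of n] by (simp add: pre_Un pre_Diff pre_pre Un_commute)
    then show ?thesis by (intro invariantI Fs)
  qed
  \<comment> \<open>Markov's inequality for \<open>f\<close>.\<close>
  have Ffin: "emeasure M (F n) < \<infinity>" for n
  proof -
    have "ennreal (1 / real (Suc n)) * emeasure M (F n) = (\<integral>\<^sup>+x. ennreal (1 / real (Suc n)) * indicator (F n) x \<partial>M)"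
      by (simp add: nn_integral_cmult_indicator)
    also have "\<dots> \<le> (\<integral>\<^sup>+x. f x * indicator (F n) x \<partial>M)"
      by (rule nn_integral_mono) (auto simp: F_def indicator_def)
    also have "\<dots> = emeasure \<nu> (F n)" using f by (simp add: emeasure_density flip: df)
    also have "\<dots> < \<infinity>" by (simp add: \<nu>.emeasure_eq_measure)
    finally have "ennreal (1 / real (Suc n)) * emeasure M (F n) < \<infinity>" .
    then show ?thesis by (auto simp: ennreal_mult_less_top less_top)
  qed
  have "\<exists>n. emeasure M (E \<inter> F n) \<noteq> 0"
  proof (rule ccontr)
    assume "\<not> ?thesis"
    then have "E \<inter> F n \<in> null_sets M" for n using E by (auto simp: null_sets_def)
    then have "AE x in M. \<forall>n. x \<notin> E \<inter> F n" by (intro AE_all_countable[THEN iffD2] allI AE_not_in)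
    then have "AE x in M. x \<notin> E"
      using fpos
    proof (eventually_elim)
      fix x assume *: "\<forall>n. x \<notin> E \<inter> F n" "x \<in> E \<longrightarrow> f x \<noteq> 0"
      show "x \<notin> E"
      proof
        assume x: "x \<in> E"
        then have "0 < f x" using * by (simp add: zero_less_iff_neq_zero)
        then obtain q where q: "0 < q" "q < f x" using dense by blast
        then have "q < \<infinity>" by (auto simp: less_top[symmetric] intro: less_le_trans)
        then obtain r where r: "q = ennreal r" "0 < r" using q by (cases q) auto
        obtain n where "1 / real (Suc n) < r" using r(2) nat_approx_posE by blast
        then have "ennreal (1 / real (Suc n)) \<le> f x" using q r by (meson ennreal_leI less_imp_le order_trans)
        then show False using * x sets.sets_into_space[OF E] by (auto simp: F_def)
      qed
    qed
    then have "E \<in> null_sets M" using E by (intro AE_iff_null_sets[THEN iffD2])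
    then have "space M \<in> null_sets \<nu>" by (subst nE) (auto simp: sets.Int_space_eq2[OF E])
    then show False using \<nu>.emeasure_space_1 by (simp add: null_sets_def)
  qed
  then obtain n where "emeasure M (E \<inter> F n) \<noteq> 0" by blast
  moreover have "emeasure M (E \<inter> F n) < \<infinity>" by (rule finite_E_Int[OF Ffin Fs])
  ultimately show ?thesis by (rule not_ergodic_if_finite_invariant[OF Finv])
qed

text \<open>The case of two events of \<open>asymptotic_independence\<close>, at times 0 and
  \<open>k\<close>.\<close>

lemma correlation_bound:
  assumes "U \<in> events" "V \<in> events" "0 < e"
  shows "\<exists>G. G \<in> sets M \<and> emeasure M G < \<infinity> \<and>
    (\<forall>k. \<bar>prob (U \<inter> shifted k V) - prob U * prob V\<bar> \<le> e + 2 * mean (G \<inter> pre k G))"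
proof -
  define W where "W i = (if i = 1 then U else V)" for i :: nat
  have "\<And>i. i \<in> {1..2} \<Longrightarrow> W i \<in> events" using assms by (auto simp: W_def)
  then have "\<exists>G. G \<in> sets M \<and> emeasure M G < \<infinity> \<and>
    (\<forall>s. \<bar>prob (space P \<inter> (\<Inter>i\<in>{1..2}. shifted (s i) (W i))) - (\<Prod>i\<in>{1..2}. prob (W i))\<bar>
      \<le> e + 2 * (\<Sum>j\<in>{1..2}. \<Sum>i\<in>{1..<j}. mean (pre (s i) G \<inter> pre (s j) G)))"
    by (rule asymptotic_independence[OF _ assms(3)])
  then obtain G where G: "G \<in> sets M" "emeasure M G < \<infinity>"
    and *: "\<forall>s. \<bar>prob (space P \<inter> (\<Inter>i\<in>{1..2}. shifted (s i) (W i))) - (\<Prod>i\<in>{1..2}. prob (W i))\<bar>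
      \<le> e + 2 * (\<Sum>j\<in>{1..2}. \<Sum>i\<in>{1..<j}. mean (pre (s i) G \<inter> pre (s j) G))"
    by (elim exE conjE)
  have "\<bar>prob (U \<inter> shifted k V) - prob U * prob V\<bar> \<le> e + 2 * mean (G \<inter> pre k G)" for k
  proof -
    define s where "s i = (if i = 1 then 0 else k)" for i :: nat
    have 12: "{1..2::nat} = {1, 2}" "{1..<2::nat} = {1}" by auto
    have "shifted 0 U = U"
      using sets.sets_into_space[OF assms(1)] by (auto simp: shifted_def shift_0[OF sets_config])
    then have "space P \<inter> (\<Inter>i\<in>{1..2}. shifted (s i) (W i)) = U \<inter> shifted k V"
      using sets.sets_into_space[OF assms(1)] unfolding 12 by (auto simp: s_def W_def)
    moreover have "(\<Prod>i\<in>{1..2}. prob (W i)) = prob U * prob V" unfolding 12 by (simp add: W_def)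
    moreover have "(\<Sum>j\<in>{1..2}. \<Sum>i\<in>{1..<j}. mean (pre (s i) G \<inter> pre (s j) G)) = mean (G \<inter> pre k G)"
      using pre_0[OF sets.sets_into_space[OF G(1)]] unfolding 12 by (simp add: 12 s_def)
    ultimately show ?thesis using *[rule_format, of s] by (simp only:)
  qed
  then show ?thesis using G by blast
qed

lemma weakly_mixing_if_cesaro:
  assumes ces: "\<And>G. G \<in> sets M \<Longrightarrow> emeasure M G < \<infinity> \<Longrightarrow>
      (\<lambda>n. (\<Sum>k<n. mean (G \<inter> pre (int k) G)) / real n) \<longlonglongrightarrow> 0"
  shows "weakly_mixing P (suspension_map M T)"
  unfolding weakly_mixing_def
proof (intro ballI)
  fix U V assume U: "U \<in> events" and V: "V \<in> events"
  have it: "iterate_set P (suspension_map M T) (- int k) V = shifted (int k) V" for k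
    using sets.sets_into_space[OF V] by (simp add: iterate_set_suspension)
  define c where "c k = \<bar>prob (U \<inter> shifted (int k) V) - prob U * prob V\<bar>" for k
  have "(\<lambda>n. (\<Sum>k=1..n. c k) / real n) \<longlonglongrightarrow> 0"
  proof (rule LIMSEQ_I)
    fix r :: real assume r: "0 < r"
    obtain G where G: "G \<in> sets M" "emeasure M G < \<infinity>"
      "\<And>k. \<bar>prob (U \<inter> shifted k V) - prob U * prob V\<bar> \<le> r / 2 + 2 * mean (G \<inter> pre k G)"
      using correlation_bound[OF U V, of "r / 2"] r by auto
    have bd: "mean (G \<inter> pre k G) \<le> mean G" for k
      using G finite_E_Int[OF G(2,1)] by (intro mean_mono) auto
    define S where "S n = (\<Sum>k<n. mean (G \<inter> pre (int k) G))" for n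
    \<comment> \<open>Weak mixing averages over \<open>1..n\<close>, the hypothesis over
      \<open>k < n\<close>; the extra term is at most \<open>mean G\<close> and vanishes after
      division by \<open>n\<close>.\<close>
    have "(\<lambda>n. 2 * (S n / real n) + 2 * mean G * inverse (real n)) \<longlonglongrightarrow> 2 * 0 + 2 * mean G * 0"
      unfolding S_def by (intro tendsto_intros ces G lim_inverse_n)
    then have "\<forall>\<^sub>F n in sequentially. 2 * (S n / real n) + 2 * mean G * inverse (real n) < r / 2"
      using r by (intro order_tendstoD(2)) auto
    then obtain N where N: "\<And>n. n \<ge> N \<Longrightarrow> 2 * (S n / real n) + 2 * mean G * inverse (real n) < r / 2"
      by (auto simp: eventually_sequentially)
    show "\<exists>N. \<forall>n\<ge>N. norm ((\<Sum>k=1..n. c k) / real n - 0) < r"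
    proof (intro exI[of _ "max N 1"] allI impI)
      fix n assume n: "max N 1 \<le> n"
      have "(\<Sum>k=1..n. c k) \<le> (\<Sum>k=1..n. r / 2 + 2 * mean (G \<inter> pre (int k) G))"
        using G(3) by (intro sum_mono) (simp add: c_def)
      also have "\<dots> = real n * (r / 2) + 2 * (\<Sum>k=1..n. mean (G \<inter> pre (int k) G))"
        by (simp add: sum.distrib sum_distrib_left)
      also have "(\<Sum>k=1..n. mean (G \<inter> pre (int k) G)) \<le> (\<Sum>k<Suc n. mean (G \<inter> pre (int k) G))"
        by (intro sum_mono2) auto
      also have "\<dots> = S n + mean (G \<inter> pre (int n) G)" by (simp add: S_def)
      also have "\<dots> \<le> S n + mean G" using bd by simp
      finally have "(\<Sum>k=1..n. c k) \<le> real n * (r / 2) + 2 * (S n + mean G)" by simp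
      then have "(\<Sum>k=1..n. c k) / real n \<le> (real n * (r / 2) + 2 * (S n + mean G)) / real n"
        by (rule divide_right_mono) simp
      also have "\<dots> = r / 2 + (2 * (S n / real n) + 2 * mean G * inverse (real n))"
        using n by (simp add: field_simps)
      also have "\<dots> < r" using N[of n] n by simp
      finally have "(\<Sum>k=1..n. c k) / real n < r" .
      moreover have "0 \<le> (\<Sum>k=1..n. c k) / real n" by (intro divide_nonneg_nonneg sum_nonneg) (auto simp: c_def)
      ultimately show "norm ((\<Sum>k=1..n. c k) / real n - 0) < r" by simp
    qed
  qed
  then show "(\<lambda>n. (\<Sum>k=1..n. \<bar>prob (U \<inter> iterate_set P (suspension_map M T) (- int k) V) - prob U * prob V\<bar>) / real n) \<longlonglongrightarrow> 0"
    by (simp add: it c_def)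
qed

text \<open>The probability that both \<open>B\<close> and \<open>pre k B\<close> are empty is
  \<open>exp (mean (B \<inter> pre k B) - 2 * mean B)\<close>, while independence would give
  \<open>exp (- 2 * mean B)\<close>. Taking logarithms, mixing would force the overlaps to
  0.\<close>

lemma not_mixing_if_recurrent:
  assumes B: "B \<in> sets M" "emeasure M B < \<infinity>" and rec: "\<not> (\<lambda>k. mean (B \<inter> pre (int k) B)) \<longlonglongrightarrow> 0"
  shows "\<not> mixing P (suspension_map M T)"
proof
  assume mix: "mixing P (suspension_map M T)"
  define U where "U = {\<nu> \<in> space P. emeasure \<nu> B = 0}"
  have U: "U \<in> events" using sets_count_in[OF B(1), of "{0}"] by (simp add: U_def)
  have it: "iterate_set P (suspension_map M T) (- int k) U = shifted (int k) U" for k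
    using sets.sets_into_space[OF U] by (simp add: iterate_set_suspension)
  have fB: "emeasure M (E \<inter> B) < \<infinity>" by (rule finite_E_Int[OF B(2,1)])
  have pU: "prob U = exp (- mean B)" using prob_count_eq[OF B(1) fB, of 0] by (simp add: U_def)
  have "prob (U \<inter> shifted (int k) U) = exp (mean (B \<inter> pre (int k) B) - 2 * mean B)" for k
  proof -
    let ?B = "pre (int k) B"
    have fU: "emeasure M (E \<inter> (B \<union> ?B)) < \<infinity>"
    proof -
      have "emeasure M (E \<inter> (B \<union> ?B)) \<le> emeasure M (E \<inter> B) + emeasure M (E \<inter> ?B)"
        using B E by (subst Int_Un_distrib, intro emeasure_subadditive) auto
      then show ?thesis using fB B by (simp add: le_less_trans ennreal_add_less_top less_top)
    qed
    have "prob (U \<inter> shifted (int k) U) = prob {\<nu> \<in> space P. emeasure \<nu> (B \<union> ?B) = 0}"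
    proof (rule measure_eq_AE)
      show "AE \<nu> in P. (\<nu> \<in> U \<inter> shifted (int k) U) = (\<nu> \<in> {\<nu> \<in> space P. emeasure \<nu> (B \<union> ?B) = 0})"
        using AE_good[of "int k"]
      proof (rule AE_mp, intro AE_I2 impI)
        fix \<nu> assume nu: "\<nu> \<in> space P" "shift (int k) \<nu> \<in> space P"
        have s: "sets \<nu> = sets M" by (rule sets_config[OF nu(1)])
        have "emeasure \<nu> (B \<union> ?B) = 0 \<longleftrightarrow> emeasure \<nu> B = 0 \<and> emeasure \<nu> ?B = 0"
        proof
          assume "emeasure \<nu> B = 0 \<and> emeasure \<nu> ?B = 0"
          then have "B \<in> null_sets \<nu>" "?B \<in> null_sets \<nu>" using B s by (simp_all add: null_sets_def)
          then show "emeasure \<nu> (B \<union> ?B) = 0" by (meson null_sets.Un null_setsD1)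
        next
          assume "emeasure \<nu> (B \<union> ?B) = 0"
          then show "emeasure \<nu> B = 0 \<and> emeasure \<nu> ?B = 0"
            using B s emeasure_eq_0[of "B \<union> ?B" \<nu> B] emeasure_eq_0[of "B \<union> ?B" \<nu> ?B] by (simp add: sets.Un)
        qed
        then show "(\<nu> \<in> U \<inter> shifted (int k) U) = (\<nu> \<in> {\<nu> \<in> space P. emeasure \<nu> (B \<union> ?B) = 0})"
          using nu by (auto simp: U_def shifted_def emeasure_shift[OF s B(1)])
      qed
      show "U \<inter> shifted (int k) U \<in> events" using U by auto
      show "{\<nu> \<in> space P. emeasure \<nu> (B \<union> ?B) = 0} \<in> events" using sets_count_in[OF sets.Un[OF B(1) sets_pre[OF B(1)]], of "{0}"] by simp
    qed
    also have "\<dots> = exp (- mean (B \<union> ?B))" using prob_count_eq[OF sets.Un[OF B(1) sets_pre[OF B(1)]] fU, of 0] by simp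
    also have "mean (B \<union> ?B) = 2 * mean B - mean (B \<inter> ?B)"
    proof -
      have "measure M ((E \<inter> B) \<union> (E \<inter> ?B)) = measure M (E \<inter> B) + measure M (E \<inter> ?B) - measure M ((E \<inter> B) \<inter> (E \<inter> ?B))"
        using B E fB by (intro measure_Un3) (auto simp: fmeasurable_def)
      moreover have "(E \<inter> B) \<union> (E \<inter> ?B) = E \<inter> (B \<union> ?B)" "(E \<inter> B) \<inter> (E \<inter> ?B) = E \<inter> (B \<inter> ?B)" by auto
      ultimately have "mean (B \<union> ?B) = mean B + mean ?B - mean (B \<inter> ?B)" by (simp only: mean_def)
      then show ?thesis using B by simp
    qed
    finally show ?thesis by (simp add: algebra_simps)
  qed
  note peq = this
  have "(\<lambda>k. prob (U \<inter> iterate_set P (suspension_map M T) (- int k) U)) \<longlonglongrightarrow> prob U * prob U"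
    using mix U unfolding mixing_def by blast
  then have "(\<lambda>k. exp (mean (B \<inter> pre (int k) B) - 2 * mean B)) \<longlonglongrightarrow> exp (- mean B) * exp (- mean B)"
    unfolding it peq pU .
  then have "(\<lambda>k. ln (exp (mean (B \<inter> pre (int k) B) - 2 * mean B)) + 2 * mean B) \<longlonglongrightarrow> ln (exp (- mean B) * exp (- mean B)) + 2 * mean B"
    by (intro tendsto_intros) auto
  then show False using rec by (simp add: ln_mult)
qed

text \<open>Strictly increasing integer sequences tend to infinity, so all differences of the times
  \<open>t i k\<close> do, and every pairwise overlap in the decorrelation bound vanishes. Positive
  exponents in \<open>iterate_set\<close> are forward images, hence the shifts by
  \<open>- t i k\<close>.\<close>

lemma mixing_of_all_orders_if:
  assumes lim: "\<And>G. G \<in> sets M \<Longrightarrow> emeasure M G < \<infinity> \<Longrightarrow> (\<lambda>k. mean (G \<inter> pre (int k) G)) \<longlonglongrightarrow> 0"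
  shows "mixing_of_all_orders P (suspension_map M T)"
  unfolding mixing_of_all_orders_def mixing_of_order_def
proof (intro allI impI)
  fix m :: nat and U :: "nat \<Rightarrow> 'a measure set" and n :: "nat \<Rightarrow> nat \<Rightarrow> int"
  assume m: "1 \<le> m" and *: "\<forall>i\<in>{1..m}. U i \<in> events \<and> strict_mono (n i)"
  define t where "t i k = (\<Sum>j=1..i. n j k)" for i k
  have "(\<Inter>i\<in>{1..m}. iterate_set P (suspension_map M T) (t i k) (U i)) = space P \<inter> (\<Inter>i\<in>{1..m}. shifted (- t i k) (U i))" for k
  proof -
    have "(\<Inter>i\<in>{1..m}. iterate_set P (suspension_map M T) (t i k) (U i)) = (\<Inter>i\<in>{1..m}. shifted (- t i k) (U i))"
      using * sets.sets_into_space by (intro INF_cong refl iterate_set_suspension) blast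
    moreover have "(\<Inter>i\<in>{1..m}. shifted (- t i k) (U i)) \<subseteq> space P" using m by (auto simp: shifted_def)
    ultimately show ?thesis by auto
  qed
  note eq = this
  have nlim: "filterlim (n i) at_top sequentially" if "i \<in> {1..m}" for i
  proof -
    have sm: "strict_mono (n i)" using * that by blast
    have "n i 0 + int k \<le> n i k" for k
    proof (induction k)
      case (Suc k)
      then show ?case using strict_monoD[OF sm, of k "Suc k"] by simp
    qed simp
    moreover have "filterlim (\<lambda>k. n i 0 + int k) at_top sequentially"
      unfolding filterlim_at_top eventually_sequentially
      by (intro allI) (rule_tac x = "nat (Z - n i 0)" in exI, auto)
    ultimately show ?thesis by (intro filterlim_at_top_mono[where g = "n i"] always_eventually allI) auto
  qed
  \<comment> \<open>The sequences may start at negative values; once all are nonnegative, the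
    difference is a sum of nonnegative terms one of which is \<open>n j k\<close>.\<close>
  have tlim: "filterlim (\<lambda>k. t j k - t i k) at_top sequentially" if ij: "i \<in> {1..<j}" "j \<in> {1..m}" for i j
  proof -
    have "\<forall>\<^sub>F k in sequentially. \<forall>l\<in>{1..m}. 0 \<le> n l k"
      using nlim by (intro eventually_ball_finite) (auto simp: filterlim_at_top)
    then have "\<forall>\<^sub>F k in sequentially. n j k \<le> t j k - t i k"
    proof eventually_elim
      fix k assume nn: "\<forall>l\<in>{1..m}. 0 \<le> n l k"
      have "{1..j} = {1..i} \<union> {Suc i..j}" using ij by auto
      then have "t j k - t i k = (\<Sum>l=Suc i..j. n l k)"
        unfolding t_def by (simp add: sum.union_disjoint)
      moreover have "n j k \<le> (\<Sum>l=Suc i..j. n l k)"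
        using ij nn by (intro member_le_sum) auto
      ultimately show "n j k \<le> t j k - t i k" by simp
    qed
    then show ?thesis by (rule filterlim_at_top_mono[OF nlim[OF ij(2)]])
  qed
  have mlim: "(\<lambda>k. mean (pre (- t i k) G \<inter> pre (- t j k) G)) \<longlonglongrightarrow> 0"
    if ij: "i \<in> {1..<j}" "j \<in> {1..m}" and G: "G \<in> sets M" "emeasure M G < \<infinity>" for i j G
  proof -
    \<comment> \<open>The hypothesis concerns natural times; passing through \<open>nat\<close>
      changes nothing once the difference is nonnegative.\<close>
    have "(\<lambda>k. mean (G \<inter> pre (int (nat (t j k - t i k))) G)) \<longlonglongrightarrow> 0"
      by (rule filterlim_compose[OF lim[OF G]])
         (rule filterlim_compose[OF filterlim_nat_sequentially tlim[OF ij]])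
    moreover have "\<forall>\<^sub>F k in sequentially. mean (G \<inter> pre (int (nat (t j k - t i k))) G) = mean (pre (- t i k) G \<inter> pre (- t j k) G)"
      using tlim[OF ij, unfolded filterlim_at_top, rule_format, of 0]
    proof eventually_elim
      fix k assume "0 \<le> t j k - t i k"
      then show "mean (G \<inter> pre (int (nat (t j k - t i k))) G) = mean (pre (- t i k) G \<inter> pre (- t j k) G)"
        using mean_pre_Int_pre[OF G(1), of "- t j k" "- t i k"] by (simp add: Int_commute)
    qed
    ultimately show ?thesis by (rule Lim_transform_eventually)
  qed
  have "(\<lambda>k. prob (space P \<inter> (\<Inter>i\<in>{1..m}. shifted (- t i k) (U i)))) \<longlonglongrightarrow> (\<Prod>i=1..m. prob (U i))"
  proof (rule LIMSEQ_I)
    fix r :: real assume r: "0 < r"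
    have Ue: "\<And>i. i \<in> {1..m} \<Longrightarrow> U i \<in> events" using * by blast
    have "\<exists>G. G \<in> sets M \<and> emeasure M G < \<infinity> \<and>
      (\<forall>s. \<bar>prob (space P \<inter> (\<Inter>i\<in>{1..m}. shifted (s i) (U i))) - (\<Prod>i\<in>{1..m}. prob (U i))\<bar>
        \<le> r / 2 + 2 * (\<Sum>j\<in>{1..m}. \<Sum>i\<in>{1..<j}. mean (pre (s i) G \<inter> pre (s j) G)))"
      by (rule asymptotic_independence[OF Ue]) (use r in auto)
    then obtain G where G: "G \<in> sets M" "emeasure M G < \<infinity>"
      and bd: "\<forall>s. \<bar>prob (space P \<inter> (\<Inter>i\<in>{1..m}. shifted (s i) (U i))) - (\<Prod>i\<in>{1..m}. prob (U i))\<bar>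
      \<le> r / 2 + 2 * (\<Sum>j\<in>{1..m}. \<Sum>i\<in>{1..<j}. mean (pre (s i) G \<inter> pre (s j) G))"
      by (elim exE conjE)
    have "(\<lambda>k. 2 * (\<Sum>j\<in>{1..m}. \<Sum>i\<in>{1..<j}. mean (pre (- t i k) G \<inter> pre (- t j k) G))) \<longlonglongrightarrow> 2 * (\<Sum>j\<in>{1..m}. \<Sum>i\<in>{1..<j}. 0)"
      by (intro tendsto_intros mlim G)
    then have "\<forall>\<^sub>F k in sequentially. 2 * (\<Sum>j\<in>{1..m}. \<Sum>i\<in>{1..<j}. mean (pre (- t i k) G \<inter> pre (- t j k) G)) < r / 2"
      by (rule order_tendstoD(2)) (use r in simp)
    then obtain N where N: "\<And>k. k \<ge> N \<Longrightarrow> 2 * (\<Sum>j\<in>{1..m}. \<Sum>i\<in>{1..<j}. mean (pre (- t i k) G \<inter> pre (- t j k) G)) < r / 2"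
      by (auto simp: eventually_sequentially)
    show "\<exists>N. \<forall>k\<ge>N. norm (prob (space P \<inter> (\<Inter>i\<in>{1..m}. shifted (- t i k) (U i))) - (\<Prod>i=1..m. prob (U i))) < r"
    proof (intro exI[of _ N] allI impI)
      fix k assume "N \<le> k"
      then show "norm (prob (space P \<inter> (\<Inter>i\<in>{1..m}. shifted (- t i k) (U i))) - (\<Prod>i=1..m. prob (U i))) < r"
        using N[of k] bd[rule_format, of "\<lambda>i. - t i k"] by simp
    qed
  qed
  then show "(\<lambda>k. prob (\<Inter>i\<in>{1..m}. iterate_set P (suspension_map M T) (\<Sum>j=1..i. n j k) (U i))) \<longlonglongrightarrow> (\<Prod>i=1..m. prob (U i))"
    using eq unfolding t_def by simp
qed

end

section \<open>Borel coordinates on Lebesgue spaces\<close>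

text \<open>The coordinate is the isomorphism onto the real model. Images of measurable sets lie in
  the completed Borel sigma-algebra, hence are trapped between Borel sets differing inside a null
  set of the model, which pulls back to a null set. Completeness of \<open>\<nu>\<close> means that
  completing it adds no new measurable sets.\<close>

lemma lebesgue_coordinates:
  assumes "lebesgue_prob_space \<nu>" and eq: "equivalent_measures M \<nu>"
  obtains X and \<phi> :: "'a \<Rightarrow> real" where "X \<in> sets M" "space M - X \<in> null_sets M" "inj_on \<phi> X"
    "\<And>b. b \<in> sets borel \<Longrightarrow> {x \<in> X. \<phi> x \<in> b} \<in> sets M"
    "\<And>B. B \<in> sets M \<Longrightarrow> B \<subseteq> X \<Longrightarrow> \<exists>b0 b1. b0 \<in> sets borel \<and> b1 \<in> sets borel \<and>
        b0 \<subseteq> \<phi> ` B \<and> \<phi> ` B \<subseteq> b1 \<and> {x \<in> X. \<phi> x \<in> b1 - b0} \<in> null_sets M"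
proof -
  obtain L X0 Y0 f where L: "sets L = sets (borel :: real measure)" and iso: "mod0_isomorphism \<nu> L X0 Y0 f"
    and cm: "complete_measure \<nu>"
    using assms(1) unfolding lebesgue_prob_space_def by metis
  interpret complete_measure \<nu> by fact
  have s: "sets M = sets \<nu>" and null: "null_sets M = null_sets \<nu>"
    using eq unfolding equivalent_measures_def absolutely_continuous_def by auto
  have sp: "space M = space \<nu>" by (rule sets_eq_imp_space_eq[OF s])
  have null_c: "null_sets (completion \<nu>) = null_sets \<nu>"
    unfolding set_eq_iff null_sets_completion_iff2 by (blast intro: complete2)
  have sets_c: "sets (completion \<nu>) = sets \<nu>"
  proof
    show "sets (completion \<nu>) \<subseteq> sets \<nu>"
    proof
      fix B assume "B \<in> sets (completion \<nu>)"
      then obtain S N N' where "B = S \<union> N" "N \<subseteq> N'" "N' \<in> null_sets \<nu>" "S \<in> sets \<nu>" by (rule sets_completionE)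
      then show "B \<in> sets \<nu>" using complete2 by blast
    qed
  qed auto
  from iso have X0: "X0 \<in> sets (completion \<nu>)" "space \<nu> - X0 \<in> null_sets (completion \<nu>)"
    and Y0: "Y0 \<in> sets (completion L)"
    and bij: "bij_betw f X0 Y0"
    and mf: "f \<in> restrict_space (completion \<nu>) X0 \<rightarrow>\<^sub>M restrict_space (completion L) Y0"
    and mi: "the_inv_into X0 f \<in> restrict_space (completion L) Y0 \<rightarrow>\<^sub>M restrict_space (completion \<nu>) X0"
    and d: "distr (restrict_space (completion \<nu>) X0) (restrict_space (completion L) Y0) f = restrict_space (completion L) Y0"
    unfolding mod0_isomorphism_def by auto
  have inj: "inj_on f X0" and img: "f ` X0 = Y0" using bij by (auto simp: bij_betw_def)
  have X0sub: "X0 \<subseteq> space \<nu>" using sets.sets_into_space[OF X0(1)] by simp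
  have Y0sub: "Y0 \<subseteq> space L" using sets.sets_into_space[OF Y0] by simp
  have spX: "space (restrict_space (completion \<nu>) X0) = X0" using X0sub by (auto simp: space_restrict_space)
  have spY: "space (restrict_space (completion L) Y0) = Y0" using Y0sub by (auto simp: space_restrict_space)
  have pre: "{x \<in> X0. f x \<in> b} \<in> sets \<nu>" if b: "b \<in> sets borel" for b
  proof -
    have "b \<inter> Y0 \<in> sets (restrict_space (completion L) Y0)"
      using b L by (auto simp: sets_restrict_space)
    from measurable_sets[OF mf this] have "f -` (b \<inter> Y0) \<inter> X0 \<in> sets (restrict_space (completion \<nu>) X0)"
      by (simp add: spX)
    then have "f -` (b \<inter> Y0) \<inter> X0 \<in> sets (completion \<nu>)"
      using X0 by (subst (asm) sets_restrict_space_iff) auto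
    moreover have "f -` (b \<inter> Y0) \<inter> X0 = {x \<in> X0. f x \<in> b}" using img by auto
    ultimately show ?thesis using sets_c by simp
  qed
  show thesis
  proof (rule that[of X0 f])
    show "X0 \<in> sets M" "space M - X0 \<in> null_sets M" using X0 by (simp_all add: s sets_c null null_c sp)
    show "inj_on f X0" by fact
    show "{x \<in> X0. f x \<in> b} \<in> sets M" if "b \<in> sets borel" for b using pre[OF that] s by simp
    fix B assume B: "B \<in> sets M" "B \<subseteq> X0"
    have "B \<in> sets (restrict_space (completion \<nu>) X0)"
      using B X0 by (subst sets_restrict_space_iff) (auto simp: s)
    from measurable_sets[OF mi this] have "the_inv_into X0 f -` B \<inter> Y0 \<in> sets (restrict_space (completion L) Y0)"
      by (simp add: spY)
    then have "the_inv_into X0 f -` B \<inter> Y0 \<in> sets (completion L)"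
      using Y0 by (subst (asm) sets_restrict_space_iff) auto
    moreover have "the_inv_into X0 f -` B \<inter> Y0 = f ` B"
      using B(2) inj img by (auto simp: the_inv_into_f_f subset_eq image_iff)
    ultimately have "f ` B \<in> sets (completion L)" by simp
    then obtain S N N' where SN: "f ` B = S \<union> N" "N \<subseteq> N'" "N' \<in> null_sets L" "S \<in> sets L" by (rule sets_completionE)
    have N': "N' \<in> sets borel" using SN(3) L by auto
    have "N' \<inter> Y0 \<in> null_sets (completion L)"
      using SN(3) by (intro null_sets_completion_subset[OF _ null_sets_completionI]) auto
    then have r0: "emeasure (restrict_space (completion L) Y0) (N' \<inter> Y0) = 0"
      using Y0 by (subst emeasure_restrict_space) auto
    have rs: "N' \<inter> Y0 \<in> sets (restrict_space (completion L) Y0)"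
      using N' L by (auto simp: sets_restrict_space)
    have "emeasure (restrict_space (completion \<nu>) X0) (f -` (N' \<inter> Y0) \<inter> X0) = 0"
      using r0 emeasure_distr[OF mf rs] d spX by simp
    moreover have e: "f -` (N' \<inter> Y0) \<inter> X0 = {x \<in> X0. f x \<in> N'}" using img by auto
    ultimately have "emeasure (completion \<nu>) {x \<in> X0. f x \<in> N'} = 0"
      using X0 by (subst (asm) emeasure_restrict_space) auto
    then have n0: "{x \<in> X0. f x \<in> N'} \<in> null_sets \<nu>"
      using pre[OF N'] by (auto simp: null_sets_def)
    have "{x \<in> X0. f x \<in> (S \<union> N') - S} \<in> null_sets \<nu>"
      by (rule complete2[OF _ n0]) auto
    then show "\<exists>b0 b1. b0 \<in> sets borel \<and> b1 \<in> sets borel \<and>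
        b0 \<subseteq> f ` B \<and> f ` B \<subseteq> b1 \<and> {x \<in> X0. f x \<in> b1 - b0} \<in> null_sets M"
      using SN N' L by (intro exI[of _ S] exI[of _ "S \<union> N'"]) (auto simp: null)
  qed
qed

text \<open>Moving the \<open>j\<close>-th piece of a partition into the interval \<open>(j, j + 1)\<close> gives bounded sets finite measure.\<close>

definition squeeze :: "nat \<Rightarrow> real \<Rightarrow> real" where
  "squeeze j t = real j + (1 + t / (1 + \<bar>t\<bar>)) / 2"

definition unsqueeze :: "nat \<Rightarrow> real \<Rightarrow> real" where
  "unsqueeze j s = (let u = 2 * (s - real j) - 1 in u / (1 - \<bar>u\<bar>))"

lemma squeeze_bounds: "real j < squeeze j t" "squeeze j t < real j + 1"
proof -
  have "\<bar>t / (1 + \<bar>t\<bar>)\<bar> < 1" by (simp add: abs_divide)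
  moreover define v where "v = t / (1 + \<bar>t\<bar>)"
  ultimately have "- 1 < v" "v < 1" by linarith+
  then show "real j < squeeze j t" "squeeze j t < real j + 1"
    unfolding squeeze_def v_def[symmetric] by auto
qed

lemma unsqueeze_squeeze [simp]: "unsqueeze j (squeeze j t) = t"
proof -
  define w where "w = 1 + \<bar>t\<bar>"
  have w: "0 < w" "\<bar>t\<bar> = w - 1" by (auto simp: w_def)
  have "2 * (squeeze j t - real j) - 1 = t / w" by (simp add: squeeze_def w_def field_simps)
  moreover have "1 - \<bar>t / w\<bar> = 1 / w" using w by (simp add: abs_divide field_simps)
  ultimately show ?thesis using w by (simp add: unsqueeze_def)
qed

lemma squeeze_unsqueeze: "real j < s \<Longrightarrow> s < real j + 1 \<Longrightarrow> squeeze j (unsqueeze j s) = s"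
proof -
  assume s: "real j < s" "s < real j + 1"
  define u where "u = 2 * (s - real j) - 1"
  define w where "w = 1 - \<bar>u\<bar>"
  have w: "0 < w" using s by (auto simp: u_def w_def abs_if)
  have "\<bar>u / w\<bar> = \<bar>u\<bar> / w" using w by (simp add: abs_divide)
  moreover have "\<bar>u\<bar> = 1 - w" by (simp add: w_def)
  ultimately have "1 + \<bar>u / w\<bar> = 1 / w" using w by (simp add: field_simps)
  then have "u / w / (1 + \<bar>u / w\<bar>) = u" using w by simp
  moreover have "unsqueeze j s = u / w" by (simp add: unsqueeze_def u_def w_def Let_def)
  ultimately have "squeeze j (unsqueeze j s) = real j + (1 + u) / 2" by (simp only: squeeze_def)
  then show ?thesis by (simp add: u_def field_simps)
qed

lemma measurable_squeeze [measurable]: "squeeze j \<in> borel_measurable borel"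
  unfolding squeeze_def by measurable

lemma measurable_unsqueeze [measurable]: "unsqueeze j \<in> borel_measurable borel"
  unfolding unsqueeze_def Let_def by measurable

lemma squeeze_image: "squeeze j ` b = {s. real j < s \<and> s < real j + 1 \<and> unsqueeze j s \<in> b}"
  using squeeze_bounds[of j] by (auto simp: squeeze_unsqueeze intro!: image_eqI[of _ _ "unsqueeze j _"])

lemma sets_squeeze_image:
  assumes [measurable]: "b \<in> sets borel"
  shows "squeeze j ` b \<in> sets borel"
proof -
  have "{s \<in> space borel. real j < s \<and> s < real j + 1 \<and> unsqueeze j s \<in> b} \<in> sets borel" by measurable
  then show ?thesis by (simp add: squeeze_image)
qed

lemma squeeze_eq_iff: "squeeze i s = squeeze j t \<longleftrightarrow> i = j \<and> s = t"
proof
  assume eq: "squeeze i s = squeeze j t"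
  have "real i < real j + 1" "real j < real i + 1"
    using squeeze_bounds[of i s] squeeze_bounds[of j t] eq by linarith+
  then have "i = j" by linarith
  moreover have "s = t" using eq \<open>i = j\<close> by (metis unsqueeze_squeeze)
  ultimately show "i = j \<and> s = t" ..
qed auto

text \<open>
  The last condition says that measurable subsets of \<open>W\<close> have Borel images up to null sets; it has to be
  phrased with images as \<open>M\<close> is complete.
\<close>

definition borel_coordinate :: "'a measure \<Rightarrow> 'a set \<Rightarrow> ('a \<Rightarrow> real) \<Rightarrow> bool" where
  "borel_coordinate M W \<phi> \<longleftrightarrow> inj_on \<phi> W \<and> (\<forall>x\<in>W. 0 \<le> \<phi> x) \<and>
    (\<forall>b\<in>sets borel. {x \<in> W. \<phi> x \<in> b} \<in> sets M) \<and>
    (\<forall>r. emeasure M {x \<in> W. \<phi> x < r} < \<infinity>) \<and>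
    (\<forall>B\<in>sets M. B \<subseteq> W \<longrightarrow> (\<exists>b0\<in>sets borel. \<exists>b1\<in>sets borel.
        b0 \<subseteq> \<phi> ` B \<and> \<phi> ` B \<subseteq> b1 \<and> {x \<in> W. \<phi> x \<in> b1 - b0} \<in> null_sets M))"

lemma choice2: "(\<And>j. \<exists>x y. Q j x y) \<Longrightarrow> \<exists>f g. \<forall>j. Q j (f j) (g j)"
  by metis

text \<open>Piece \<open>j\<close> of the partition is moved to the interval
  \<open>(j, j + 1)\<close>, so a coordinate below \<open>r\<close> confines the point to finitely
  many pieces, of finite total measure. This is what later lets the points be numbered from the
  left.\<close>

lemma ex_borel_coordinate:
  assumes "lebesgue_prob_space \<nu>" and "equivalent_measures M \<nu>"
    and A: "finite_measure_partition M A" and W': "W' \<in> sets M"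
  obtains W \<phi> where "W \<in> sets M" "W \<subseteq> W'" "W' - W \<in> null_sets M" "borel_coordinate M W \<phi>"
proof -
  obtain X and f :: "'a \<Rightarrow> real" where X: "X \<in> sets M" "space M - X \<in> null_sets M" "inj_on f X"
    and pre: "\<And>b. b \<in> sets borel \<Longrightarrow> {x \<in> X. f x \<in> b} \<in> sets M"
    and sw: "\<And>B. B \<in> sets M \<Longrightarrow> B \<subseteq> X \<Longrightarrow> \<exists>b0 b1. b0 \<in> sets borel \<and> b1 \<in> sets borel \<and>
        b0 \<subseteq> f ` B \<and> f ` B \<subseteq> b1 \<and> {x \<in> X. f x \<in> b1 - b0} \<in> null_sets M"
  proof (rule lebesgue_coordinates[OF assms(1,2)], goal_cases)
    case (1 X f)
    show ?case by (rule 1(1)[OF 1(2-6)])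
  qed
  have As: "A j \<in> sets M" "emeasure M (A j) < \<infinity>" for j using A by (auto simp: finite_measure_partition_def)
  have Ad: "i = j" if "x \<in> A i" "x \<in> A j" for x i j
    using A that by (auto simp: finite_measure_partition_def disjoint_family_on_def)
  have AU: "(\<Union>j. A j) = space M" using A by (simp add: finite_measure_partition_def)
  have "\<exists>b0 b1. b0 \<in> sets borel \<and> b1 \<in> sets borel \<and>
        b0 \<subseteq> f ` (W' \<inter> A j \<inter> X) \<and> f ` (W' \<inter> A j \<inter> X) \<subseteq> b1 \<and> {x \<in> X. f x \<in> b1 - b0} \<in> null_sets M" for j
    using W' As X by (intro sw) auto
  then have "\<exists>b0 b1. \<forall>j. b0 j \<in> sets borel \<and> b1 j \<in> sets borel \<and>
        b0 j \<subseteq> f ` (W' \<inter> A j \<inter> X) \<and> f ` (W' \<inter> A j \<inter> X) \<subseteq> b1 j \<and> {x \<in> X. f x \<in> b1 j - b0 j} \<in> null_sets M"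
    by (rule choice2)
  then obtain b0 b1 where "\<forall>j. b0 j \<in> sets borel \<and> b1 j \<in> sets borel \<and>
        b0 j \<subseteq> f ` (W' \<inter> A j \<inter> X) \<and> f ` (W' \<inter> A j \<inter> X) \<subseteq> b1 j \<and> {x \<in> X. f x \<in> b1 j - b0 j} \<in> null_sets M"
    by (elim exE)
  then have b: "\<And>j. b0 j \<in> sets borel" "\<And>j. b1 j \<in> sets borel"
    "\<And>j. b0 j \<subseteq> f ` (W' \<inter> A j \<inter> X)" "\<And>j. f ` (W' \<inter> A j \<inter> X) \<subseteq> b1 j" "\<And>j. {x \<in> X. f x \<in> b1 j - b0 j} \<in> null_sets M"
    by blast+
  \<comment> \<open>Cutting with the inner Borel set loses only points with
    \<open>f x \<in> b1 j - b0 j\<close>, a null set, and makes each piece the preimage of a Borel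
    set.\<close>
  define V where "V j = {x \<in> X. f x \<in> b0 j}" for j
  have Vs: "V j \<in> sets M" for j unfolding V_def by (rule pre[OF b(1)])
  have Vsub: "V j \<subseteq> W' \<inter> A j \<inter> X" for j
  proof
    fix x assume "x \<in> V j"
    then have x: "x \<in> X" "f x \<in> b0 j" by (auto simp: V_def)
    then obtain y where "y \<in> W' \<inter> A j \<inter> X" "f x = f y" using b(3)[of j] by blast
    then show "x \<in> W' \<inter> A j \<inter> X" using x X(3) by (metis IntE inj_onD)
  qed
  define W where "W = (\<Union>j. V j)"
  have Ws: "W \<in> sets M" unfolding W_def using Vs by auto
  define ix where "ix x = (THE j. x \<in> A j)" for x
  have ix: "ix x = j" if "x \<in> A j" for x j unfolding ix_def using that Ad by blast
  define \<phi> where "\<phi> x = squeeze (ix x) (f x)" for x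
  have \<phi>: "\<phi> x = squeeze j (f x)" if "x \<in> A j" for x j using ix[OF that] by (simp add: \<phi>_def)
  have \<phi>V: "\<phi> x = squeeze j (f x)" if "x \<in> V j" for x j using \<phi>[of x j] Vsub that by blast
  have WX: "W \<subseteq> X" using Vsub by (auto simp: W_def)
  have Wsp: "\<exists>j. x \<in> V j \<and> x \<in> A j" if "x \<in> W" for x using that Vsub by (auto simp: W_def)
  show thesis
  proof (rule that[of W \<phi>])
    show "W \<in> sets M" by fact
    show "W \<subseteq> W'" using Vsub by (auto simp: W_def)
    have "(space M - X) \<union> (\<Union>j. {x \<in> X. f x \<in> b1 j - b0 j}) \<in> null_sets M"
      using X(2) b(5) by blast
    then show "W' - W \<in> null_sets M"
    proof (rule null_sets_subset)
      show "W' - W \<in> sets M" using W' Ws by auto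
      show "W' - W \<subseteq> (space M - X) \<union> (\<Union>j. {x \<in> X. f x \<in> b1 j - b0 j})"
      proof
        fix x assume x: "x \<in> W' - W"
        then have "x \<in> space M" using sets.sets_into_space[OF W'] by auto
        then obtain j where j: "x \<in> A j" using AU by auto
        show "x \<in> (space M - X) \<union> (\<Union>j. {x \<in> X. f x \<in> b1 j - b0 j})"
        proof (cases "x \<in> X")
          case True
          then have "f x \<in> b1 j" using b(4)[of j] x j by auto
          moreover have "f x \<notin> b0 j" using x True by (auto simp: W_def V_def)
          ultimately show ?thesis using True by auto
        qed (use \<open>x \<in> space M\<close> in auto)
      qed
    qed
    show "borel_coordinate M W \<phi>"
      unfolding borel_coordinate_def
    proof (intro conjI ballI allI impI)
      show "inj_on \<phi> W"
      proof (rule inj_onI)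
        fix x y assume xy: "x \<in> W" "y \<in> W" "\<phi> x = \<phi> y"
        obtain i where i: "x \<in> V i" using xy by (auto simp: W_def)
        obtain j where j: "y \<in> V j" using xy by (auto simp: W_def)
        have "f x = f y" using xy(3) by (simp add: \<phi>V[OF i] \<phi>V[OF j] squeeze_eq_iff)
        then show "x = y" using X(3) xy WX by (auto simp: inj_on_def)
      qed
      show "0 \<le> \<phi> x" for x using squeeze_bounds(1)[of "ix x" "f x"] unfolding \<phi>_def by linarith
    next
      fix c :: "real set" assume c: "c \<in> sets borel"
      have "{x \<in> W. \<phi> x \<in> c} = (\<Union>j. {x \<in> X. f x \<in> b0 j \<inter> squeeze j -` c})"
        using \<phi>V by (auto simp: W_def V_def)
      moreover have "{x \<in> X. f x \<in> b0 j \<inter> squeeze j -` c} \<in> sets M" for j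
        using measurable_sets[OF measurable_squeeze c, of j] b(1) by (intro pre) auto
      ultimately show "{x \<in> W. \<phi> x \<in> c} \<in> sets M" by auto
    next
      fix r :: real
      define N where "N = nat \<lceil>r\<rceil>"
      have "{x \<in> W. \<phi> x < r} \<subseteq> (\<Union>j\<le>N. A j)"
      proof
        fix x assume x: "x \<in> {x \<in> W. \<phi> x < r}"
        then obtain j where j: "x \<in> A j" using Wsp by blast
        have "real j < r" using squeeze_bounds(1)[of j "f x"] \<phi>[OF j] x by auto
        then have "j \<le> N" unfolding N_def by linarith
        then show "x \<in> (\<Union>j\<le>N. A j)" using j by auto
      qed
      then have "emeasure M {x \<in> W. \<phi> x < r} \<le> emeasure M (\<Union>j\<le>N. A j)"
        using As by (intro emeasure_mono) auto
      also have "\<dots> \<le> (\<Sum>j\<le>N. emeasure M (A j))" using As by (intro emeasure_subadditive_finite) auto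
      also have "\<dots> < \<infinity>" using As by (simp add: less_top sum_Pinfty)
      finally show "emeasure M {x \<in> W. \<phi> x < r} < \<infinity>" .
    next
      fix B assume B: "B \<in> sets M" "B \<subseteq> W"
      have "\<exists>c0 c1. c0 \<in> sets borel \<and> c1 \<in> sets borel \<and>
        c0 \<subseteq> f ` (B \<inter> A j) \<and> f ` (B \<inter> A j) \<subseteq> c1 \<and> {x \<in> X. f x \<in> c1 - c0} \<in> null_sets M" for j
        using B As WX by (intro sw) auto
      then have "\<exists>c0 c1. \<forall>j. c0 j \<in> sets borel \<and> c1 j \<in> sets borel \<and>
        c0 j \<subseteq> f ` (B \<inter> A j) \<and> f ` (B \<inter> A j) \<subseteq> c1 j \<and> {x \<in> X. f x \<in> c1 j - c0 j} \<in> null_sets M"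
        by (rule choice2)
      then obtain c0 c1 where "\<forall>j. c0 j \<in> sets borel \<and> c1 j \<in> sets borel \<and>
        c0 j \<subseteq> f ` (B \<inter> A j) \<and> f ` (B \<inter> A j) \<subseteq> c1 j \<and> {x \<in> X. f x \<in> c1 j - c0 j} \<in> null_sets M"
        by (elim exE)
      then have c: "\<And>j. c0 j \<in> sets borel" "\<And>j. c1 j \<in> sets borel"
        "\<And>j. c0 j \<subseteq> f ` (B \<inter> A j)" "\<And>j. f ` (B \<inter> A j) \<subseteq> c1 j" "\<And>j. {x \<in> X. f x \<in> c1 j - c0 j} \<in> null_sets M"
        by blast+
      have im: "\<phi> ` B = (\<Union>j. squeeze j ` f ` (B \<inter> A j))"
      proof -
        have "B = (\<Union>j. B \<inter> A j)" using AU sets.sets_into_space[OF B(1)] by blast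
        then have "\<phi> ` B = (\<Union>j. \<phi> ` (B \<inter> A j))" by blast
        also have "\<dots> = (\<Union>j. squeeze j ` f ` (B \<inter> A j))"
        proof (intro SUP_cong refl)
          fix j
          show "\<phi> ` (B \<inter> A j) = squeeze j ` f ` (B \<inter> A j)"
            unfolding image_image by (rule image_cong[OF refl]) (use \<phi> in blast)
        qed
        finally show ?thesis .
      qed
      show "\<exists>b0\<in>sets borel. \<exists>b1\<in>sets borel.
        b0 \<subseteq> \<phi> ` B \<and> \<phi> ` B \<subseteq> b1 \<and> {x \<in> W. \<phi> x \<in> b1 - b0} \<in> null_sets M"
      proof (intro bexI conjI)
        show "(\<Union>j. squeeze j ` c0 j) \<subseteq> \<phi> ` B" unfolding im by (intro UN_mono image_mono c(3) subset_refl)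
        show "\<phi> ` B \<subseteq> (\<Union>j. squeeze j ` c1 j)" unfolding im by (intro UN_mono image_mono c(4) subset_refl)
        show "(\<Union>j. squeeze j ` c0 j) \<in> sets borel" "(\<Union>j. squeeze j ` c1 j) \<in> sets borel"
          using sets_squeeze_image c by auto
        then have dm: "(\<Union>j. squeeze j ` c1 j) - (\<Union>j. squeeze j ` c0 j) \<in> sets borel" by blast
        have "(\<Union>j. {x \<in> X. f x \<in> c1 j - c0 j}) \<in> null_sets M" using c(5) by blast
        then show "{x \<in> W. \<phi> x \<in> (\<Union>j. squeeze j ` c1 j) - (\<Union>j. squeeze j ` c0 j)} \<in> null_sets M"
        proof (rule null_sets_subset)
          have "{x \<in> W. \<phi> x \<in> c} \<in> sets M" if c: "c \<in> sets borel" for c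
          proof -
            have "{x \<in> W. \<phi> x \<in> c} = (\<Union>j. {x \<in> X. f x \<in> b0 j \<inter> squeeze j -` c})"
              using \<phi>V by (auto simp: W_def V_def)
            moreover have "{x \<in> X. f x \<in> b0 j \<inter> squeeze j -` c} \<in> sets M" for j
              using measurable_sets[OF measurable_squeeze c, of j] b(1) by (intro pre) auto
            ultimately show ?thesis by auto
          qed
          from this[OF dm] show "{x \<in> W. \<phi> x \<in> (\<Union>j. squeeze j ` c1 j) - (\<Union>j. squeeze j ` c0 j)} \<in> sets M" .
          show "{x \<in> W. \<phi> x \<in> (\<Union>j. squeeze j ` c1 j) - (\<Union>j. squeeze j ` c0 j)} \<subseteq> (\<Union>j. {x \<in> X. f x \<in> c1 j - c0 j})"
          proof
            fix x assume x: "x \<in> {x \<in> W. \<phi> x \<in> (\<Union>j. squeeze j ` c1 j) - (\<Union>j. squeeze j ` c0 j)}"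
            then obtain j t where jt: "t \<in> c1 j" "\<phi> x = squeeze j t" by auto
            obtain i where i: "x \<in> V i" using x by (auto simp: W_def)
            have "squeeze i (f x) = squeeze j t" using \<phi>V[OF i] jt by simp
            then have "f x = t" by (simp add: squeeze_eq_iff)
            moreover have "f x \<notin> c0 j" using x jt \<open>f x = t\<close> by auto
            ultimately show "x \<in> (\<Union>j. {x \<in> X. f x \<in> c1 j - c0 j})" using x WX jt by auto
          qed
        qed
      qed
    qed
  qed
qed

section \<open>Bernoulli coding of dissipative suspensions\<close>

lemma measurable_completion_AE:
  assumes f: "f \<in> Q \<rightarrow>\<^sub>M N" and ae: "AE x in Q. f x = g x" and sp: "\<And>x. x \<in> space Q \<Longrightarrow> g x \<in> space N"
  shows "g \<in> completion Q \<rightarrow>\<^sub>M N"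
proof (rule measurableI)
  show "g x \<in> space N" if "x \<in> space (completion Q)" for x using sp that by simp
  fix V assume V: "V \<in> sets N"
  show "g -` V \<inter> space (completion Q) \<in> sets (completion Q)"
  proof (rule completion.in_sets_AE)
    show "f -` V \<inter> space Q \<in> sets (completion Q)" using measurable_sets[OF f V] by auto
    show "AE x in completion Q. (x \<in> f -` V \<inter> space Q) = (x \<in> g -` V \<inter> space (completion Q))"
      using AE_completion[OF ae] by (rule AE_mp) (auto intro!: AE_I2)
  qed auto
qed

section \<open>Encoding and decoding of configurations on the orbit of \<open>W\<close>\<close>

locale bernoulli_coding = poisson_suspension M T A E P
  for M :: "'a measure" and T A E P +
  fixes W :: "'a set" and \<phi> :: "'a \<Rightarrow> real"
  assumes W: "wandering M T W" and EW: "sym_diff E (\<Union>n. pre n W) \<in> null_sets M"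
    and coord: "borel_coordinate M W \<phi>"
begin

lemma W_sets [simp]: "W \<in> sets M" and W_disjoint: "disjoint_family (\<lambda>n. pre n W)"
  using W by (simp_all add: wandering_iff)

lemmas borel_coordinateD = coord[unfolded borel_coordinate_def]

lemma inj: "inj_on \<phi> W"
  by (rule borel_coordinateD[THEN conjunct1])

lemma nonneg: "x \<in> W \<Longrightarrow> 0 \<le> \<phi> x"
  by (rule borel_coordinateD[THEN conjunct2, THEN conjunct1, rule_format])

lemma slice_sets: "b \<in> sets borel \<Longrightarrow> {x \<in> W. \<phi> x \<in> b} \<in> sets M"
  by (rule borel_coordinateD[THEN conjunct2, THEN conjunct2, THEN conjunct1, rule_format])

lemma slice_finite: "emeasure M {x \<in> W. \<phi> x < r} < \<infinity>"
  by (rule borel_coordinateD[THEN conjunct2, THEN conjunct2, THEN conjunct2, THEN conjunct1, rule_format])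

lemma sandwich:
  assumes "B \<in> sets M" "B \<subseteq> W"
  shows "\<exists>b0 b1. b0 \<in> sets borel \<and> b1 \<in> sets borel \<and> b0 \<subseteq> \<phi> ` B \<and> \<phi> ` B \<subseteq> b1 \<and>
    {x \<in> W. \<phi> x \<in> b1 - b0} \<in> null_sets M"
  using borel_coordinateD[THEN conjunct2, THEN conjunct2, THEN conjunct2, THEN conjunct2, rule_format, OF assms]
  by (elim bexE) (intro exI conjI; assumption?; elim conjE; assumption)

definition slice :: "int \<Rightarrow> real set \<Rightarrow> 'a set" where
  "slice n b = pre n {x \<in> W. \<phi> x \<in> b}"

lemma slice_in_sets [simp]: "b \<in> sets borel \<Longrightarrow> slice n b \<in> sets M"
  by (simp add: slice_def slice_sets)

lemma slice_subset: "slice n b \<subseteq> pre n W"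
  by (auto simp: slice_def pre_def)

lemma slice_mono: "b \<subseteq> b' \<Longrightarrow> slice n b \<subseteq> slice n b'"
  by (auto simp: slice_def pre_def)

lemma emeasure_shift_slice:
  "sets \<nu> = sets M \<Longrightarrow> b \<in> sets borel \<Longrightarrow> emeasure (shift m \<nu>) (slice n b) = emeasure \<nu> (slice (n + m) b)"
  by (subst emeasure_shift) (simp_all add: slice_def pre_pre add.commute slice_sets)

lemma emeasure_slice_lessThan: "emeasure M (slice n {..<r}) < \<infinity>"
  using slice_finite[of r] slice_sets[of "{..<r}"] by (simp add: slice_def)

text \<open>Over all rational \<open>q\<close> and all \<open>k\<close> these bits record the
  counting function of the points in \<open>pre n W\<close> along left half-lines, as long as it
  takes natural values.\<close>

definition enc_bit :: "int \<Rightarrow> 'a measure \<Rightarrow> rat \<times> nat \<Rightarrow> bool" where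
  "enc_bit n \<nu> = (\<lambda>(q, k). of_nat (Suc k) \<le> emeasure \<nu> (slice n {..<of_rat q}))"

definition enc :: "'a measure \<Rightarrow> int \<Rightarrow> real" where
  "enc \<nu> n = encode_bits (\<lambda>i. enc_bit n \<nu> (from_nat i))"

definition dec_bit :: "real \<Rightarrow> rat \<Rightarrow> nat \<Rightarrow> bool" where
  "dec_bit t q k = decode_bit (to_nat (q, k)) t"

lemma dec_bit_enc: "dec_bit (enc \<nu> n) q k \<longleftrightarrow> of_nat (Suc k) \<le> emeasure \<nu> (slice n {..<of_rat q})"
  unfolding dec_bit_def enc_def by (simp add: decode_encode_bits enc_bit_def)

text \<open>
  The coordinate of the \<open>k\<close>-th point (from 0, counted from the left) of the configuration coded by \<open>t\<close>;
  it is \<open>\<infinity>\<close> if there are at most \<open>k\<close> points.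
\<close>

definition pt :: "real \<Rightarrow> nat \<Rightarrow> ereal" where
  "pt t k = (INF q. if dec_bit t q k then ereal (of_rat q) else \<infinity>)"

definition hits :: "(int \<Rightarrow> real) \<Rightarrow> (int \<Rightarrow> real set) \<Rightarrow> (int \<times> nat) set" where
  "hits y b = {(n, k). \<bar>pt (y n) k\<bar> \<noteq> \<infinity> \<and> real_of_ereal (pt (y n) k) \<in> b n}"

text \<open>The sum of unit masses at the coded points, each carried from \<open>W\<close> back to
  its translate. Numbers outside the image of \<open>W\<close> under \<open>\<phi>\<close> are
  discarded, so that an arbitrary sequence \<open>y\<close> still decodes to a measure.\<close>

definition dec :: "(int \<Rightarrow> real) \<Rightarrow> 'a measure" where
  "dec y = distr (count_space (hits y (\<lambda>_. \<phi> ` W))) M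
     (\<lambda>(n, k). zpow (- n) (the_inv_into W \<phi> (real_of_ereal (pt (y n) k))))"

text \<open>The coordinates of the points of \<open>B\<close> in the \<open>n\<close>-th translate,
  after carrying them to \<open>W\<close>. This set need not be Borel.\<close>

definition trace :: "'a set \<Rightarrow> int \<Rightarrow> real set" where
  "trace B n = \<phi> ` (pre (- n) B \<inter> W)"

lemma W_space: "x \<in> W \<Longrightarrow> x \<in> space M"
  using sets.sets_into_space[OF W_sets] by blast

lemma sets_dec [simp]: "sets (dec y) = sets M" by (simp add: dec_def)

lemma emeasure_dec:
  assumes B: "B \<in> sets M"
  shows "emeasure (dec y) B = emeasure (count_space UNIV) (hits y (trace B))"
proof -
  let ?H = "hits y (\<lambda>_. \<phi> ` W)"
  let ?l = "\<lambda>(n, k). zpow (- n) (the_inv_into W \<phi> (real_of_ereal (pt (y n) k)))"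
  have m: "?l \<in> count_space ?H \<rightarrow>\<^sub>M M"
    by (auto simp: hits_def the_inv_into_f_f[OF inj] W_space)
  have "emeasure (dec y) B = emeasure (count_space ?H) (?l -` B \<inter> ?H)"
    unfolding dec_def using emeasure_distr[OF m B] by simp
  also have "?l -` B \<inter> ?H = hits y (trace B)"
    by (auto simp: hits_def trace_def the_inv_into_f_f[OF inj] pre_def W_space)
  finally have "emeasure (dec y) B = emeasure (count_space ?H) (hits y (trace B))" .
  moreover have "hits y (trace B) \<subseteq> ?H" by (auto simp: hits_def trace_def)
  ultimately show ?thesis by (simp add: emeasure_count_space)
qed

lemma measurable_pt [measurable]: "(\<lambda>t. pt t k) \<in> borel_measurable borel"
  unfolding pt_def dec_bit_def
  by (intro borel_measurable_INF) measurable

abbreviation codes :: "(int \<Rightarrow> real) measure" where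
  "codes \<equiv> \<Pi>\<^sub>M _\<in>UNIV. borel"

text \<open>The number of hits is an integral of indicators against the counting measure on a
  countable set.\<close>

lemma measurable_hits:
  assumes b: "\<And>n. b n \<in> sets borel"
  shows "(\<lambda>y. emeasure (count_space UNIV) (hits y b)) \<in> borel_measurable codes"
proof -
  have "(\<lambda>y. indicator (hits y b) (n, k) :: ennreal) \<in> borel_measurable codes" for n k
  proof -
    have [measurable]: "b n \<in> sets borel" "(\<lambda>y. y n) \<in> borel_measurable codes" by (auto simp: b)
    have "(\<lambda>y. if \<bar>pt (y n) k\<bar> \<noteq> \<infinity> \<and> real_of_ereal (pt (y n) k) \<in> b n then 1 else 0 :: ennreal) \<in> borel_measurable codes"
      by measurable
    moreover have "indicator (hits y b) (n, k) = (if \<bar>pt (y n) k\<bar> \<noteq> \<infinity> \<and> real_of_ereal (pt (y n) k) \<in> b n then 1 else 0 :: ennreal)" for y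
      by (simp add: hits_def)
    ultimately show ?thesis by (simp only:)
  qed
  note ind = this
  have "(\<lambda>(h, y). indicator (hits y b) h :: ennreal) \<in> borel_measurable (count_space UNIV \<Otimes>\<^sub>M codes)"
  proof (rule measurable_pair_measure_countable1)
    show "(\<lambda>y. case (h, y) of (h, y) \<Rightarrow> (indicator (hits y b) h :: ennreal)) \<in> borel_measurable codes" for h
      using ind[of "fst h" "snd h"] by (simp only: prod.case prod.collapse)
  qed (rule countableI_type)
  from measurable_pair_swap[OF this]
  have "(\<lambda>(y, h). indicator (hits y b) h :: ennreal) \<in> borel_measurable (codes \<Otimes>\<^sub>M count_space UNIV)"
    by (simp only: prod.case)
  then have "(\<lambda>y. \<integral>\<^sup>+h. indicator (hits y b) h \<partial>count_space UNIV) \<in> borel_measurable codes"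
    by (rule sigma_finite_measure.borel_measurable_nn_integral[OF sigma_finite_measure_count_space])
  moreover have "(\<integral>\<^sup>+h. indicator (hits y b) h \<partial>count_space UNIV) = emeasure (count_space UNIV) (hits y b)" for y
    by (rule nn_integral_indicator) simp
  ultimately show ?thesis by (simp only:)
qed

text \<open>The configurations on which decoding inverts encoding. The conditions range over all
  integers \<open>n\<close>, which makes the set stable under the suspension map.\<close>

definition X0 :: "'a measure set" where
  "X0 = {\<nu> \<in> space P. emeasure \<nu> (space M - (\<Union>n. pre n W)) = 0 \<and>
     (\<forall>n q. emeasure \<nu> (slice n {..<of_rat q}) \<in> \<nat>) \<and> (\<forall>n. shift n \<nu> \<in> space P)}"

lemma X0_events: "X0 \<in> events"
proof -
  have "(\<Union>n. pre n W) \<in> sets M" by (intro sets.countable_UN) auto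
  then have 1: "{\<nu> \<in> space P. emeasure \<nu> (space M - (\<Union>n. pre n W)) \<in> {0}} \<in> events"
    by (intro sets_count_in) auto
  have 2: "{\<nu> \<in> space P. \<forall>n q. emeasure \<nu> (slice n {..<of_rat q}) \<in> \<nat>} \<in> events"
    by (intro sets.sets_Collect_countable_All sets_count_in) auto
  have 3: "{\<nu> \<in> space P. \<forall>n. shift n \<nu> \<in> space P} \<in> events"
    by (intro sets.sets_Collect_countable_All sets_shifted_space)
  have "X0 = {\<nu> \<in> space P. emeasure \<nu> (space M - (\<Union>n. pre n W)) \<in> {0}} \<inter>
     {\<nu> \<in> space P. \<forall>n q. emeasure \<nu> (slice n {..<of_rat q}) \<in> \<nat>} \<inter> {\<nu> \<in> space P. \<forall>n. shift n \<nu> \<in> space P}"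
    by (auto simp: X0_def)
  then show ?thesis using 1 2 3 by auto
qed

lemma AE_X0: "AE \<nu> in P. \<nu> \<in> X0"
proof -
  have U: "(\<Union>n. pre n W) \<in> sets M" by (intro sets.countable_UN) auto
  have "E \<inter> (space M - (\<Union>n. pre n W)) \<subseteq> sym_diff E (\<Union>n. pre n W)" by auto
  then have "emeasure M (E \<inter> (space M - (\<Union>n. pre n W))) = 0"
    using EW by (intro emeasure_eq_0[OF null_setsD2 null_setsD1])
  then have 1: "AE \<nu> in P. emeasure \<nu> (space M - (\<Union>n. pre n W)) = 0"
    using U by (intro AE_count_zero) auto
  have 2: "AE \<nu> in P. \<forall>n q. emeasure \<nu> (slice n {..<of_rat q}) \<in> \<nat>"
    using emeasure_slice_lessThan by (intro AE_all_countable[THEN iffD2] allI AE_count_Nats finite_E_Int) auto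
  have 3: "AE \<nu> in P. \<forall>n. shift n \<nu> \<in> space P"
    by (intro AE_all_countable[THEN iffD2] allI AE_good)
  show ?thesis using 1 2 3 AE_space by eventually_elim (simp add: X0_def)
qed

text \<open>Counts at rational half-lines are natural and bounded by the count at a rational above
  \<open>r\<close>, so they attain a maximum below \<open>r\<close>. By continuity from below this
  maximum is the count at \<open>r\<close> itself.\<close>

lemma slice_left_limit:
  assumes \<nu>: "\<nu> \<in> X0"
  shows "\<exists>q. of_rat q < r \<and> emeasure \<nu> (slice n {..<of_rat q}) = emeasure \<nu> (slice n {..<r})"
proof -
  have s: "sets \<nu> = sets M" using \<nu> by (simp add: X0_def sets_config)
  define F where "F t = emeasure \<nu> (slice n {..<t})" for t
  have mono: "F t \<le> F u" if "t \<le> u" for t u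
    unfolding F_def using that by (intro emeasure_mono slice_mono) (auto simp: s)
  have nat: "F (of_rat q) \<in> \<nat>" for q using \<nu> by (auto simp: X0_def F_def)
  obtain q1 where "r < of_rat q1" using of_rat_dense[of r "r + 1"] by auto
  obtain K where K: "F (of_rat q1) = of_nat K" using nat by (auto simp: Nats_def)
  define S where "S = {m::nat. \<exists>q. of_rat q < r \<and> F (of_rat q) = of_nat m}"
  have "S \<subseteq> {..K}"
  proof
    fix m assume "m \<in> S"
    then obtain q where "of_rat q < r" "F (of_rat q) = of_nat m" by (auto simp: S_def)
    then have "of_nat m \<le> (of_nat K :: ennreal)" using mono[of "of_rat q" "of_rat q1"] K \<open>r < of_rat q1\<close> by auto
    then show "m \<in> {..K}" by simp
  qed
  then have fin: "finite S" by (rule finite_subset) auto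
  obtain q0 where "of_rat q0 < r" using of_rat_dense[of "r - 1" r] by auto
  then have ne: "S \<noteq> {}" using nat[of q0] by (auto simp: S_def Nats_def)
  obtain q where q: "of_rat q < r" "F (of_rat q) = of_nat (Max S)" using Max_in[OF fin ne] by (auto simp: S_def)
  have le: "F (of_rat q') \<le> of_nat (Max S)" if q': "of_rat q' < r" for q'
  proof -
    obtain m where "F (of_rat q') = of_nat m" using nat by (auto simp: Nats_def)
    moreover from this have "m \<in> S" using q' by (auto simp: S_def)
    ultimately show ?thesis using Max_ge[OF fin] by simp
  qed
  have "slice n {..<r} = (\<Union>i. slice n {..<r - 1 / real (Suc i)})"
  proof (intro equalityI subsetI)
    fix x assume x: "x \<in> slice n {..<r}"
    then have "0 < r - \<phi> (zpow n x)" by (simp add: slice_def pre_def)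
    then obtain i where "1 / real (Suc i) < r - \<phi> (zpow n x)" by (rule nat_approx_posE)
    then have "x \<in> slice n {..<r - 1 / real (Suc i)}" using x by (simp add: slice_def pre_def)
    then show "x \<in> (\<Union>i. slice n {..<r - 1 / real (Suc i)})" by blast
  next
    fix x assume "x \<in> (\<Union>i. slice n {..<r - 1 / real (Suc i)})"
    then obtain i where i: "zpow n x \<in> W" "x \<in> space M" "\<phi> (zpow n x) < r - 1 / real (Suc i)"
      by (auto simp: slice_def pre_def)
    moreover have "0 < 1 / real (Suc i)" by simp
    ultimately have "\<phi> (zpow n x) < r" by linarith
    then show "x \<in> slice n {..<r}" using i by (auto simp: slice_def pre_def)
  qed
  then have "F r = emeasure \<nu> (\<Union>i. slice n {..<r - 1 / real (Suc i)})" by (simp add: F_def)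
  also have "\<dots> = (SUP i. emeasure \<nu> (slice n {..<r - 1 / real (Suc i)}))"
  proof (intro SUP_emeasure_incseq[symmetric] incseq_SucI)
    fix i
    have "1 / real (Suc (Suc i)) \<le> 1 / real (Suc i)" by (intro divide_left_mono) auto
    then show "slice n {..<r - 1 / real (Suc i)} \<subseteq> slice n {..<r - 1 / real (Suc (Suc i))}"
      by (auto simp: slice_def pre_def simp del: of_nat_Suc)
  qed (auto simp: s)
  also have "\<dots> \<le> of_nat (Max S)"
  proof (rule SUP_least)
    fix i
    have "r - 1 / real (Suc i) < r" by simp
    then obtain q' where "r - 1 / real (Suc i) < of_rat q'" "of_rat q' < r" using of_rat_dense by blast
    then show "emeasure \<nu> (slice n {..<r - 1 / real (Suc i)}) \<le> of_nat (Max S)"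
      using mono[of "r - 1 / real (Suc i)" "of_rat q'"] le[of q'] by (simp add: F_def)
  qed
  finally have "F r = F (of_rat q)" using mono[of "of_rat q" r] q by simp
  then show ?thesis using q(1) by (auto simp: F_def)
qed

text \<open>The infimum is below \<open>r\<close> exactly when some rational below \<open>r\<close>
  has its bit set. Passing from \<open>r\<close> to such a rational uses that the count at
  \<open>r\<close> is already attained there.\<close>

lemma pt_less_iff:
  assumes \<nu>: "\<nu> \<in> X0"
  shows "pt (enc \<nu> n) k < ereal r \<longleftrightarrow> of_nat (Suc k) \<le> emeasure \<nu> (slice n {..<r})"
proof
  have s: "sets \<nu> = sets M" using \<nu> by (simp add: X0_def sets_config)
  assume "pt (enc \<nu> n) k < ereal r"
  then obtain q where "(if dec_bit (enc \<nu> n) q k then ereal (of_rat q) else \<infinity>) < ereal r"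
    unfolding pt_def INF_less_iff by blast
  then have q: "dec_bit (enc \<nu> n) q k" "of_rat q < r" by (auto split: if_splits)
  then have "of_nat (Suc k) \<le> emeasure \<nu> (slice n {..<of_rat q})" by (simp only: dec_bit_enc)
  also have "\<dots> \<le> emeasure \<nu> (slice n {..<r})"
    using q(2) by (intro emeasure_mono slice_mono) (auto simp: s)
  finally show "of_nat (Suc k) \<le> emeasure \<nu> (slice n {..<r})" .
next
  assume le: "of_nat (Suc k) \<le> emeasure \<nu> (slice n {..<r})"
  obtain q where q: "of_rat q < r" "emeasure \<nu> (slice n {..<of_rat q}) = emeasure \<nu> (slice n {..<r})"
    using slice_left_limit[OF \<nu>] by blast
  then have "dec_bit (enc \<nu> n) q k" using le by (simp only: dec_bit_enc)
  then show "pt (enc \<nu> n) k < ereal r"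
    unfolding pt_def INF_less_iff using q(1) by (intro bexI[of _ q]) auto
qed

text \<open>Excludes the value minus infinity, so a value that is not finite always means that the
  point does not exist.\<close>

lemma pt_nonneg:
  assumes \<nu>: "\<nu> \<in> X0"
  shows "0 \<le> pt (enc \<nu> n) k"
proof (rule ccontr)
  assume "\<not> 0 \<le> pt (enc \<nu> n) k"
  then have "pt (enc \<nu> n) k < ereal 0" by (simp add: zero_ereal_def)
  then have "of_nat (Suc k) \<le> emeasure \<nu> (slice n {..<0})" using pt_less_iff[OF \<nu>] by blast
  moreover have "slice n {..<0} = {}" using nonneg by (fastforce simp: slice_def pre_def)
  ultimately show False by simp
qed

definition points :: "'a measure \<Rightarrow> int \<Rightarrow> nat set" where
  "points \<nu> n = {k. \<bar>pt (enc \<nu> n) k\<bar> \<noteq> \<infinity>}"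

definition point_at :: "'a measure \<Rightarrow> int \<Rightarrow> nat \<Rightarrow> real" where
  "point_at \<nu> n k = real_of_ereal (pt (enc \<nu> n) k)"

text \<open>Both sides are measures in \<open>b\<close>, finite and equal on half-lines by the definition of \<open>pt\<close>.\<close>

lemma emeasure_slice_eq_card:
  assumes \<nu>: "\<nu> \<in> X0" and b: "b \<in> sets borel"
  shows "emeasure \<nu> (slice n b) = emeasure (count_space UNIV) {k \<in> points \<nu> n. point_at \<nu> n k \<in> b}"
proof -
  have s: "sets \<nu> = sets M" using \<nu> by (simp add: X0_def sets_config)
  have sp: "space \<nu> = space M" by (rule sets_eq_imp_space_eq[OF s])
  \<comment> \<open>The default value 0 has no effect, since \<open>m\<close> is built from the part
    of \<open>\<nu>\<close> on \<open>pre n W\<close>.\<close>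
  define \<Phi> where "\<Phi> x = (if zpow n x \<in> W then \<phi> (zpow n x) else 0)" for x
  have \<Phi>: "\<Phi> \<in> borel_measurable M"
  proof (rule measurableI)
    fix c :: "real set" assume c: "c \<in> sets borel"
    have "\<Phi> -` c \<inter> space M = slice n c \<union> (if 0 \<in> c then space M - pre n W else {})"
      by (auto simp: \<Phi>_def slice_def pre_def split: if_splits)
    moreover have "slice n c \<in> sets M" "space M - pre n W \<in> sets M"
      using c by (auto intro!: sets.compl_sets)
    ultimately show "\<Phi> -` c \<inter> space M \<in> sets M" by (auto intro!: sets.Un)
  qed auto
  define m where "m = distr (density \<nu> (indicator (pre n W))) borel \<Phi>"
  define c where "c = distr (count_space (points \<nu> n)) borel (point_at \<nu> n)"
  have m: "emeasure m d = emeasure \<nu> (slice n d)" if d: "d \<in> sets borel" for d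
  proof -
    have \<Phi>': "\<Phi> \<in> density \<nu> (indicator (pre n W)) \<rightarrow>\<^sub>M borel" using \<Phi> s by (simp cong: measurable_cong_sets)
    have ms: "\<Phi> -` d \<inter> space M \<in> sets \<nu>" using measurable_sets[OF \<Phi> d] s by simp
    have "emeasure m d = emeasure (density \<nu> (indicator (pre n W))) (\<Phi> -` d \<inter> space M)"
      unfolding m_def using emeasure_distr[OF \<Phi>' d] sp by simp
    also have "\<dots> = emeasure \<nu> (pre n W \<inter> (\<Phi> -` d \<inter> space M))"
    proof -
      have pW: "pre n W \<in> sets \<nu>" by (simp add: s)
      have "emeasure (density \<nu> (indicator (pre n W))) (\<Phi> -` d \<inter> space M)
          = (\<integral>\<^sup>+x. indicator (pre n W) x * indicator (\<Phi> -` d \<inter> space M) x \<partial>\<nu>)"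
        using pW ms by (intro emeasure_density) auto
      also have "\<dots> = (\<integral>\<^sup>+x. indicator (pre n W \<inter> (\<Phi> -` d \<inter> space M)) x \<partial>\<nu>)"
        by (simp only: indicator_inter_arith)
      also have "\<dots> = emeasure \<nu> (pre n W \<inter> (\<Phi> -` d \<inter> space M))"
        by (rule nn_integral_indicator[OF sets.Int[OF pW ms]])
      finally show ?thesis .
    qed
    also have "pre n W \<inter> (\<Phi> -` d \<inter> space M) = slice n d" by (auto simp: \<Phi>_def slice_def pre_def)
    finally show ?thesis .
  qed
  have c: "emeasure c d = emeasure (count_space UNIV) {k \<in> points \<nu> n. point_at \<nu> n k \<in> d}" if d: "d \<in> sets borel" for d
  proof -
    have "emeasure c d = emeasure (count_space (points \<nu> n)) (point_at \<nu> n -` d \<inter> points \<nu> n)"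
      unfolding c_def using d by (subst emeasure_distr) auto
    also have "point_at \<nu> n -` d \<inter> points \<nu> n = {k \<in> points \<nu> n. point_at \<nu> n k \<in> d}" by auto
    finally show ?thesis by (simp add: emeasure_count_space)
  qed
  have F: "emeasure m {..<r} \<noteq> \<infinity> \<and> emeasure m {..<r} = emeasure c {..<r}" for r
  proof -
    obtain q where "emeasure \<nu> (slice n {..<of_rat q}) = emeasure \<nu> (slice n {..<r})"
      using slice_left_limit[OF \<nu>] by blast
    moreover have "emeasure \<nu> (slice n {..<of_rat q}) \<in> \<nat>" using \<nu> unfolding X0_def by blast
    ultimately have "emeasure \<nu> (slice n {..<r}) \<in> \<nat>" by simp
    then obtain K where K: "emeasure \<nu> (slice n {..<r}) = of_nat K" by (auto simp: Nats_def)
    have "{k \<in> points \<nu> n. point_at \<nu> n k \<in> {..<r}} = {k. pt (enc \<nu> n) k < ereal r}"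
    proof (intro equalityI subsetI)
      fix k assume k: "k \<in> {k. pt (enc \<nu> n) k < ereal r}"
      then have "\<bar>pt (enc \<nu> n) k\<bar> \<noteq> \<infinity>" using pt_nonneg[OF \<nu>, of n k] by auto
      then show "k \<in> {k \<in> points \<nu> n. point_at \<nu> n k \<in> {..<r}}"
        using k by (cases "pt (enc \<nu> n) k") (auto simp: points_def point_at_def)
    next
      fix k assume "k \<in> {k \<in> points \<nu> n. point_at \<nu> n k \<in> {..<r}}"
      then show "k \<in> {k. pt (enc \<nu> n) k < ereal r}"
        by (cases "pt (enc \<nu> n) k") (auto simp: points_def point_at_def)
    qed
    \<comment> \<open>With \<open>K\<close> points to the left of \<open>r\<close>, these are the
      points number 0 to \<open>K - 1\<close>.\<close>
    also have "\<dots> = {..<K}" unfolding pt_less_iff[OF \<nu>] K of_nat_le_iff by auto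
    finally have "emeasure c {..<r} = of_nat K" using c[of "{..<r}"] by simp
    then show ?thesis using m[of "{..<r}"] K by simp
  qed
  have "m = c"
  proof (rule measure_eqI_generator_eq[where E = "range lessThan" and \<Omega> = UNIV and A = "\<lambda>i. {..<real i}"])
    show "Int_stable (range (lessThan :: real \<Rightarrow> real set))"
    proof (rule Int_stableI)
      fix U V :: "real set" assume "U \<in> range lessThan" "V \<in> range lessThan"
      then obtain u v where "U = {..<u}" "V = {..<v}" by auto
      then have "U \<inter> V = {..<min u v}" by auto
      then show "U \<inter> V \<in> range lessThan" by blast
    qed
    have "sets borel = sigma_sets UNIV (range (lessThan :: real \<Rightarrow> real set))"
      by (subst borel_Iio) simp
    then show "sets m = sigma_sets UNIV (range lessThan)" "sets c = sigma_sets UNIV (range lessThan)"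
      by (simp_all add: m_def c_def)
    show "(\<Union>i. {..<real i}) = UNIV" using reals_Archimedean2 by auto
    show "emeasure m {..<real i} \<noteq> \<infinity>" for i using F[of "real i"] by blast
  qed (use F in auto)
  then show ?thesis using m[OF b] c[OF b] by simp
qed

text \<open>The previous lemma needs a Borel set, which \<open>trace B n\<close> may fail to be. Its
  intersection with the countable set \<open>Z\<close> of decoded positions is Borel, and
  \<open>\<nu>\<close> has no mass in the translate at coordinates outside \<open>Z\<close>.\<close>

lemma emeasure_Int_pre_eq_card:
  assumes \<nu>: "\<nu> \<in> X0" and B: "B \<in> sets M"
  shows "emeasure \<nu> (B \<inter> pre n W) = emeasure (count_space UNIV) {k \<in> points \<nu> n. point_at \<nu> n k \<in> trace B n}"
proof -
  have s: "sets \<nu> = sets M" using \<nu> by (simp add: X0_def sets_config)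
  define Z where "Z = point_at \<nu> n ` points \<nu> n"
  have Zc: "countable Z" by (simp add: Z_def)
  have Zs: "Z \<in> sets borel" "Z \<inter> trace B n \<in> sets borel"
    using countable_subset[OF Int_lower1 Zc] Zc by (simp_all add: borel_closed sets.countable)
  have "{k \<in> points \<nu> n. point_at \<nu> n k \<in> - Z} = {}" by (auto simp: Z_def)
  then have "emeasure \<nu> (slice n (- Z)) = 0"
    using emeasure_slice_eq_card[OF \<nu>, of "- Z" n] Zs(1) by (simp only: borel_comp) simp
  then have "slice n (- Z) \<in> null_sets \<nu>" using Zs s by (auto simp: null_sets_def)
  then have ae: "AE x in \<nu>. x \<notin> slice n (- Z)" by (rule AE_not_in)
  have "emeasure \<nu> (B \<inter> pre n W) = emeasure \<nu> (slice n (Z \<inter> trace B n))"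
  proof (rule emeasure_eq_AE)
    show "AE x in \<nu>. (x \<in> B \<inter> pre n W) = (x \<in> slice n (Z \<inter> trace B n))"
      using ae
    proof (rule AE_mp, intro AE_I2 impI)
      fix x assume x: "x \<notin> slice n (- Z)" "x \<in> space \<nu>"
      then have xs: "x \<in> space M" using sets_eq_imp_space_eq[OF s] by simp
      show "(x \<in> B \<inter> pre n W) = (x \<in> slice n (Z \<inter> trace B n))"
      proof
        assume a: "x \<in> B \<inter> pre n W"
        then have w: "zpow n x \<in> W" by (auto simp: pre_def)
        then have "\<phi> (zpow n x) \<in> Z" using x xs by (auto simp: slice_def pre_def)
        moreover have "\<phi> (zpow n x) \<in> trace B n" using a w xs by (auto simp: trace_def pre_def)
        ultimately show "x \<in> slice n (Z \<inter> trace B n)" using w xs by (auto simp: slice_def pre_def)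
      next
        assume "x \<in> slice n (Z \<inter> trace B n)"
        then have w: "zpow n x \<in> W" "\<phi> (zpow n x) \<in> trace B n" by (auto simp: slice_def pre_def)
        then obtain z where z: "z \<in> pre (- n) B" "z \<in> W" "\<phi> (zpow n x) = \<phi> z" by (auto simp: trace_def)
        then have "zpow n x = z" using inj w by (auto simp: inj_on_def)
        then have "x \<in> B" using z xs by (auto simp: pre_def)
        then show "x \<in> B \<inter> pre n W" using w xs by (auto simp: pre_def)
      qed
    qed
    show "B \<inter> pre n W \<in> sets \<nu>" unfolding s by (intro sets.Int sets_pre W_sets B)
    show "slice n (Z \<inter> trace B n) \<in> sets \<nu>" unfolding s by (intro slice_in_sets Zs)
  qed
  also have "\<dots> = emeasure (count_space UNIV) {k \<in> points \<nu> n. point_at \<nu> n k \<in> Z \<inter> trace B n}"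
    by (rule emeasure_slice_eq_card[OF \<nu> Zs(2)])
  also have "{k \<in> points \<nu> n. point_at \<nu> n k \<in> Z \<inter> trace B n} = {k \<in> points \<nu> n. point_at \<nu> n k \<in> trace B n}"
    by (auto simp: Z_def)
  finally show ?thesis .
qed

lemma card_hits_enc:
  "emeasure (count_space UNIV) (hits (enc \<nu>) b)
    = (\<integral>\<^sup>+n. emeasure (count_space UNIV) {k \<in> points \<nu> n. point_at \<nu> n k \<in> b n} \<partial>count_space UNIV)"
proof -
  have "emeasure (count_space UNIV) (hits (enc \<nu>) b) = (\<integral>\<^sup>+p. indicator (hits (enc \<nu>) b) p \<partial>count_space UNIV)"
    by simp
  also have "\<dots> = (\<integral>\<^sup>+n. \<integral>\<^sup>+k. indicator (hits (enc \<nu>) b) (n, k) \<partial>count_space UNIV \<partial>count_space UNIV)"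
    by (rule nn_integral_fst_count_space[symmetric])
  also have "\<dots> = (\<integral>\<^sup>+n. \<integral>\<^sup>+k. indicator {k \<in> points \<nu> n. point_at \<nu> n k \<in> b n} k \<partial>count_space UNIV \<partial>count_space UNIV)"
    by (intro nn_integral_cong) (auto simp: hits_def points_def point_at_def indicator_def)
  finally show ?thesis by simp
qed

text \<open>The translates of \<open>W\<close> are disjoint and carry all of \<open>\<nu>\<close>,
  so the counts in the single translates add up to the measure.\<close>

lemma dec_enc:
  assumes \<nu>: "\<nu> \<in> X0"
  shows "dec (enc \<nu>) = \<nu>"
proof (rule measure_eqI)
  have s: "sets \<nu> = sets M" using \<nu> by (simp add: X0_def sets_config)
  show "sets (dec (enc \<nu>)) = sets \<nu>" by (simp add: s)
  fix B assume "B \<in> sets (dec (enc \<nu>))"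
  then have B: "B \<in> sets M" by simp
  have U: "(\<Union>n. pre n W) \<in> sets M" by (intro sets.countable_UN) auto
  have "space M - (\<Union>n. pre n W) \<in> null_sets \<nu>"
    using \<nu> U s by (auto simp: X0_def null_sets_def)
  then have ae: "AE x in \<nu>. x \<notin> space M - (\<Union>n. pre n W)" by (rule AE_not_in)
  have "emeasure \<nu> B = emeasure \<nu> (\<Union>n. B \<inter> pre n W)"
  proof (rule emeasure_eq_AE)
    show "AE x in \<nu>. (x \<in> B) = (x \<in> (\<Union>n. B \<inter> pre n W))"
      using ae by (rule AE_mp) (use sets.sets_into_space[OF B] in \<open>auto intro!: AE_I2\<close>)
    show "(\<Union>n. B \<inter> pre n W) \<in> sets \<nu>" unfolding s using B by (intro sets.countable_UN) auto
  qed (use B s in auto)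
  also have "\<dots> = (\<integral>\<^sup>+n. emeasure \<nu> (B \<inter> pre n W) \<partial>count_space UNIV)"
    using B s W_disjoint by (intro emeasure_UN_countable) (auto simp: disjoint_family_on_def)
  also have "\<dots> = emeasure (dec (enc \<nu>)) B"
    unfolding emeasure_dec[OF B] card_hits_enc by (simp add: emeasure_Int_pre_eq_card[OF \<nu> B])
  finally show "emeasure (dec (enc \<nu>)) B = emeasure \<nu> B" ..
qed

section \<open>The law of the codes\<close>

lemma measurable_enc_coordinate_observed: "(\<lambda>\<nu>. enc \<nu> n) \<in> borel_measurable (sigma (space P) (observed (pre n W)))"
  unfolding enc_def
proof (rule measurable_encode_bits)
  fix i
  obtain q k where qk: "(from_nat i :: rat \<times> nat) = (q, k)" by fastforce
  have Pow: "observed (pre n W) \<subseteq> Pow (space P)" using observed_events sets.sets_into_space by blast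
  have "cyl {slice n {..<of_rat q}} (\<lambda>_. {of_nat (Suc k)..}) \<in> cyls (pre n W)"
    using emeasure_slice_lessThan slice_subset by (intro cylsI) auto
  then have "cyl {slice n {..<of_rat q}} (\<lambda>_. {of_nat (Suc k)..}) \<in> observed (pre n W)"
    unfolding observed_def by (rule sigma_sets.Basic)
  moreover have "{\<nu> \<in> space (sigma (space P) (observed (pre n W))). enc_bit n \<nu> (from_nat i)}
      = cyl {slice n {..<of_rat q}} (\<lambda>_. {of_nat (Suc k)..})"
    using Pow by (auto simp: enc_bit_def qk cyl_def)
  ultimately show "Measurable.pred (sigma (space P) (observed (pre n W))) (\<lambda>\<nu>. enc_bit n \<nu> (from_nat i))"
    unfolding pred_def using Pow by (auto intro: sigma_sets.Basic)
qed

lemma vimage_enc_coordinate_observed: "V \<in> sets borel \<Longrightarrow> (\<lambda>\<nu>. enc \<nu> n) -` V \<inter> space P \<in> observed (pre n W)"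
proof -
  assume V: "V \<in> sets borel"
  have Pow: "observed (pre n W) \<subseteq> Pow (space P)" using observed_events sets.sets_into_space by blast
  have "sigma_sets (space P) (observed (pre n W)) = observed (pre n W)"
    by (rule sigma_algebra.sigma_sets_eq[OF observed_sigma_algebra])
  then show ?thesis using measurable_sets[OF measurable_enc_coordinate_observed V, of n] Pow by simp
qed

lemma measurable_enc_coordinate [measurable]: "(\<lambda>\<nu>. enc \<nu> n) \<in> borel_measurable P"
  by (rule measurableI) (use vimage_enc_coordinate_observed observed_events in auto)

lemma measurable_enc: "enc \<in> P \<rightarrow>\<^sub>M codes"
  by (rule measurable_PiM_single') (auto simp: space_PiM)

lemma enc_shift: "\<nu> \<in> space P \<Longrightarrow> enc (shift m \<nu>) n = enc \<nu> (n + m)"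
  unfolding enc_def enc_bit_def by (simp add: emeasure_shift_slice[OF sets_config])

lemma distr_enc:
  "distr P codes enc = (\<Pi>\<^sub>M _\<in>UNIV. distr P borel (\<lambda>\<nu>. enc \<nu> 0))"
proof -
  have ind: "indep_vars (\<lambda>_. borel) (\<lambda>n \<nu>. enc \<nu> n) UNIV"
    unfolding indep_vars_def2
  proof (intro conjI ballI)
    show "indep_sets (\<lambda>n. {(\<lambda>\<nu>. enc \<nu> n) -` V \<inter> space P |V. V \<in> sets borel}) UNIV"
      by (rule indep_sets_mono_sets[OF observed_indep[OF W_disjoint]]) (use vimage_enc_coordinate_observed in auto)
  qed simp
  \<comment> \<open>Coordinate \<open>n\<close> of a code is coordinate 0 of the code of the
    configuration shifted by \<open>n\<close>, and the shift preserves \<open>P\<close>.\<close>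
  have marg: "distr P borel (\<lambda>\<nu>. enc \<nu> n) = distr P borel (\<lambda>\<nu>. enc \<nu> 0)" for n
  proof -
    have "distr P borel (\<lambda>\<nu>. enc \<nu> 0) = distr (distr P P (safe_shift n)) borel (\<lambda>\<nu>. enc \<nu> 0)"
      by (simp add: distr_safe_shift)
    also have "\<dots> = distr P borel ((\<lambda>\<nu>. enc \<nu> 0) \<circ> safe_shift n)"
      by (rule distr_distr[OF measurable_enc_coordinate measurable_safe_shift])
    also have "\<dots> = distr P borel (\<lambda>\<nu>. enc \<nu> n)"
    proof (rule distr_cong_AE)
      show "AE \<nu> in P. ((\<lambda>\<nu>. enc \<nu> 0) \<circ> safe_shift n) \<nu> = enc \<nu> n"
        using AE_good[of n] AE_space by eventually_elim (simp add: safe_shift_def enc_shift)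
      show "(\<lambda>\<nu>. enc \<nu> 0) \<circ> safe_shift n \<in> borel_measurable P"
        by (rule measurable_comp[OF measurable_safe_shift measurable_enc_coordinate])
    qed auto
    finally show ?thesis ..
  qed
  have "distr P codes (\<lambda>\<nu>. \<lambda>n\<in>UNIV. enc \<nu> n) = (\<Pi>\<^sub>M n\<in>UNIV. distr P borel (\<lambda>\<nu>. enc \<nu> n))"
    by (rule iffD1[OF indep_vars_iff_distr_eq_PiM' ind]) auto
  moreover have "(\<lambda>\<nu>. \<lambda>n\<in>UNIV. enc \<nu> n) = enc" by (simp add: fun_eq_iff)
  moreover have "(\<Pi>\<^sub>M n\<in>UNIV. distr P borel (\<lambda>\<nu>. enc \<nu> n)) = (\<Pi>\<^sub>M _\<in>UNIV. distr P borel (\<lambda>\<nu>. enc \<nu> 0))"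
    by (intro PiM_cong refl marg)
  ultimately show ?thesis by (simp only:)
qed

section \<open>The decoder as a measurable map\<close>

definition Q :: "(int \<Rightarrow> real) measure" where "Q = distr P codes enc"

text \<open>Each \<open>trace B n\<close> lies between Borel sets \<open>b0 n\<close> and
  \<open>b1 n\<close>. Their difference corresponds to a null subset of the translate, where almost
  surely there is no point, so the decoded count agrees almost everywhere with the measurable number
  of hits of \<open>b0\<close>.\<close>

lemma measurable_emeasure_dec:
  assumes B: "B \<in> sets M"
  shows "(\<lambda>y. emeasure (dec y) B) \<in> borel_measurable (completion Q)"
proof -
  have "\<exists>b0 b1. b0 \<in> sets borel \<and> b1 \<in> sets borel \<and> b0 \<subseteq> trace B n \<and> trace B n \<subseteq> b1 \<and>
    {x \<in> W. \<phi> x \<in> b1 - b0} \<in> null_sets M" for n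
    unfolding trace_def using B by (intro sandwich) auto
  then have "\<exists>b0 b1. \<forall>n. b0 n \<in> sets borel \<and> b1 n \<in> sets borel \<and> b0 n \<subseteq> trace B n \<and> trace B n \<subseteq> b1 n \<and>
    {x \<in> W. \<phi> x \<in> b1 n - b0 n} \<in> null_sets M"
    by (rule choice2)
  then obtain b0 b1 where "\<forall>n. b0 n \<in> sets borel \<and> b1 n \<in> sets borel \<and> b0 n \<subseteq> trace B n \<and> trace B n \<subseteq> b1 n \<and>
    {x \<in> W. \<phi> x \<in> b1 n - b0 n} \<in> null_sets M"
    by (elim exE)
  then have b: "\<And>n. b0 n \<in> sets borel" "\<And>n. b1 n \<in> sets borel" "\<And>n. b0 n \<subseteq> trace B n" "\<And>n. trace B n \<subseteq> b1 n"
    "\<And>n. {x \<in> W. \<phi> x \<in> b1 n - b0 n} \<in> null_sets M"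
    by blast+
  let ?d = "\<lambda>n. b1 n - b0 n"
  have ds: "?d n \<in> sets borel" for n using b by auto
  have "AE \<nu> in P. \<forall>n. emeasure \<nu> (slice n (?d n)) = 0"
  proof (intro AE_all_countable[THEN iffD2] allI AE_count_zero)
    fix n
    show "slice n (?d n) \<in> sets M" using ds by simp
    have "slice n (?d n) \<in> null_sets M" unfolding slice_def by (rule null_sets_pre[OF b(5)])
    then show "emeasure M (E \<inter> slice n (?d n)) = 0"
      by (intro emeasure_eq_0[OF null_setsD2 null_setsD1]) blast+
  qed
  then have "AE \<nu> in P. emeasure (count_space UNIV) (hits (enc \<nu>) ?d) = 0"
    using AE_X0
  proof eventually_elim
    fix \<nu> assume z: "\<forall>n. emeasure \<nu> (slice n (?d n)) = 0" and \<nu>: "\<nu> \<in> X0"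
    have "emeasure (count_space UNIV) {k \<in> points \<nu> n. point_at \<nu> n k \<in> ?d n} = 0" for n
      using emeasure_slice_eq_card[OF \<nu> ds, of n n] z by simp
    then show "emeasure (count_space UNIV) (hits (enc \<nu>) ?d) = 0"
      unfolding card_hits_enc by (simp only: nn_integral_const mult_zero_left)
  qed
  moreover have "{y \<in> space codes. emeasure (count_space UNIV) (hits y ?d) = 0} \<in> sets codes"
    using measurable_sets[OF measurable_hits[OF ds], of "{0}"] by (simp add: vimage_def Int_def conj_commute)
  ultimately have ae: "AE y in Q. emeasure (count_space UNIV) (hits y ?d) = 0"
    unfolding Q_def by (subst AE_distr_iff[OF measurable_enc]) auto
  show ?thesis
  proof (rule measurable_completion_AE)
    show "(\<lambda>y. emeasure (count_space UNIV) (hits y b0)) \<in> borel_measurable Q"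
      using measurable_hits[OF b(1)] by (simp add: Q_def)
    show "AE y in Q. emeasure (count_space UNIV) (hits y b0) = emeasure (dec y) B"
      using ae
    proof eventually_elim
      fix y assume "emeasure (count_space UNIV) (hits y ?d) = 0"
      then have "hits y ?d = {}" by (simp add: emeasure_count_space split: if_splits)
      have "h \<in> hits y b0 \<longleftrightarrow> h \<in> hits y (trace B)" for h
      proof (cases h)
        case (Pair n k)
        have mem: "(n, k) \<in> hits y c \<longleftrightarrow> \<bar>pt (y n) k\<bar> \<noteq> \<infinity> \<and> real_of_ereal (pt (y n) k) \<in> c n" for c
          by (simp add: hits_def)
        have "(n, k) \<notin> hits y ?d" using \<open>hits y ?d = {}\<close> by simp
        then have no: "\<not> (\<bar>pt (y n) k\<bar> \<noteq> \<infinity> \<and> real_of_ereal (pt (y n) k) \<in> b1 n - b0 n)"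
          unfolding mem .
        define v where "v = real_of_ereal (pt (y n) k)"
        have "v \<in> b0 n \<longrightarrow> v \<in> trace B n" "v \<in> trace B n \<longrightarrow> v \<in> b1 n"
          using subsetD[OF b(3)] subsetD[OF b(4)] by simp_all
        then show ?thesis
          using no unfolding Pair mem v_def[symmetric] Diff_iff by argo
      qed
      then have "hits y b0 = hits y (trace B)" by (rule set_eqI)
      then show "emeasure (count_space UNIV) (hits y b0) = emeasure (dec y) B"
        using emeasure_dec[OF B] by simp
    qed
  qed simp
qed

text \<open>An arbitrary sequence may decode to a measure that is not integer valued on some
  \<open>A j\<close>; the empty configuration is then the default.\<close>

definition safe_dec :: "(int \<Rightarrow> real) \<Rightarrow> 'a measure" where
  "safe_dec y = (if dec y \<in> space P then dec y else null_measure M)"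

lemma measurable_safe_dec: "safe_dec \<in> completion Q \<rightarrow>\<^sub>M P"
proof (rule measurable_into_P)
  show "safe_dec y \<in> configurations M A" for y using null_measure_in_P by (simp add: safe_dec_def space_P)
  have "{y \<in> space (completion Q). emeasure (dec y) (A j) \<in> \<nat>} \<in> sets (completion Q)" for j
    using measurable_sets[OF measurable_emeasure_dec[OF A_sets] sets_Nats_ennreal]
    by (simp add: vimage_def Int_def conj_commute)
  then have "{y \<in> space (completion Q). \<forall>j. emeasure (dec y) (A j) \<in> \<nat>} \<in> sets (completion Q)"
    by (intro sets.sets_Collect_countable_All)
  then have c: "{y \<in> space (completion Q). dec y \<in> space P} \<in> sets (completion Q)"
    by (simp add: space_P_iff[OF sets_dec])
  fix B assume B: "B \<in> sets M"
  have "(\<lambda>y. if dec y \<in> space P then emeasure (dec y) B else 0) \<in> borel_measurable (completion Q)"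
    using c measurable_emeasure_dec[OF B] by (intro measurable_If) auto
  moreover have "(\<lambda>y. if dec y \<in> space P then emeasure (dec y) B else 0) = (\<lambda>y. emeasure (safe_dec y) B)"
    by (auto simp: safe_dec_def)
  ultimately show "(\<lambda>y. emeasure (safe_dec y) B) \<in> borel_measurable (completion Q)" by simp
qed

text \<open>\<open>safe_dec\<close> is a left inverse of \<open>enc\<close> on \<open>X0\<close>, so
  \<open>mod0_isomorphism_retract\<close> gives the isomorphism. Since \<open>T\<close> pulls
  \<open>slice n b\<close> back to \<open>slice (n + 1) b\<close>, the suspension map becomes the
  shift of the codes.\<close>

lemma bernoulli_suspension: "bernoulli P (suspension_map M T)"
proof -
  define q where "q = distr P borel (\<lambda>\<nu>. enc \<nu> 0)"
  have Qq: "Q = (\<Pi>\<^sub>M _\<in>UNIV. q)" unfolding Q_def q_def by (rule distr_enc)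
  have "prob_space q" unfolding q_def by (rule prob_space_distr) simp
  moreover have "sets q = sets borel" by (simp add: q_def)
  moreover have "isomorphic_systems P (suspension_map M T) Q (\<lambda>x n. x (n + 1))"
    unfolding isomorphic_systems_def
  proof (intro exI conjI ballI)
    show "mod0_isomorphism P Q X0 {y \<in> space codes. safe_dec y \<in> X0 \<and> enc (safe_dec y) = y} enc"
      unfolding Q_def
    proof (rule mod0_isomorphism_retract[OF measurable_enc X0_events])
      have eq: "space P - X0 = {\<nu> \<in> space P. \<not> (\<nu> \<in> X0)}" by blast
      have "{\<nu> \<in> space P. \<not> (\<nu> \<in> X0)} \<in> events" using sets.compl_sets[OF X0_events] unfolding eq .
      from iffD1[OF AE_iff_null[OF this] AE_X0] show "space P - X0 \<in> null_sets P" unfolding eq .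
      show "safe_dec \<in> completion (distr P codes enc) \<rightarrow>\<^sub>M P"
        using measurable_safe_dec by (simp add: Q_def)
      show "safe_dec (enc \<nu>) = \<nu>" if \<nu>: "\<nu> \<in> X0" for \<nu>
      proof -
        have "\<nu> \<in> space P" using \<nu> unfolding X0_def by blast
        then show ?thesis unfolding safe_dec_def dec_enc[OF \<nu>] by (rule if_P)
      qed
      \<comment> \<open>Equality of two codes is a countable family of equalities of real
        coordinates.\<close>
      have "{y \<in> space (completion Q). enc (safe_dec y) n = y n} \<in> sets (completion Q)" for n
      proof -
        have "(\<lambda>y. enc (safe_dec y) n) \<in> borel_measurable (completion Q)"
          by (rule measurable_compose[OF measurable_safe_dec measurable_enc_coordinate])
        moreover have "(\<lambda>y. y n) \<in> borel_measurable (completion Q)"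
          by (rule measurable_completion) (simp add: Q_def)
        ultimately show ?thesis by measurable
      qed
      then have "{y \<in> space (completion Q). \<forall>n. enc (safe_dec y) n = y n} \<in> sets (completion Q)"
        by (intro sets.sets_Collect_countable_All)
      then show "{y \<in> space codes. enc (safe_dec y) = y} \<in> sets (completion (distr P codes enc))"
        by (simp add: Q_def fun_eq_iff)
    qed
    fix \<nu> assume \<nu>: "\<nu> \<in> X0"
    then have \<nu>P: "\<nu> \<in> space P" by (simp add: X0_def)
    have s: "sets \<nu> = sets M" by (rule sets_config[OF \<nu>P])
    show "suspension_map M T \<nu> \<in> X0"
    proof -
      have U: "(\<Union>n. pre n W) \<in> sets M" by (intro sets.countable_UN) auto
      have "pre 1 (space M - (\<Union>n. pre n W)) = space M - (\<Union>n. pre n W)"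
      proof -
        have "(\<Union>n. pre (1 + n) W) = (\<Union>n. pre n W)"
        proof (intro equalityI subsetI)
          fix x assume "x \<in> (\<Union>n. pre n W)"
          then obtain n where "x \<in> pre n W" by auto
          then have "x \<in> pre (1 + (n - 1)) W" by simp
          then show "x \<in> (\<Union>n. pre (1 + n) W)" by blast
        qed auto
        then show ?thesis by (simp add: pre_Diff pre_UN pre_pre)
      qed
      then have "emeasure (shift 1 \<nu>) (space M - (\<Union>n. pre n W)) = 0"
        using \<nu> U by (simp add: emeasure_shift[OF s] X0_def)
      moreover have "emeasure (shift 1 \<nu>) (slice n {..<of_rat q}) \<in> \<nat>" for n q
      proof -
        have "emeasure (shift 1 \<nu>) (slice n {..<of_rat q}) = emeasure \<nu> (slice (1 + n) {..<of_rat q})"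
          by (simp add: emeasure_shift_slice[OF s] add.commute)
        then show ?thesis using \<nu> by (simp add: X0_def)
      qed
      moreover have "shift n (shift 1 \<nu>) \<in> space P" for n
        using \<nu> by (simp add: shift_shift[OF s] X0_def)
      moreover have "shift 1 \<nu> \<in> space P" using \<nu> by (simp add: X0_def)
      ultimately show ?thesis by (simp add: suspension_map_eq X0_def)
    qed
    show "enc (suspension_map M T \<nu>) = (\<lambda>n. enc \<nu> (n + 1))"
      by (simp add: fun_eq_iff suspension_map_eq enc_shift[OF \<nu>P])
  qed
  ultimately show ?thesis unfolding bernoulli_def Qq by blast
qed

end

section \<open>The canonical decomposition\<close>

lemma poisson_suspensionI:
  assumes T: "mpt M T" and A: "finite_measure_partition M A" and P: "poisson_measure M A (measure_on M E) P"
    and E: "mpt.invariant M T E"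
  shows "poisson_suspension M T A E P"
proof -
  interpret mpt M T by fact
  show ?thesis
    by (intro poisson_suspension.intro T poisson_law.intro poisson_suspension_axioms.intro A P E invariantD(1)[OF E])
qed

context mpt
begin

text \<open>Up to a null set \<open>D\<close> is the union of all translates of one wandering set,
  and this union is exactly invariant.\<close>

lemma invariant_measurable_union:
  assumes "is_measurable_union M {B. wandering M T B} D"
  shows "invariant D"
proof -
  obtain W where W: "wandering M T W" "sym_diff D (\<Union>n. pre n W) \<in> null_sets M"
    using ex_wandering_generator[OF assms] .
  have Ws: "(\<Union>n. pre n W) \<in> sets M" using W(1) by (intro sets.countable_UN) (auto simp: wandering_iff)
  have "pre 1 (\<Union>n. pre n W) = (\<Union>n. pre n W)"
  proof (intro equalityI subsetI)
    fix x assume "x \<in> (\<Union>n. pre n W)"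
    then obtain n where "x \<in> pre n W" by auto
    then have "x \<in> pre (1 + (n - 1)) W" by simp
    then show "x \<in> pre 1 (\<Union>n. pre n W)" unfolding pre_UN pre_pre by blast
  qed (unfold pre_UN pre_pre, blast)
  then have "invariant (\<Union>n. pre n W)" using Ws by (intro invariantI) auto
  then show ?thesis
    by (rule invariant_cong_null) (use W(2) assms in \<open>simp_all add: is_measurable_union_def Un_commute\<close>)
qed

end

theorem theorem4p8:
  fixes M :: "'a measure" and T :: "'a \<Rightarrow> 'a" and A :: "nat \<Rightarrow> 'a set"
    and D C Pos Nul N0 Np :: "'a set"
    and \<mu>_B \<mu>_m \<mu>_wm \<mu>_ne :: "'a measure"
    and P_B P_m P_wm P_ne :: "'a measure measure"
  assumes "dynamical_system M T"
    and "finite_measure_partition M A"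
    and "canonical_decomposition M T D C Pos Nul N0 Np"
    and "\<mu>_B = measure_on M D"
    and "\<mu>_m = measure_on M (N0 \<inter> C)"
    and "\<mu>_wm = measure_on M (Np \<inter> Nul)"
    and "\<mu>_ne = measure_on M Pos"
    and "poisson_measure M A \<mu>_B P_B"
    and "poisson_measure M A \<mu>_m P_m"
    and "poisson_measure M A \<mu>_wm P_wm"
    and "poisson_measure M A \<mu>_ne P_ne"
  shows "(\<mu>_ne \<noteq> null_measure M \<longrightarrow> \<not> ergodic P_ne (suspension_map M T)) \<and>
    (weakly_mixing P_wm (suspension_map M T) \<and>
      (\<mu>_wm \<noteq> null_measure M \<longrightarrow> \<not> mixing P_wm (suspension_map M T))) \<and>
    mixing_of_all_orders P_m (suspension_map M T) \<and>
    bernoulli P_B (suspension_map M T)"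
proof -
  have mpt: "mpt M T" by (rule dynamical_system_imp_mpt[OF assms(1)])
  interpret mpt M T by fact
  note A = assms(2)
  have D: "is_measurable_union M {B. wandering M T B} D" and C: "C = space M - D"
    and PN: "invariant_partition M T Pos Nul"
    and Pos: "emeasure M Pos = 0 \<or> (\<exists>\<nu>. invariant_prob M T \<nu> \<and> equivalent_measures \<nu> (measure_on M Pos))"
    and Nul: "\<not> (\<exists>\<nu>. invariant_prob M T \<nu> \<and> absolutely_continuous (measure_on M Nul) \<nu>)"
    and N: "invariant_partition M T N0 Np"
    and N0: "\<And>B. B \<in> sets M \<Longrightarrow> B \<subseteq> N0 \<Longrightarrow> 0 < emeasure M B \<Longrightarrow> emeasure M B < \<infinity> \<Longrightarrow>
        (\<lambda>k. emeasure M (B \<inter> iterate_set M T (- int k) B)) \<longlonglongrightarrow> 0"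
    and Np: "\<And>B. B \<in> sets M \<Longrightarrow> B \<subseteq> Np \<Longrightarrow> 0 < emeasure M B \<Longrightarrow>
        0 < limsup (\<lambda>k. emeasure M (B \<inter> iterate_set M T (- int k) B))"
    using assms(3) unfolding canonical_decomposition_def by blast+
  have inv: "invariant Pos" "invariant Nul" "invariant N0" "invariant Np" "invariant D"
    using PN N invariant_measurable_union[OF D] by (simp_all add: invariant_partition_def invariant_set_iff)
  have invC: "invariant C" unfolding C by (rule invariant_compl[OF inv(5)])
  have null_measure: "measure_on M F = null_measure M" if "F \<in> sets M" "emeasure M F = 0" for F
  proof (rule measure_eqI)
    fix B assume "B \<in> sets (measure_on M F)"
    then have "emeasure (measure_on M F) B = emeasure M (F \<inter> B)" using that by (simp add: emeasure_measure_on)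
    also have "\<dots> = 0" by (rule emeasure_eq_0[OF that]) auto
    finally show "emeasure (measure_on M F) B = emeasure (null_measure M) B" by simp
  qed simp
  have iter: "iterate_set M T (- int k) B = pre (int k) B" if "B \<in> sets M" for k B
    using iterate_set_eq_pre[OF sets.sets_into_space[OF that]] by simp
  \<comment> \<open>Overlaps of \<open>G\<close> under the restricted intensity are overlaps of the
    subset \<open>F \<inter> G\<close> of the invariant part, the form in which the decomposition
    controls them.\<close>
  have swap: "measure M ((F \<inter> G) \<inter> pre k (F \<inter> G)) = measure M (F \<inter> (G \<inter> pre k G))"
    if F: "invariant F" and G: "G \<in> sets M" for F G k
  proof (rule measure_eq_AE)
    have "AE x in M. x \<notin> sym_diff (pre k F) F" by (rule AE_not_in[OF invariantD(2)[OF F]])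
    then show "AE x in M. (x \<in> (F \<inter> G) \<inter> pre k (F \<inter> G)) = (x \<in> F \<inter> (G \<inter> pre k G))"
      by (rule AE_mp) (auto simp: pre_Int intro!: AE_I2)
  qed (intro sets.Int sets_pre invariantD(1)[OF F] G)+
  have ne: "\<not> ergodic P_ne (suspension_map M T)" if nz: "\<mu>_ne \<noteq> null_measure M"
  proof -
    interpret poisson_suspension M T A Pos P_ne
      by (rule poisson_suspensionI[OF mpt A _ inv(1)]) (use assms(7,11) in simp)
    have "emeasure M Pos \<noteq> 0" using nz null_measure[OF E] assms(7) by auto
    then show ?thesis using Pos not_ergodic_if_invariant_prob by blast
  qed
  have invwm: "invariant (Np \<inter> Nul)" by (rule invariant_Int[OF inv(4,2)])
  interpret wm: poisson_suspension M T A "Np \<inter> Nul" P_wm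
    by (rule poisson_suspensionI[OF mpt A _ invwm]) (use assms(6,10) in simp)
  have wmix: "weakly_mixing P_wm (suspension_map M T)"
  proof (rule wm.weakly_mixing_if_cesaro)
    fix G assume G: "G \<in> sets M" "emeasure M G < \<infinity>"
    let ?B = "(Np \<inter> Nul) \<inter> G"
    have "(\<lambda>n. (\<Sum>k<n. measure M (?B \<inter> pre (int k) ?B)) / real n) \<longlonglongrightarrow> 0"
      by (rule null_part_cesaro[OF inv(2) Nul _ _ wm.finite_E_Int[OF G(2,1)]]) (use wm.E G in auto)
    then show "(\<lambda>n. (\<Sum>k<n. wm.mean (G \<inter> pre (int k) G)) / real n) \<longlonglongrightarrow> 0"
      by (simp add: swap[OF invwm G(1)] wm.mean_def)
  qed
  have nmix: "\<not> mixing P_wm (suspension_map M T)" if nz: "\<mu>_wm \<noteq> null_measure M"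
  proof -
    have "emeasure M (Np \<inter> Nul) \<noteq> 0" using nz null_measure[OF wm.E] assms(6) by auto
    \<comment> \<open>The part may have infinite measure; one of its pieces inside the sets
      \<open>A n\<close> has positive and finite measure.\<close>
    moreover have "emeasure M (Np \<inter> Nul) = (\<Sum>n. emeasure M ((Np \<inter> Nul) \<inter> A n))"
      by (rule wm.emeasure_eq_suminf[OF refl wm.E])
    ultimately have "(\<Sum>n. emeasure M ((Np \<inter> Nul) \<inter> A n)) \<noteq> 0" by simp
    moreover have "(\<Sum>n. emeasure M ((Np \<inter> Nul) \<inter> A n)) = 0"
      if "\<forall>n. emeasure M ((Np \<inter> Nul) \<inter> A n) = 0"
      using that by (simp only: suminf_zero)
    ultimately obtain n where n: "emeasure M ((Np \<inter> Nul) \<inter> A n) \<noteq> 0" by blast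
    define B where "B = (Np \<inter> Nul) \<inter> A n"
    have B: "B \<in> sets M" "B \<subseteq> Np \<inter> Nul" using wm.E by (auto simp: B_def)
    have Bfin: "emeasure M B < \<infinity>" unfolding B_def by (rule wm.finite_Int_A[OF wm.E])
    have pos: "0 < limsup (\<lambda>k. emeasure M (B \<inter> pre (int k) B))"
      using Np[OF B(1)] B n iter[OF B(1)] by (simp add: B_def zero_less_iff_neq_zero)
    show ?thesis
    proof (rule wm.not_mixing_if_recurrent[OF B(1) Bfin])
      show "\<not> (\<lambda>k. wm.mean (B \<inter> pre (int k) B)) \<longlonglongrightarrow> 0"
      proof
        assume lim: "(\<lambda>k. wm.mean (B \<inter> pre (int k) B)) \<longlonglongrightarrow> 0"
        have "emeasure M (B \<inter> pre (int k) B) = ennreal (wm.mean (B \<inter> pre (int k) B))" for k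
        proof -
          have "(Np \<inter> Nul) \<inter> (B \<inter> pre (int k) B) = B \<inter> pre (int k) B" using B by auto
          moreover have "emeasure M (B \<inter> pre (int k) B) < \<infinity>"
            by (rule le_less_trans[OF emeasure_mono Bfin]) (use B in auto)
          ultimately show ?thesis by (simp add: wm.mean_def emeasure_eq_ennreal_measure)
        qed
        then have "(\<lambda>k. emeasure M (B \<inter> pre (int k) B)) \<longlonglongrightarrow> ennreal 0"
          using tendsto_ennrealI[OF lim] by (simp only:)
        then have "limsup (\<lambda>k. emeasure M (B \<inter> pre (int k) B)) = 0"
          using lim_imp_Limsup[OF sequentially_bot] by fastforce
        then show False using pos by simp
      qed
    qed
  qed
  have invm: "invariant (N0 \<inter> C)" by (rule invariant_Int[OF inv(3) invC])
  interpret m: poisson_suspension M T A "N0 \<inter> C" P_m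
    by (rule poisson_suspensionI[OF mpt A _ invm]) (use assms(5,9) in simp)
  have mixm: "mixing_of_all_orders P_m (suspension_map M T)"
  proof (rule m.mixing_of_all_orders_if)
    fix G assume G: "G \<in> sets M" "emeasure M G < \<infinity>"
    let ?B = "(N0 \<inter> C) \<inter> G"
    have B: "?B \<in> sets M" using m.E G by auto
    have Bfin: "emeasure M ?B < \<infinity>" by (rule m.finite_E_Int[OF G(2,1)])
    have "(\<lambda>k. emeasure M (?B \<inter> pre (int k) ?B)) \<longlonglongrightarrow> 0"
    \<comment> \<open>The property of \<open>N0\<close> concerns sets of positive measure; for a
      null set the overlaps vanish identically.\<close>
    proof (cases "emeasure M ?B = 0")
      case True
      have "emeasure M (?B \<inter> pre (int k) ?B) = 0" for k by (rule emeasure_eq_0[OF B True Int_lower1])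
      then show ?thesis by (simp only: tendsto_const)
    next
      case False
      then have "0 < emeasure M ?B" by (simp add: zero_less_iff_neq_zero)
      from N0[OF B _ this Bfin] show ?thesis unfolding iter[OF B] by blast
    qed
    then have "(\<lambda>k. measure M (?B \<inter> pre (int k) ?B)) \<longlonglongrightarrow> 0"
      unfolding measure_def by (rule tendsto_enn2real[of _ 0, simplified])
    then show "(\<lambda>k. m.mean (G \<inter> pre (int k) G)) \<longlonglongrightarrow> 0"
      by (simp add: swap[OF invm G(1)] m.mean_def)
  qed
  have bern: "bernoulli P_B (suspension_map M T)"
  proof -
    obtain W' where W': "wandering M T W'" "sym_diff D (\<Union>n. pre n W') \<in> null_sets M"
      using ex_wandering_generator[OF D] .
    obtain \<nu> where \<nu>: "lebesgue_prob_space \<nu>" "equivalent_measures M \<nu>"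
      using assms(1) unfolding dynamical_system_def by blast
    have W's: "W' \<in> sets M" using W'(1) by (simp add: wandering_iff)
    \<comment> \<open>The generator is shrunk by a null set to one with a coordinate. It stays
      wandering as a subset, and the translates of what is lost form a null set.\<close>
    obtain W \<phi> where W: "W \<in> sets M" "W \<subseteq> W'" "W' - W \<in> null_sets M" "borel_coordinate M W \<phi>"
      using ex_borel_coordinate[OF \<nu> A W's] .
    have wW: "wandering M T W"
      using W'(1) W(1) pre_mono[OF W(2)] unfolding wandering_iff disjoint_family_on_def by blast
    have "(\<Union>n. pre n (W' - W)) \<in> null_sets M" using null_sets_pre[OF W(3)] by (intro null_sets_UN)
    then have "sym_diff D (\<Union>n. pre n W') \<union> (\<Union>n. pre n (W' - W)) \<in> null_sets M" using W'(2) by blast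
    then have DW: "sym_diff D (\<Union>n. pre n W) \<in> null_sets M"
    proof (rule null_sets_subset)
      show "sym_diff D (\<Union>n. pre n W) \<in> sets M"
        using W(1) invariantD(1)[OF inv(5)] by (intro sets_sym_diff sets.countable_UN) auto
      show "sym_diff D (\<Union>n. pre n W) \<subseteq> sym_diff D (\<Union>n. pre n W') \<union> (\<Union>n. pre n (W' - W))"
        using W(2) by (auto simp: pre_def)
    qed
    interpret B: bernoulli_coding M T A D P_B W \<phi>
    proof (intro bernoulli_coding.intro bernoulli_coding_axioms.intro wW DW W(4))
      show "poisson_suspension M T A D P_B"
        by (rule poisson_suspensionI[OF mpt A _ inv(5)]) (use assms(4,8) in simp)
    qed
    show ?thesis by (rule B.bernoulli_suspension)
  qed
  show ?thesis using ne wmix nmix mixm bern by blast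
qed

end
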